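(* Let $q\in\Bbbk$ be nonzero with $q=1$ or $q$ not a root of unity, and let $\mathcal{D}_q$ be the tensor category of finite dimensional right $\Bbbk\mathcal{A}(q)$-comodules. Then the Green ring $\mathcal{GR}(\mathcal{D}_q)$ is isomorphic to $\mathbb{Z}[x,x^{-1},y]$.
   Context: $\Bbbk$ is an algebraically closed field of characteristic $0$. For $q\in\Bbbk$ and integers $l,m\ge 0$ put $l_q=1+q+\cdots+q^{l-1}$, $l!_q=1_q\cdots l_q$, and let $\binom{l+m}{l}_q=\frac{(l+m)!_q}{l!_q\,m!_q}$ be the Gaussian binomial coefficient (a polynomial in $q$, evaluated at $q$). For $0\ne q\in\Bbbk$, $\Bbbk\mathcal{A}(q)$ is the Hopf algebra with $\Bbbk$-basis $\{p_i^l\mid i\in\mathbb{Z},\ l\ge 0\}$ ($p_i^l$ is the path of length $l$ starting at vertex $i$ of the infinite linear quiver, with vertex set $\mathbb{Z}$ and one arrow $i\to i+1$ for each $i$), comultiplication $\Delta(p_i^l)=\sum_{j=0}^{l}p_{i+j}^{l-j}\otimes p_i^{j}$, counit $\varepsilon(p_i^l)=\delta_{l,0}$, multiplication $p_i^l\cdot p_j^m=q^{im}\binom{l+m}{l}_q\,p_{i+j}^{l+m}$, and unit $p_0^0$. $\mathcal{D}_q$ is the tensor category of finite dimensional right $\Bbbk\mathcal{A}(q)$-comodules, where the comodule structure of $U\otimes V$ is $u\otimes v\mapsto u_0\otimes v_0\otimes u_1v_1$ (Sweedler notation). The Green ring $\mathcal{GR}(\mathcal{C})$ of a tensor category $\mathcal{C}$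 is the abelian group generated by the isomorphism classes $[X]$ of objects of $\mathcal{C}$ modulo all split short exact sequences (i.e. $[X\oplus Y]=[X]+[Y]$), with multiplication $[X]\cdot[Y]=[X\otimes Y]$. *)

theory Defs
  imports
    "HOL-Algebra.Free_Abelian_Groups"
    "HOL-Algebra.QuotRing"
    "HOL-Algebra.Algebraic_Closure_Type"
    "HOL-Computational_Algebra.Computational_Algebra"
    "HOL-Library.Poly_Mapping"
    "HOL-Library.Product_Plus"
begin

text \<open>
  The vector space with basis all elements of the type \<open>'x\<close> is
  \<^typ>\<open>'x \<Rightarrow>\<^sub>0 'k\<close>; the one with basis a set \<open>B\<close> is its subspace of vectors supported in
  \<open>B :: 'x set\<close>. Tensor products of such spaces have the product type as basis, direct sums
  the sum type. Linear maps are given by their values on basis vectors and extended by \<open>lin_ext\<close>.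
\<close>

section \<open>Vector spaces with a basis\<close>

abbreviation bvec :: "'x \<Rightarrow> ('x \<Rightarrow>\<^sub>0 'k::field)" where
  "bvec x \<equiv> Poly_Mapping.single x 1"

definition vscale :: "'k::field \<Rightarrow> ('x \<Rightarrow>\<^sub>0 'k) \<Rightarrow> ('x \<Rightarrow>\<^sub>0 'k)" where
  "vscale c v = Poly_Mapping.map ((*) c) v"

definition vspace :: "'x set \<Rightarrow> ('x \<Rightarrow>\<^sub>0 'k::field) set" where
  "vspace B = {v. Poly_Mapping.keys v \<subseteq> B}"

definition lin_ext :: "('x \<Rightarrow> ('y \<Rightarrow>\<^sub>0 'k::field)) \<Rightarrow> ('x \<Rightarrow>\<^sub>0 'k) \<Rightarrow> ('y \<Rightarrow>\<^sub>0 'k)" where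
  "lin_ext f v = (\<Sum>x \<in> Poly_Mapping.keys v. vscale (Poly_Mapping.lookup v x) (f x))"

definition tensor_vec ::
  "('x \<Rightarrow>\<^sub>0 'k::field) \<Rightarrow> ('y \<Rightarrow>\<^sub>0 'k) \<Rightarrow> ('x \<times> 'y \<Rightarrow>\<^sub>0 'k)" where
  "tensor_vec u v = lin_ext (\<lambda>x. lin_ext (\<lambda>y. bvec (x, y)) v) u"

definition tensor_map ::
  "('x \<Rightarrow> ('z \<Rightarrow>\<^sub>0 'k::field)) \<Rightarrow> ('y \<Rightarrow> ('w \<Rightarrow>\<^sub>0 'k)) \<Rightarrow> ('x \<times> 'y \<Rightarrow> ('z \<times> 'w \<Rightarrow>\<^sub>0 'k))" where
  "tensor_map f g = (\<lambda>(x, y). tensor_vec (f x) (g y))"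


section \<open>Bialgebras with a basis and their finite dimensional right comodules\<close>

record (overloaded) ('h, 'k) bialgebra =
  h_mult :: "'h \<Rightarrow> 'h \<Rightarrow> ('h \<Rightarrow>\<^sub>0 'k)"
  h_unit :: "'h \<Rightarrow>\<^sub>0 'k"
  h_comult :: "'h \<Rightarrow> ('h \<times> 'h \<Rightarrow>\<^sub>0 'k)"
  h_counit :: "'h \<Rightarrow> 'k"

text \<open>
  The comodule with basis \<open>B = basis M\<close> has underlying vector space \<open>vspace B\<close> and structure
  map \<open>lin_ext (coact M)\<close> from \<open>V\<close> to \<open>V \<otimes> H\<close>.
\<close>

record (overloaded) ('b, 'h, 'k) comodule =
  basis :: "'b set"
  coact :: "'b \<Rightarrow> ('b \<times> 'h \<Rightarrow>\<^sub>0 'k)"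

definition is_comodule ::
  "('h, 'k::field) bialgebra \<Rightarrow> ('b, 'h, 'k) comodule \<Rightarrow> bool" where
  "is_comodule H M \<longleftrightarrow>
     finite (basis M) \<and>
     (\<forall>b \<in> basis M. coact M b \<in> vspace (basis M \<times> UNIV)) \<and>
     (\<forall>b \<in> basis M.
        lin_ext (\<lambda>((a, h), h'). bvec (a, (h, h'))) (lin_ext (tensor_map (coact M) bvec) (coact M b))
        = lin_ext (tensor_map bvec (h_comult H)) (coact M b)) \<and>
     (\<forall>b \<in> basis M.
        lin_ext (\<lambda>(a, h). Poly_Mapping.single a (h_counit H h)) (coact M b) = bvec b)"

definition comodule_hom ::
  "('b, 'h, 'k::field) comodule \<Rightarrow> ('c, 'h, 'k) comodule \<Rightarrow> ('b \<Rightarrow> ('c \<Rightarrow>\<^sub>0 'k)) \<Rightarrow> bool" where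
  "comodule_hom M N f \<longleftrightarrow>
     (\<forall>b \<in> basis M. f b \<in> vspace (basis N)) \<and>
     (\<forall>b \<in> basis M. lin_ext (coact N) (f b) = lin_ext (tensor_map f bvec) (coact M b))"

definition comodule_iso :: "('b, 'h, 'k::field) comodule \<Rightarrow> ('c, 'h, 'k) comodule \<Rightarrow> bool" where
  "comodule_iso M N \<longleftrightarrow>
     (\<exists>f. comodule_hom M N f \<and> bij_betw (lin_ext f) (vspace (basis M)) (vspace (basis N)))"

definition direct_sum ::
  "('b, 'h, 'k::field) comodule \<Rightarrow> ('c, 'h, 'k) comodule \<Rightarrow> ('b + 'c, 'h, 'k) comodule" where
  "direct_sum M N =
     \<lparr> basis = basis M <+> basis N,
       coact = case_sum (\<lambda>b. lin_ext (\<lambda>(a, h). bvec (Inl a, h)) (coact M b))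
                        (\<lambda>c. lin_ext (\<lambda>(a, h). bvec (Inr a, h)) (coact N c)) \<rparr>"

text \<open>\<open>u \<otimes> v \<mapsto> u\<^sub>0 \<otimes> v\<^sub>0 \<otimes> u\<^sub>1 v\<^sub>1\<close>:\<close>

definition tensor_prod ::
  "('h, 'k::field) bialgebra \<Rightarrow> ('b, 'h, 'k) comodule \<Rightarrow> ('c, 'h, 'k) comodule
     \<Rightarrow> ('b \<times> 'c, 'h, 'k) comodule" where
  "tensor_prod H U V =
     \<lparr> basis = basis U \<times> basis V,
       coact = (\<lambda>(b, c).
         lin_ext (\<lambda>((u\<^sub>0, u\<^sub>1), (v\<^sub>0, v\<^sub>1)). tensor_vec (bvec (u\<^sub>0, v\<^sub>0)) (h_mult H u\<^sub>1 v\<^sub>1))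
           (tensor_vec (coact U b) (coact V c))) \<rparr>"

definition unit_comodule :: "('h, 'k::field) bialgebra \<Rightarrow> (unit, 'h, 'k) comodule" where
  "unit_comodule H = \<lparr> basis = {()}, coact = (\<lambda>_. tensor_vec (bvec ()) (h_unit H)) \<rparr>"


section \<open>The Green ring\<close>

text \<open>
  The objects are the comodules whose basis is a finite set of natural numbers; every
  finite dimensional comodule is isomorphic to one of these. Thus \<open>iso_class H M\<close> is an
  isomorphism class of objects also if the basis of \<open>M\<close> lives in a type other than \<^typ>\<open>nat\<close>,
  as it does for direct sums and tensor products of objects.
\<close>

type_synonym ('h, 'k) object_class = "(nat, 'h, 'k) comodule set"

definition iso_class ::
  "('h, 'k::field) bialgebra \<Rightarrow> ('b, 'h, 'k) comodule \<Rightarrow> ('h, 'k) object_class" where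
  "iso_class H M = {U. is_comodule H U \<and> comodule_iso U M}"

definition iso_classes :: "('h, 'k::field) bialgebra \<Rightarrow> ('h, 'k) object_class set" where
  "iso_classes H = {iso_class H U | U :: (nat, 'h, 'k) comodule. is_comodule H U}"

definition tensor_class ::
  "('h, 'k::field) bialgebra \<Rightarrow> ('h, 'k) object_class \<Rightarrow> ('h, 'k) object_class
     \<Rightarrow> ('h, 'k) object_class" where
  "tensor_class H A B = (\<Union>U\<in>A. \<Union>V\<in>B. iso_class H (tensor_prod H U V))"

definition free_green_ring ::
  "('h, 'k::field) bialgebra \<Rightarrow> (('h, 'k) object_class \<Rightarrow>\<^sub>0 int) ring" where
  "free_green_ring H =
     \<lparr> carrier = carrier (free_Abelian_group (iso_classes H)),
       monoid.mult = (\<lambda>a b. frag_extend (\<lambda>A. frag_extend (\<lambda>B. frag_of (tensor_class H A B)) b) a),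
       one = frag_of (iso_class H (unit_comodule H)),
       zero = 0,
       add = (+) \<rparr>"

definition split_relations ::
  "('h, 'k::field) bialgebra \<Rightarrow> (('h, 'k) object_class \<Rightarrow>\<^sub>0 int) set" where
  "split_relations H =
     {frag_of (iso_class H (direct_sum U V)) - (frag_of (iso_class H U) + frag_of (iso_class H V))
      | (U :: (nat, 'h, 'k) comodule) (V :: (nat, 'h, 'k) comodule). is_comodule H U \<and> is_comodule H V}"

text \<open>
  The subgroup generated by the split relations is already a two-sided ideal, because
  the tensor product distributes over direct sums.
\<close>

definition green_ring ::
  "('h, 'k::field) bialgebra \<Rightarrow> (('h, 'k) object_class \<Rightarrow>\<^sub>0 int) set ring" where
  "green_ring H =
     free_green_ring H Quot
       generate (free_Abelian_group (iso_classes H)) (split_relations H)"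


section \<open>The Hopf algebra of the infinite linear quiver\<close>

definition q_int_poly :: "nat \<Rightarrow> 'k::field poly" where
  "q_int_poly l = (\<Sum>i<l. Polynomial.monom 1 i)"

definition q_fact_poly :: "nat \<Rightarrow> 'k::field poly" where
  "q_fact_poly l = (\<Prod>i\<in>{1..l}. q_int_poly i)"

text \<open>The division is exact and takes place before evaluation at \<open>q\<close>.\<close>

definition gauss_binomial :: "nat \<Rightarrow> nat \<Rightarrow> 'k::field \<Rightarrow> 'k" where
  "gauss_binomial l m q =
     poly (q_fact_poly (l + m) div (q_fact_poly l * q_fact_poly m)) q"

text \<open>The pair \<open>(i, l)\<close> stands for the path \<open>p\<^sub>i\<^sup>l\<close> of length \<open>l\<close> starting at vertex \<open>i\<close>.\<close>

definition path_hopf :: "'k::field \<Rightarrow> (int \<times> nat, 'k) bialgebra" where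
  "path_hopf q =
     \<lparr> h_mult = (\<lambda>(i, l) (j, m).
         Poly_Mapping.single (i + j, l + m) (q powi (i * int m) * gauss_binomial l m q)),
       h_unit = bvec (0, 0),
       h_comult = (\<lambda>(i, l). \<Sum>j\<le>l. bvec ((i + int j, l - j), (i, j))),
       h_counit = (\<lambda>(i, l). if l = 0 then 1 else 0) \<rparr>"


section \<open>The ring of polynomials in \<open>y\<close> and Laurent polynomials in \<open>x\<close>\<close>

text \<open>
  This is the monoid ring of \<open>\<int> \<times> \<nat>\<close> over the integers, with the
  convolution product of \<^typ>\<open>int \<times> nat \<Rightarrow>\<^sub>0 int\<close>: the key \<open>(i, m)\<close> is the monomial \<open>x\<^sup>i y\<^sup>m\<close>.
\<close>

abbreviation laurent_xy :: "(int \<times> nat \<Rightarrow>\<^sub>0 int) ring" where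
  "laurent_xy \<equiv> ring_of_type_algebra"

end

theory Submission
  imports Defs
begin

text \<open>
  A comodule over the path coalgebra is a graded space with a raising operator \<open>D\<close> of degree one. It is
  a direct sum of strings \<open>M(i, l)\<close>, one Jordan block of \<open>D\<close> in the degrees \<open>i, \<dots>, i + l\<close>, and the ranks of the
  powers of \<open>D\<close> on the graded components determine the multiplicities of the strings. On a tensor
  product \<open>D (u \<otimes> v) = D u \<otimes> v + q\<^sup>i u \<otimes> D v\<close> for \<open>u\<close> of degree \<open>i\<close>. As no \<open>1 + q + \<dots> + q\<^sup>l\<close> vanishes, this gives
  \<open>M(i, 0) \<otimes> M(j, l) = M(i + j, l)\<close> and \<open>M(0, 1) \<otimes> M(j, l) = M(j, l + 1) \<oplus> M(j + 1, l - 1)\<close>.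
  Sending \<open>M(i, l)\<close> to \<open>x\<^sup>i S\<^sub>l\<close> with \<open>S\<^sub>0 = 1\<close>, \<open>S\<^sub>1 = y\<close>, \<open>S\<^sub>l\<^sub>+\<^sub>2 = y S\<^sub>l\<^sub>+\<^sub>1 - x S\<^sub>l\<close> therefore maps a basis of the Green
  ring to a basis of the Laurent polynomial ring. It is multiplicative: \<open>[M \<otimes> N] = [M] [N]\<close> holds for the
  two kinds of generators \<open>M\<close> by the rules above, and then for every string \<open>M\<close> by associativity
  and induction on \<open>l\<close>.
\<close>

section \<open>Linear maps between spaces with a basis\<close>

text \<open>The ranks of the operators \<open>act\<close> are isomorphism invariant and additive and
  involve no choice of a decomposition. Hence it suffices to prove that a decomposition into strings
  exists; its uniqueness is read off from the ranks. Products of two long strings are never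
  decomposed, since that would require explicit lowest vectors with complicated
  \<open>q\<close>-coefficients. With the factor \<open>string 0 1\<close> there is a single such
  vector to find, and the change of basis has coefficients that are powers of \<open>q\<close> times
  one quantum integer; this is where the condition on \<open>q\<close> acts. \<open>S_l\<close> is
  \<open>y^l\<close> plus terms of lower degree in \<open>y\<close> whose coefficients are integer
  multiples of powers of \<open>x\<close>, so strings and monomials are related by a triangular
  matrix. Its inverse is obtained without elimination, by iterating multiplication by
  \<open>y\<close>, written in the string basis, on the powers of \<open>x\<close>. Direct sums and
  tensor products leave the basis type \<open>nat\<close>. Inductions are therefore run over
  comodules on \<open>nat\<close>, and their results are carried to other basis types by isomorphism
  invariance.\<close>

lemma lookup_vscale [simp]: "Poly_Mapping.lookup (vscale c v) x = c * Poly_Mapping.lookup v x"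
  by (simp add: vscale_def map.rep_eq when_def)

lemma vector_space_vscale: "vector_space vscale"
  by unfold_locales (auto intro!: poly_mapping_eqI simp: lookup_add algebra_simps)

global_interpretation vs: vector_space "vscale :: 'k::field \<Rightarrow> ('x \<Rightarrow>\<^sub>0 'k) \<Rightarrow> ('x \<Rightarrow>\<^sub>0 'k)"
  by (rule vector_space_vscale)

global_interpretation vp: vector_space_pair
  "vscale :: 'k::field \<Rightarrow> ('x \<Rightarrow>\<^sub>0 'k) \<Rightarrow> ('x \<Rightarrow>\<^sub>0 'k)"
  "vscale :: 'k::field \<Rightarrow> ('y \<Rightarrow>\<^sub>0 'k) \<Rightarrow> ('y \<Rightarrow>\<^sub>0 'k)"
  by unfold_locales

abbreviation lin :: "(('x \<Rightarrow>\<^sub>0 'k::field) \<Rightarrow> ('y \<Rightarrow>\<^sub>0 'k)) \<Rightarrow> bool" where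
  "lin \<equiv> Vector_Spaces.linear vscale vscale"

lemma linI:
  assumes "\<And>u v. F (u + v) = F u + F v" "\<And>c v. F (vscale c v) = vscale c (F v)"
  shows "lin F"
  by unfold_locales (use assms in auto)

lemmas lin_add = vp.linear_add
  and lin_scale = vp.linear_scale
  and lin_0 = vp.linear_0
  and lin_sum = vp.linear_sum

lemma lin_compose: "lin F \<Longrightarrow> lin G \<Longrightarrow> lin (\<lambda>v. G (F v))"
  by (intro linI) (simp_all add: lin_add lin_scale)

lemma lin_plus: "lin F \<Longrightarrow> lin G \<Longrightarrow> lin (\<lambda>v. F v + G v)"
  by (intro linI) (simp_all add: lin_add lin_scale vs.scale_right_distrib)

lemma lin_const_zero: "lin (\<lambda>v. 0)"
  by (intro linI) simp_all

lemma lin_id: "lin (\<lambda>v. v)"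
  by (intro linI) simp_all

lemma lin_sums: "(\<And>i. i \<in> I \<Longrightarrow> lin (F i)) \<Longrightarrow> lin (\<lambda>v. \<Sum>i\<in>I. F i v)"
  by (induction I rule: infinite_finite_induct) (simp_all add: lin_const_zero lin_plus)

lemma lookup_lin_ext:
  "Poly_Mapping.lookup (lin_ext f v) y =
     (\<Sum>x\<in>Poly_Mapping.keys v. Poly_Mapping.lookup v x * Poly_Mapping.lookup (f x) y)"
  by (simp add: lin_ext_def lookup_sum)

lemma lin_ext_superset:
  assumes "finite S" "Poly_Mapping.keys v \<subseteq> S"
  shows "lin_ext f v = (\<Sum>x\<in>S. vscale (Poly_Mapping.lookup v x) (f x))"
  unfolding lin_ext_def
  by (rule sum.mono_neutral_left) (use assms in \<open>auto simp: in_keys_iff\<close>)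

lemma lin_lin_ext:
  fixes f :: "'x \<Rightarrow> ('y \<Rightarrow>\<^sub>0 'k::field)"
  shows "lin (lin_ext f)"
proof (rule linI)
  fix u v :: "'x \<Rightarrow>\<^sub>0 'k"
  let ?S = "Poly_Mapping.keys u \<union> Poly_Mapping.keys v"
  have "Poly_Mapping.keys (u + v) \<subseteq> ?S"
    by (rule keys_add)
  then show "lin_ext f (u + v) = lin_ext f u + lin_ext f v"
    by (simp add: lin_ext_superset[where S = ?S] lookup_add vs.scale_left_distrib sum.distrib)
next
  fix c and v :: "'x \<Rightarrow>\<^sub>0 'k"
  have "Poly_Mapping.keys (vscale c v) \<subseteq> Poly_Mapping.keys v"
    by (auto simp: in_keys_iff)
  then show "lin_ext f (vscale c v) = vscale c (lin_ext f v)"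
    by (simp add: lin_ext_superset[where S = "Poly_Mapping.keys v"] vs.scale_sum_right)
qed

lemma lin_ext_bvec [simp]: "lin_ext f (bvec x) = f x"
  by (simp add: lin_ext_def)

lemma lin_ext_bvec_id: "lin_ext bvec v = v"
proof (rule poly_mapping_eqI)
  fix y
  have "(\<Sum>x\<in>Poly_Mapping.keys v. Poly_Mapping.lookup v x * Poly_Mapping.lookup (bvec x) y)
    = (\<Sum>x\<in>Poly_Mapping.keys v. if x = y then Poly_Mapping.lookup v x else 0)"
    by (intro sum.cong) (auto simp: lookup_single when_def)
  then show "Poly_Mapping.lookup (lin_ext bvec v) y = Poly_Mapping.lookup v y"
    unfolding lookup_lin_ext by (simp add: in_keys_iff lookup_single when_def eq_commute[of y])
qed

lemma vec_expand: "v = (\<Sum>x\<in>Poly_Mapping.keys v. vscale (Poly_Mapping.lookup v x) (bvec x))"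
  using lin_ext_bvec_id[of v] unfolding lin_ext_def by simp

lemma lin_eq_lin_ext:
  assumes "lin F"
  shows "lin_ext (\<lambda>x. F (bvec x)) v = F v"
proof -
  have "F v = F (\<Sum>x\<in>Poly_Mapping.keys v. vscale (Poly_Mapping.lookup v x) (bvec x))"
    using vec_expand[of v] by simp
  then show ?thesis
    by (simp add: lin_sum[OF assms] lin_scale[OF assms] lin_ext_def)
qed

lemma lin_ext_cong: "(\<And>x. x \<in> Poly_Mapping.keys v \<Longrightarrow> f x = g x) \<Longrightarrow> lin_ext f v = lin_ext g v"
  by (simp add: lin_ext_def)

lemma lin_ext_cong_vspace:
  "v \<in> vspace B \<Longrightarrow> (\<And>x. x \<in> B \<Longrightarrow> f x = g x) \<Longrightarrow> lin_ext f v = lin_ext g v"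
  by (rule lin_ext_cong) (auto simp: vspace_def)

lemma lin_eq_on:
  assumes "lin F" "lin G" "v \<in> vspace B" "\<And>x. x \<in> B \<Longrightarrow> F (bvec x) = G (bvec x)"
  shows "F v = G v"
  using lin_ext_cong_vspace[OF assms(3), of "\<lambda>x. F (bvec x)" "\<lambda>x. G (bvec x)"] assms
  by (simp add: lin_eq_lin_ext)

lemma vspace_UNIV: "v \<in> vspace UNIV"
  by (simp add: vspace_def)

lemma bvec_in_vspace [simp]: "bvec x \<in> vspace B \<longleftrightarrow> x \<in> B"
  by (simp add: vspace_def)

lemma zero_in_vspace [simp]: "0 \<in> vspace B"
  by (simp add: vspace_def)

lemma add_in_vspace: "u \<in> vspace B \<Longrightarrow> v \<in> vspace B \<Longrightarrow> u + v \<in> vspace B"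
  using keys_add[of u v] by (auto simp: vspace_def)

lemma vscale_in_vspace: "v \<in> vspace B \<Longrightarrow> vscale c v \<in> vspace B"
  by (auto simp: vspace_def in_keys_iff)

lemma subspace_vspace: "vs.subspace (vspace B)"
  by (rule vs.subspaceI) (simp_all add: add_in_vspace vscale_in_vspace)

lemma sum_in_vspace: "(\<And>i. i \<in> I \<Longrightarrow> f i \<in> vspace B) \<Longrightarrow> sum f I \<in> vspace B"
  by (rule vs.subspace_sum[OF subspace_vspace])

lemma lin_in_subspace:
  assumes "lin F" "v \<in> vspace B" "vs.subspace W" "\<And>x. x \<in> B \<Longrightarrow> F (bvec x) \<in> W"
  shows "F v \<in> W"
proof -
  have "lin_ext (\<lambda>x. F (bvec x)) v \<in> W"
    unfolding lin_ext_def using assms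
    by (intro vs.subspace_sum vs.subspace_scale) (auto simp: vspace_def)
  then show ?thesis
    by (simp add: lin_eq_lin_ext assms)
qed

lemma lin_ext_in_vspace:
  assumes "v \<in> vspace B" "\<And>x. x \<in> B \<Longrightarrow> f x \<in> vspace C"
  shows "lin_ext f v \<in> vspace C"
  by (rule lin_in_subspace[OF lin_lin_ext assms(1) subspace_vspace]) (simp add: assms)

lemma vspace_eq_span: "(vspace B :: ('x \<Rightarrow>\<^sub>0 'k::field) set) = vs.span (bvec ` B)" (is "?V = ?S")
proof
  show "?V \<subseteq> ?S"
  proof
    fix v :: "'x \<Rightarrow>\<^sub>0 'k" assume v: "v \<in> vspace B"
    have "lin_ext bvec v \<in> vs.span (bvec ` B)"
      by (rule lin_in_subspace[OF lin_lin_ext v vs.subspace_span]) (simp add: vs.span_base)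
    then show "v \<in> vs.span (bvec ` B)"
      by (simp add: lin_ext_bvec_id)
  qed
  show "?S \<subseteq> ?V"
    by (rule vs.span_minimal[OF _ subspace_vspace]) auto
qed

lemma inj_bvec: "inj_on (bvec :: 'x \<Rightarrow> ('x \<Rightarrow>\<^sub>0 'k::field)) A"
  by (rule inj_onI) (metis keys_single singleton_inject zero_neq_one)

lemma independent_bvec: "vs.independent (bvec ` B :: ('x \<Rightarrow>\<^sub>0 'k::field) set)"
proof (rule vs.independent_mono[OF _ image_mono[OF subset_UNIV]])
  show "vs.independent (range (bvec :: 'x \<Rightarrow> ('x \<Rightarrow>\<^sub>0 'k)))"
    unfolding vs.dependent_def
  proof clarify
    fix x :: 'x assume "bvec x \<in> vs.span (range bvec - {bvec x :: 'x \<Rightarrow>\<^sub>0 'k})"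
    moreover have "range bvec - {bvec x :: 'x \<Rightarrow>\<^sub>0 'k} \<subseteq> bvec ` (UNIV - {x})"
      by auto
    ultimately have "bvec x \<in> (vspace (UNIV - {x}) :: ('x \<Rightarrow>\<^sub>0 'k) set)"
      unfolding vspace_eq_span by (rule vs.span_mono[THEN subsetD, rotated])
    then show False
      by simp
  qed
qed

section \<open>Dimensions, linear coordinates and linear bijections\<close>

lemma dim_bij_vspace:
  fixes F :: "('x \<Rightarrow>\<^sub>0 'k::field) \<Rightarrow> ('y \<Rightarrow>\<^sub>0 'k)"
  assumes "lin F" "bij_betw F (vspace S) W"
  shows "vs.dim W = card S"
proof -
  let ?C = "F ` bvec ` S"
  have inj: "inj_on F (vs.span (bvec ` S))" and im: "F ` vs.span (bvec ` S) = W"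
    using assms(2) by (auto simp: bij_betw_def vspace_eq_span)
  have "vs.independent ?C"
    using vp.linear_independent_injective_image[OF assms(1) independent_bvec inj] .
  moreover have "vs.span ?C = W"
    using vp.linear_span_image[OF assms(1)] im by metis
  moreover have "card ?C = card S"
    using inj inj_on_subset[OF inj vs.span_superset] inj_bvec by (metis card_image)
  ultimately show ?thesis
    using vs.dim_span_eq_card_independent by metis
qed

text \<open>Coordinates indexed by natural numbers serve twice: they measure ranks, and they turn a
  stable subspace into an object whose basis has the type that the Green ring uses.\<close>

lemma subspace_param:
  fixes W :: "('x \<Rightarrow>\<^sub>0 'k::field) set"
  assumes "vs.subspace W" "W \<subseteq> vspace B" "finite B"
  obtains F :: "(nat \<Rightarrow>\<^sub>0 'k) \<Rightarrow> ('x \<Rightarrow>\<^sub>0 'k)" and n where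
    "lin F" "bij_betw F (vspace {..<n}) W"
proof -
  obtain C where C: "C \<subseteq> W" "vs.independent C" "W \<subseteq> vs.span C"
    using vs.maximal_independent_subset by blast
  have "finite C"
    using vs.independent_span_bound[of "bvec ` B" C] C assms by (auto simp: vspace_eq_span)
  then obtain g n where g: "bij_betw g {..<n::nat} C"
    using ex_bij_betw_nat_finite[of C] by (auto simp: atLeast0LessThan)
  let ?F = "lin_ext g"
  have span: "vs.span C = W"
    using C assms vs.span_minimal by blast
  have gC: "g ` {..<n} = C" "inj_on g {..<n}"
    using g by (auto simp: bij_betw_def)
  have img: "?F ` bvec ` {..<n} = C"
    using gC by (auto simp: image_image)
  have "?F ` vspace {..<n} = W"
    unfolding vspace_eq_span
    using vp.linear_span_image[OF lin_lin_ext, of g "bvec ` {..<n}"] img span by metis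
  moreover have "inj_on ?F (vspace {..<n})"
    unfolding vspace_eq_span
  proof (rule vp.linear_inj_on_span_independent_image[OF lin_lin_ext])
    show "vs.independent (?F ` bvec ` {..<n})"
      using img C by simp
    show "inj_on ?F (bvec ` {..<n})"
      using gC(2) by (auto simp: inj_on_def)
  qed
  ultimately show thesis
    using that[of ?F n] by (simp add: lin_lin_ext bij_betw_def)
qed

lemma lin_inverse:
  fixes F :: "('x \<Rightarrow>\<^sub>0 'k::field) \<Rightarrow> ('y \<Rightarrow>\<^sub>0 'k)"
  assumes "lin F" "bij_betw F (vspace S) W"
  obtains G where "lin G" "\<And>v. v \<in> vspace S \<Longrightarrow> G (F v) = v"
    "\<And>w. w \<in> W \<Longrightarrow> G w \<in> vspace S" "\<And>w. w \<in> W \<Longrightarrow> F (G w) = w"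
proof -
  have "inj_on F (vs.span (bvec ` S))" and im: "F ` vspace S = W"
    using assms(2) by (auto simp: bij_betw_def vspace_eq_span)
  then obtain G where G: "lin G" "\<And>v. v \<in> vs.span (bvec ` S) \<Longrightarrow> G (F v) = v"
    using vp.linear_inj_on_left_inverse[OF assms(1)] by (metis vspace_eq_span)
  show thesis
    by (rule that[of G]) (use G im in \<open>auto simp: vspace_eq_span\<close>)
qed

lemma bij_betw_lin_vspaceI:
  assumes "lin F" "F ` vspace S \<subseteq> W" "\<And>w. w \<in> W \<Longrightarrow> G w \<in> vspace S"
    "\<And>w. w \<in> W \<Longrightarrow> F (G w) = w" "\<And>v. v \<in> vspace S \<Longrightarrow> G (F v) = v"
  shows "bij_betw F (vspace S) W"
  by (rule bij_betw_byWitness[where f' = G]) (use assms in auto)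

text \<open>The images of the basis vectors span a space of dimension \<open>card S\<close>. A basis
  chosen among these at most \<open>card S\<close> vectors must use all of them, so they are
  independent and pairwise distinct.\<close>

lemma lin_surj_imp_bij:
  fixes F :: "('x \<Rightarrow>\<^sub>0 'k::field) \<Rightarrow> ('y \<Rightarrow>\<^sub>0 'k)"
  assumes "lin F" "F ` vspace S \<subseteq> vspace T" "finite S" "card S = card T"
    "\<And>t. t \<in> T \<Longrightarrow> bvec t \<in> F ` vspace S"
  shows "bij_betw F (vspace S) (vspace T)"
proof -
  let ?C = "F ` bvec ` S"
  have span: "vs.span ?C = F ` vspace S"
    unfolding vspace_eq_span using vp.linear_span_image[OF assms(1)] .
  have "vspace T \<subseteq> F ` vspace S"
    unfolding vspace_eq_span[of T] span[symmetric]
    by (rule vs.span_minimal[OF _ vs.subspace_span]) (use assms(5) span in auto)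
  then have eq: "F ` vspace S = vspace T"
    using assms(2) by blast
  have "vs.dim (vspace T :: ('y \<Rightarrow>\<^sub>0 'k) set) = card T"
    by (rule dim_bij_vspace[OF lin_id]) (simp add: bij_betw_def)
  then have dim: "vs.dim ?C = card S"
    using assms(4) span eq by (metis vs.dim_span)
  have finC: "finite ?C"
    using assms(3) by simp
  obtain D where D: "D \<subseteq> ?C" "vs.independent D" "?C \<subseteq> vs.span D" "card D = vs.dim ?C"
    using vs.basis_exists by blast
  have "card ?C \<le> card S"
    using assms(3) card_image_le le_trans finite_imageI by metis
  then have "D = ?C"
    using D(1,4) dim finC by (metis card_seteq)
  then have ind: "vs.independent ?C" and card: "card ?C = card S"
    using D dim by auto
  have "card (bvec ` S :: ('x \<Rightarrow>\<^sub>0 'k) set) = card S"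
    by (rule card_image[OF inj_bvec])
  then have "inj_on F (bvec ` S)"
    using card assms(3) by (intro eq_card_imp_inj_on) auto
  then have "inj_on F (vspace S)"
    unfolding vspace_eq_span
    by (rule vp.linear_inj_on_span_independent_image[OF assms(1) ind])
  then show ?thesis
    using eq by (simp add: bij_betw_def)
qed

subsection \<open>Tensor products and coefficients\<close>

lemma lookup_tensor_vec [simp]:
  "Poly_Mapping.lookup (tensor_vec u v) (x, y) = Poly_Mapping.lookup u x * Poly_Mapping.lookup v y"
proof -
  have 1: "Poly_Mapping.lookup (lin_ext (\<lambda>y. bvec (x', y)) v) (x, y)
      = (if x' = x then Poly_Mapping.lookup v y else 0)" for x'
  proof -
    have "(\<Sum>y'\<in>Poly_Mapping.keys v. Poly_Mapping.lookup v y' * (1 when (x', y') = (x, y)))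
      = (\<Sum>y'\<in>Poly_Mapping.keys v. if y' = y then (if x' = x then Poly_Mapping.lookup v y else 0) else 0)"
      by (rule sum.cong) (auto simp: when_def)
    then show ?thesis
      by (auto simp: lookup_lin_ext lookup_single in_keys_iff)
  qed
  have "(\<Sum>x'\<in>Poly_Mapping.keys u. Poly_Mapping.lookup u x' * (if x' = x then Poly_Mapping.lookup v y else 0))
      = (\<Sum>x'\<in>Poly_Mapping.keys u. if x' = x then Poly_Mapping.lookup u x * Poly_Mapping.lookup v y else 0)"
    by (rule sum.cong) auto
  then show ?thesis
    unfolding tensor_vec_def lookup_lin_ext[of _ u] 1 by (auto simp: in_keys_iff)
qed

lemma poly_mapping_pair_eqI:
  assumes "\<And>x y. Poly_Mapping.lookup v (x, y) = Poly_Mapping.lookup w (x, y)"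
  shows "v = w"
  by (rule poly_mapping_eqI) (use assms in auto)

lemma lin_tensor_left: "lin (\<lambda>u. tensor_vec u v)"
  by (intro linI poly_mapping_pair_eqI) (simp_all add: lookup_add algebra_simps)

lemma lin_tensor_right: "lin (tensor_vec u)"
  by (intro linI poly_mapping_pair_eqI) (simp_all add: lookup_add algebra_simps)

lemma tensor_bvec [simp]: "tensor_vec (bvec x) (bvec y) = bvec (x, y)"
  by (intro poly_mapping_pair_eqI) (auto simp: lookup_single when_def)

lemma tensor_zero [simp]: "tensor_vec 0 v = 0" "tensor_vec u 0 = 0"
  by (intro poly_mapping_pair_eqI; simp)+

lemma tensor_scale [simp]:
  "tensor_vec (vscale c u) v = vscale c (tensor_vec u v)"
  "tensor_vec u (vscale c v) = vscale c (tensor_vec u v)"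
  by (simp_all add: lin_scale[OF lin_tensor_left] lin_scale[OF lin_tensor_right])

lemma tensor_add:
  "tensor_vec (u + u') v = tensor_vec u v + tensor_vec u' v"
  "tensor_vec u (v + v') = tensor_vec u v + tensor_vec u v'"
  by (simp_all add: lin_add[OF lin_tensor_left] lin_add[OF lin_tensor_right])

lemma tensor_sum:
  "tensor_vec (sum f I) v = (\<Sum>i\<in>I. tensor_vec (f i) v)"
  "tensor_vec u (sum g I) = (\<Sum>i\<in>I. tensor_vec u (g i))"
  by (simp_all add: lin_sum[OF lin_tensor_left] lin_sum[OF lin_tensor_right])

lemma tensor_in_vspace: "u \<in> vspace B \<Longrightarrow> v \<in> vspace C \<Longrightarrow> tensor_vec u v \<in> vspace (B \<times> C)"
  by (auto simp: vspace_def in_keys_iff)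

text \<open>For \<open>w \<in> V \<otimes> H\<close> one has \<open>w = \<Sum>\<^sub>h slice h w \<otimes> h\<close>.\<close>

definition slice :: "'h \<Rightarrow> ('b \<times> 'h \<Rightarrow>\<^sub>0 'k::field) \<Rightarrow> ('b \<Rightarrow>\<^sub>0 'k)" where
  "slice h = lin_ext (\<lambda>(a, h'). if h' = h then bvec a else 0)"

lemma lin_slice: "lin (slice h)"
  by (simp add: slice_def lin_lin_ext)

lemma slice_bvec: "slice h (bvec (a, h')) = (if h' = h then bvec a else 0)"
  by (simp add: slice_def)

lemma lookup_slice [simp]: "Poly_Mapping.lookup (slice h w) a = Poly_Mapping.lookup w (a, h)"
proof -
  have "(\<Sum>x\<in>Poly_Mapping.keys w. Poly_Mapping.lookup w x
          * Poly_Mapping.lookup (case x of (a, h') \<Rightarrow> if h' = h then bvec a else 0) a)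
      = (\<Sum>x\<in>Poly_Mapping.keys w. if x = (a, h) then Poly_Mapping.lookup w x else 0)"
    by (rule sum.cong) (auto simp: lookup_single when_def split: if_splits)
  then show ?thesis
    by (auto simp: slice_def lookup_lin_ext in_keys_iff)
qed

lemma slice_eqI: "(\<And>h. slice h v = slice h w) \<Longrightarrow> v = w"
  by (intro poly_mapping_pair_eqI) (metis lookup_slice)

lemma slice_tensor: "slice h (tensor_vec v w) = vscale (Poly_Mapping.lookup w h) v"
  by (rule poly_mapping_eqI) simp

lemma vspace_slice_iff: "w \<in> vspace (B \<times> UNIV) \<longleftrightarrow> (\<forall>h. slice h w \<in> vspace B)"
  by (auto simp: vspace_def in_keys_iff subset_iff)

lemma slice_expand:
  assumes "finite S" "\<And>h. slice h w \<noteq> 0 \<Longrightarrow> h \<in> S"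
  shows "w = (\<Sum>h\<in>S. tensor_vec (slice h w) (bvec h))"
proof (rule slice_eqI)
  fix h
  have "(\<Sum>h'\<in>S. vscale (Poly_Mapping.lookup (bvec h') h) (slice h' w))
      = (\<Sum>h'\<in>S. if h' = h then slice h w else 0)"
    by (rule sum.cong) (auto simp: lookup_single when_def)
  then have "slice h (\<Sum>h'\<in>S. tensor_vec (slice h' w) (bvec h'))
      = (\<Sum>h'\<in>S. if h' = h then slice h w else 0)"
    by (simp add: lin_sum[OF lin_slice] slice_tensor)
  also have "\<dots> = slice h w"
    using assms by auto
  finally show "slice h w = slice h (\<Sum>h'\<in>S. tensor_vec (slice h' w) (bvec h'))"
    by simp
qed

lemma finite_slice: "finite {h. slice h w \<noteq> 0}"
proof (rule finite_subset)
  show "{h. slice h w \<noteq> 0} \<subseteq> snd ` Poly_Mapping.keys w"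
  proof
    fix h assume "h \<in> {h. slice h w \<noteq> 0}"
    then obtain a where "Poly_Mapping.lookup w (a, h) \<noteq> 0"
      by (metis (mono_tags) lookup_slice lookup_zero mem_Collect_eq poly_mapping_eqI)
    then show "h \<in> snd ` Poly_Mapping.keys w"
      by (force simp: in_keys_iff)
  qed
qed simp

section \<open>Comodules as graded spaces with a raising operator\<close>

lemma lin_eqI:
  assumes "lin F" "lin G" "\<And>x. F (bvec x) = G (bvec x)"
  shows "F v = G v"
  by (rule lin_eq_on[OF assms(1,2) vspace_UNIV assms(3)])

lemma lin_ext_bvec_eq: "lin F \<Longrightarrow> lin_ext (\<lambda>x. F (bvec x)) = F"
  by (rule ext) (rule lin_eq_lin_ext)

text \<open>Allows a coaction to be prescribed by its coefficients; finiteness is what makes the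
  family come from an element of the algebraic tensor product.\<close>

lemma ex_slices:
  fixes g :: "'h \<Rightarrow> ('b \<Rightarrow>\<^sub>0 'k::field)"
  assumes "finite {h. g h \<noteq> 0}"
  shows "\<exists>w. \<forall>h. slice h w = g h"
proof (intro exI allI)
  fix h
  let ?S = "{h. g h \<noteq> 0}"
  have "slice h (\<Sum>h'\<in>?S. tensor_vec (g h') (bvec h'))
      = (\<Sum>h'\<in>?S. vscale (Poly_Mapping.lookup (bvec h') h) (g h'))"
    by (simp add: lin_sum[OF lin_slice] slice_tensor)
  also have "\<dots> = (\<Sum>h'\<in>?S. if h' = h then g h else 0)"
    by (rule sum.cong) (auto simp: lookup_single when_def)
  also have "\<dots> = g h"
    using assms by auto
  finally show "slice h (\<Sum>h'\<in>?S. tensor_vec (g h') (bvec h')) = g h" .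
qed

text \<open>
  Over the path coalgebra, \<open>act M (i, 0)\<close> is the projection to degree \<open>i\<close>, and \<open>act M (i, l)\<close> is the
  \<open>l\<close>-th power of the raising operator applied after it.
\<close>

definition act :: "('b, 'h, 'k::field) comodule \<Rightarrow> 'h \<Rightarrow> ('b \<Rightarrow>\<^sub>0 'k) \<Rightarrow> ('b \<Rightarrow>\<^sub>0 'k)" where
  "act M h v = slice h (lin_ext (coact M) v)"

lemma lin_act: "lin (act M h)"
  unfolding act_def by (rule lin_compose[OF lin_lin_ext lin_slice])

lemma act_bvec: "act M h (bvec b) = slice h (coact M b)"
  by (simp add: act_def)

lemma act_0 [simp]: "act M h 0 = 0"
  by (rule lin_0[OF lin_act])

lemma finite_act: "finite {h. act M h v \<noteq> 0}"
  by (simp add: act_def finite_slice)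

lemma finite_act_grade: "finite {i. act M (i, l) v \<noteq> 0}"
proof (rule finite_subset)
  show "{i. act M (i, l) v \<noteq> 0} \<subseteq> fst ` {h. act M h v \<noteq> 0}"
    by force
qed (simp add: finite_act)

lemma slice_tensor_map:
  fixes F :: "('b \<Rightarrow>\<^sub>0 'k::field) \<Rightarrow> ('c \<Rightarrow>\<^sub>0 'k)" and w :: "'b \<times> 'h \<Rightarrow>\<^sub>0 'k"
  assumes "lin F"
  shows "slice h (lin_ext (tensor_map (\<lambda>b. F (bvec b)) bvec) w) = F (slice h w)"
proof (rule lin_eqI[of _ _ w])
  show "lin (\<lambda>w. slice h (lin_ext (tensor_map (\<lambda>b. F (bvec b)) bvec) w))"
    by (rule lin_compose[OF lin_lin_ext lin_slice])
  show "lin (\<lambda>w. F (slice h w))"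
    by (rule lin_compose[OF lin_slice assms])
  fix x :: "'b \<times> 'h"
  show "slice h (lin_ext (tensor_map (\<lambda>b. F (bvec b)) bvec) (bvec x)) = F (slice h (bvec x))"
    by (cases x) (auto simp: tensor_map_def slice_tensor slice_bvec lookup_single lin_0[OF assms])
qed

lemma slice_tensor_map_coact:
  "slice h (lin_ext (tensor_map (coact M) bvec) w) = lin_ext (coact M) (slice h w)"
  using slice_tensor_map[OF lin_lin_ext, of h "coact M" w] by simp

text \<open>Works with a map on vectors instead of values on basis vectors, because inclusions,
  retractions and their inverses arise as linear maps.\<close>

definition morph ::
  "('b, 'h, 'k::field) comodule \<Rightarrow> ('c, 'h, 'k) comodule \<Rightarrow> (('b \<Rightarrow>\<^sub>0 'k) \<Rightarrow> ('c \<Rightarrow>\<^sub>0 'k)) \<Rightarrow> bool" where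
  "morph M N F \<longleftrightarrow> lin F \<and> (\<forall>v\<in>vspace (basis M). F v \<in> vspace (basis N)) \<and>
     (\<forall>v\<in>vspace (basis M). \<forall>h. act N h (F v) = F (act M h v))"

lemma comodule_hom_iff_morph:
  fixes M :: "('b, 'h, 'k::field) comodule" and N :: "('c, 'h, 'k) comodule"
  shows "comodule_hom M N f \<longleftrightarrow> morph M N (lin_ext f)"
proof -
  have 1: "(\<forall>b\<in>basis M. f b \<in> vspace (basis N)) \<longleftrightarrow>
    (\<forall>v\<in>vspace (basis M). lin_ext f v \<in> vspace (basis N))"
    by (metis lin_ext_in_vspace bvec_in_vspace lin_ext_bvec)
  have 2: "lin_ext (coact N) (f b) = lin_ext (tensor_map f bvec) (coact M b)
    \<longleftrightarrow> (\<forall>h. act N h (lin_ext f (bvec b)) = lin_ext f (act M h (bvec b)))" for b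
    using slice_tensor_map[OF lin_lin_ext, of _ f "coact M b"]
    by (auto simp: act_def intro: slice_eqI)
  have 3: "(\<forall>b\<in>basis M. act N h (lin_ext f (bvec b)) = lin_ext f (act M h (bvec b)))
    \<longleftrightarrow> (\<forall>v\<in>vspace (basis M). act N h (lin_ext f v) = lin_ext f (act M h v))" for h
  proof
    assume *: "\<forall>b\<in>basis M. act N h (lin_ext f (bvec b)) = lin_ext f (act M h (bvec b))"
    show "\<forall>v\<in>vspace (basis M). act N h (lin_ext f v) = lin_ext f (act M h v)"
    proof
      fix v :: "'b \<Rightarrow>\<^sub>0 'k" assume "v \<in> vspace (basis M)"
      then show "act N h (lin_ext f v) = lin_ext f (act M h v)"
        by (rule lin_eq_on[OF lin_compose[OF lin_lin_ext lin_act] lin_compose[OF lin_act lin_lin_ext]])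
          (use * in simp)
    qed
  qed (metis bvec_in_vspace)
  have 4: "(\<forall>b\<in>basis M. lin_ext (coact N) (f b) = lin_ext (tensor_map f bvec) (coact M b))
    \<longleftrightarrow> (\<forall>v\<in>vspace (basis M). \<forall>h. act N h (lin_ext f v) = lin_ext f (act M h v))"
    using 2 3 by blast
  show ?thesis
    unfolding comodule_hom_def morph_def 1 4 by (simp add: lin_lin_ext)
qed

lemma comodule_iso_iff:
  "comodule_iso M N \<longleftrightarrow> (\<exists>F. morph M N F \<and> bij_betw F (vspace (basis M)) (vspace (basis N)))"
proof
  assume "\<exists>F. morph M N F \<and> bij_betw F (vspace (basis M)) (vspace (basis N))"
  then obtain F where F: "morph M N F" "bij_betw F (vspace (basis M)) (vspace (basis N))"
    by blast
  then have "lin_ext (\<lambda>x. F (bvec x)) = F"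
    by (intro lin_ext_bvec_eq) (simp add: morph_def)
  then show "comodule_iso M N"
    using F unfolding comodule_iso_def comodule_hom_iff_morph by metis
qed (auto simp: comodule_iso_def comodule_hom_iff_morph)

lemma morphD:
  assumes "morph M N F"
  shows "lin F" "v \<in> vspace (basis M) \<Longrightarrow> F v \<in> vspace (basis N)"
    "v \<in> vspace (basis M) \<Longrightarrow> act N h (F v) = F (act M h v)"
  using assms by (auto simp: morph_def)

section \<open>The comodule axioms in terms of paths\<close>

abbreviation comod :: "'k::field \<Rightarrow> ('b, int \<times> nat, 'k) comodule \<Rightarrow> bool" where
  "comod q \<equiv> is_comodule (path_hopf q)"

lemma slice_assoc:
  "slice (h, h') (lin_ext (\<lambda>((a, h), h'). bvec (a, (h, h'))) w) = slice h (slice h' w)"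
  by (rule lin_eqI[OF lin_compose[OF lin_lin_ext lin_slice] lin_compose[OF lin_slice lin_slice]])
    (auto simp: slice_bvec lin_0[OF lin_slice] split: prod.splits)

text \<open>A path is cut at one of its vertices into a final segment \<open>h1\<close> and an
  initial segment \<open>h2\<close>. A given pair arises from at most one path, and only if
  \<open>h1\<close> starts where \<open>h2\<close> ends.\<close>

lemma slice_comult:
  fixes w :: "'b \<times> int \<times> nat \<Rightarrow>\<^sub>0 'k::field"
  shows "slice (h1, h2) (lin_ext (tensor_map bvec (h_comult (path_hopf q))) w) =
     (if fst h1 = fst h2 + int (snd h2) then slice (fst h2, snd h1 + snd h2) w else 0)"
proof (rule lin_eqI[OF lin_compose[OF lin_lin_ext lin_slice],
      where G = "\<lambda>w. if fst h1 = fst h2 + int (snd h2) then slice (fst h2, snd h1 + snd h2) w else 0"])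
  show "lin (\<lambda>w. if fst h1 = fst h2 + int (snd h2) then slice (fst h2, snd h1 + snd h2) w else 0)"
    by (cases "fst h1 = fst h2 + int (snd h2)") (simp_all add: lin_slice lin_const_zero)
  fix x :: "'b \<times> int \<times> nat"
  obtain a i l where x: "x = (a, (i, l))"
    by (cases x) auto
  obtain i1 l1 i2 l2 where h: "h1 = (i1, l1)" "h2 = (i2, l2)"
    by (cases h1, cases h2) auto
  have "Poly_Mapping.lookup (h_comult (path_hopf q) (i, l)) (h1, h2)
      = (\<Sum>j\<le>l. if j = l2 then (if i = i2 \<and> i1 = i + int l2 \<and> l1 = l - l2 then 1 else 0) else 0)"
    unfolding path_hopf_def bialgebra.simps prod.case lookup_sum
    by (rule sum.cong) (auto simp: lookup_single h when_def)
  also have "\<dots> = (if i = i2 \<and> i1 = i2 + int l2 \<and> l = l1 + l2 then 1 else 0)"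
    by auto
  finally show "slice (h1, h2) (lin_ext (tensor_map bvec (h_comult (path_hopf q))) (bvec x))
      = (if fst h1 = fst h2 + int (snd h2) then slice (fst h2, snd h1 + snd h2) (bvec x) else 0)"
    by (auto simp: x h tensor_map_def slice_tensor slice_bvec)
qed

text \<open>Only trivial paths have nonzero counit, so the counit axiom says that a vector is the
  sum of its homogeneous components. \<open>S\<close> may be any finite set containing the degrees
  that occur.\<close>

lemma counit_slice:
  fixes w :: "'b \<times> int \<times> nat \<Rightarrow>\<^sub>0 'k::field"
  assumes "finite S" "\<And>i. slice (i, 0) w \<noteq> 0 \<Longrightarrow> i \<in> S"
  shows "lin_ext (\<lambda>(a, h). Poly_Mapping.single a (h_counit (path_hopf q) h)) w = (\<Sum>i\<in>S. slice (i, 0) w)"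
proof -
  let ?T = "S \<union> fst ` snd ` Poly_Mapping.keys w"
  have "lin_ext (\<lambda>(a, h). Poly_Mapping.single a (h_counit (path_hopf q) h)) w = (\<Sum>i\<in>?T. slice (i, 0) w)"
  proof (rule lin_eq_on[where B = "UNIV \<times> (?T \<times> UNIV)" and G = "\<lambda>w. \<Sum>i\<in>?T. slice (i, 0) w"])
    show "lin (\<lambda>w. \<Sum>i\<in>?T. slice (i, 0) w)"
      by (rule lin_sums[OF lin_slice])
    show "w \<in> vspace (UNIV \<times> (?T \<times> UNIV))"
      by (force simp: vspace_def)
    fix x :: "'b \<times> int \<times> nat" assume "x \<in> UNIV \<times> (?T \<times> UNIV)"
    moreover obtain a i l where "x = (a, (i, l))"
      by (cases x) auto
    ultimately show "lin_ext (\<lambda>(a, h). Poly_Mapping.single a (h_counit (path_hopf q) h)) (bvec x)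
        = (\<Sum>i\<in>?T. slice (i, 0) (bvec x))"
      using assms(1) by (auto simp: path_hopf_def slice_bvec simp del: Un_iff)
  qed (rule lin_lin_ext)
  also have "\<dots> = (\<Sum>i\<in>S. slice (i, 0) w)"
    by (rule sum.mono_neutral_right) (use assms in auto)
  finally show ?thesis .
qed

text \<open>Coassociativity is dual to concatenation: acting by two paths in succession is acting by
  the composite path, or zero if they do not fit together.\<close>

lemma comod_coassoc_iff:
  "lin_ext (\<lambda>((a, h), h'). bvec (a, (h, h'))) (lin_ext (tensor_map (coact M) bvec) (coact M b))
      = lin_ext (tensor_map bvec (h_comult (path_hopf q))) (coact M b)
   \<longleftrightarrow> (\<forall>i l j m. act M (j, m) (act M (i, l) (bvec b)) =
        (if j = i + int l then act M (i, l + m) (bvec b) else 0))" (is "?L = ?R \<longleftrightarrow> ?A")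
proof -
  have L: "slice ((j, m), (i, l)) ?L = act M (j, m) (act M (i, l) (bvec b))" for i l j m
    by (simp add: slice_assoc slice_tensor_map_coact act_def)
  have R: "slice ((j, m), (i, l)) ?R = (if j = i + int l then act M (i, l + m) (bvec b) else 0)" for i l j m
    by (simp add: slice_comult act_def add.commute)
  have "?L = ?R \<longleftrightarrow> (\<forall>h. slice h ?L = slice h ?R)"
    by (auto intro: slice_eqI)
  also have "\<dots> \<longleftrightarrow> ?A"
    unfolding split_paired_All L R by blast
  finally show ?thesis .
qed

lemma comodI:
  assumes fin: "finite (basis M)"
    and in_space: "\<And>b h. b \<in> basis M \<Longrightarrow> act M h (bvec b) \<in> vspace (basis M)"
    and comp: "\<And>b i l j m. b \<in> basis M \<Longrightarrow>
      act M (j, m) (act M (i, l) (bvec b)) = (if j = i + int l then act M (i, l + m) (bvec b) else 0)"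
    and sum: "\<And>b. b \<in> basis M \<Longrightarrow> \<exists>S. finite S \<and> bvec b = (\<Sum>i\<in>S. act M (i, 0) (bvec b))"
  shows "comod q M"
proof -
  have "lin_ext (\<lambda>(a, h). Poly_Mapping.single a (h_counit (path_hopf q) h)) (coact M b) = bvec b"
    if b: "b \<in> basis M" for b
  proof -
    obtain S where S: "finite S" "bvec b = (\<Sum>i\<in>S. act M (i, 0) (bvec b))"
      using sum[OF b] by blast
    \<comment> \<open>Projecting the decomposition of \<open>bvec b\<close> to a degree outside
      \<open>S\<close> kills every term; hence \<open>S\<close> contains all degrees that occur, as
      \<open>counit_slice\<close> requires.\<close>
    have "i \<in> S" if "slice (i, 0) (coact M b) \<noteq> 0" for i
    proof (rule ccontr)
      assume "i \<notin> S"
      then have "(\<Sum>j\<in>S. act M (i, 0) (act M (j, 0) (bvec b))) = 0"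
        using comp[OF b] by (intro sum.neutral) auto
      then have "act M (i, 0) (bvec b) = 0"
        by (subst S(2)) (simp add: lin_sum[OF lin_act])
      with that show False
        by (simp add: act_bvec)
    qed
    then show ?thesis
      using S by (simp add: counit_slice[OF S(1)] act_bvec)
  qed
  then show ?thesis
    unfolding is_comodule_def comod_coassoc_iff
    using fin in_space comp by (auto simp: vspace_slice_iff act_bvec)
qed

lemma comodD:
  assumes M: "comod q M"
  shows "finite (basis M)"
    and act_in_vspace: "v \<in> vspace (basis M) \<Longrightarrow> act M h v \<in> vspace (basis M)"
    and act_act: "v \<in> vspace (basis M) \<Longrightarrow>
      act M (j, m) (act M (i, l) v) = (if j = i + int l then act M (i, l + m) v else 0)"
    and grade_sum: "v \<in> vspace (basis M) \<Longrightarrow> finite S \<Longrightarrow> {i. act M (i, 0) v \<noteq> 0} \<subseteq> S \<Longrightarrow>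
      (\<Sum>i\<in>S. act M (i, 0) v) = v"
proof -
  show fin: "finite (basis M)"
    using M by (simp add: is_comodule_def)
  have in_space: "act M h (bvec b) \<in> vspace (basis M)" if "b \<in> basis M" for b h
    using M that unfolding is_comodule_def vspace_slice_iff act_bvec by blast
  show 1: "act M h v \<in> vspace (basis M)" if "v \<in> vspace (basis M)" for h v
    by (rule lin_in_subspace[OF lin_act that subspace_vspace in_space])
  have comp: "act M (j, m) (act M (i, l) (bvec b)) = (if j = i + int l then act M (i, l + m) (bvec b) else 0)"
    if "b \<in> basis M" for b i l j m
    using M that unfolding is_comodule_def comod_coassoc_iff by blast
  show 2: "act M (j, m) (act M (i, l) v) = (if j = i + int l then act M (i, l + m) v else 0)"
    if "v \<in> vspace (basis M)" for v i l j m
  proof (rule lin_eq_on[OF lin_compose[OF lin_act lin_act] _ that comp])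
    show "lin (\<lambda>v. if j = i + int l then act M (i, l + m) v else 0)"
      by (cases "j = i + int l") (simp_all add: lin_act lin_const_zero)
  qed
  show "(\<Sum>i\<in>S. act M (i, 0) v) = v" if v: "v \<in> vspace (basis M)" and S: "finite S" "{i. act M (i, 0) v \<noteq> 0} \<subseteq> S"
  proof -
    \<comment> \<open>The identity is proved by linearity from basis vectors, so one index set has
      to serve all of them; degrees outside \<open>S\<close> contribute zero to \<open>v\<close> and
      are dropped at the end.\<close>
    let ?T = "S \<union> (\<Union>b\<in>basis M. {i. act M (i, 0) (bvec b) \<noteq> 0})"
    have finT: "finite ?T"
      using S fin by (intro finite_UnI finite_UN_I finite_act_grade)
    have "(\<Sum>i\<in>?T. act M (i, 0) v) = v"
    proof (rule lin_eq_on[OF lin_sums[OF lin_act] lin_id v])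
      fix b assume b: "b \<in> basis M"
      have "lin_ext (\<lambda>(a, h). Poly_Mapping.single a (h_counit (path_hopf q) h)) (coact M b) = bvec b"
        using M b by (simp add: is_comodule_def)
      also have "lin_ext (\<lambda>(a, h). Poly_Mapping.single a (h_counit (path_hopf q) h)) (coact M b)
          = (\<Sum>i\<in>?T. slice (i, 0) (coact M b))"
        by (rule counit_slice[OF finT]) (use b in \<open>auto simp: act_bvec\<close>)
      finally show "(\<Sum>i\<in>?T. act M (i, 0) (bvec b)) = bvec b"
        by (simp add: act_bvec)
    qed
    moreover have "(\<Sum>i\<in>?T. act M (i, 0) v) = (\<Sum>i\<in>S. act M (i, 0) v)"
      by (rule sum.mono_neutral_right) (use S finT in auto)
    ultimately show ?thesis
      by simp
  qed
qed

lemma grade_expand: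
  assumes "comod q M" "v \<in> vspace (basis M)"
  shows "v = (\<Sum>i | act M (i, 0) v \<noteq> 0. act M (i, 0) v)"
  by (rule grade_sum[OF assms finite_act_grade subset_refl, symmetric])

section \<open>Homogeneous components\<close>

definition deg :: "('b, int \<times> nat, 'k::field) comodule \<Rightarrow> int \<Rightarrow> ('b \<Rightarrow>\<^sub>0 'k) set" where
  "deg M i = {v \<in> vspace (basis M). act M (i, 0) v = v}"

lemma act_in_deg:
  assumes "comod q M" "v \<in> vspace (basis M)"
  shows "act M (i, l) v \<in> deg M (i + int l)"
  using assms by (simp add: deg_def act_in_vspace act_act)

lemma act_in_degI: "comod q M \<Longrightarrow> v \<in> deg M i \<Longrightarrow> j = i + int l \<Longrightarrow> act M (i, l) v \<in> deg M j"
  using act_in_deg[of q M v i l] by (simp add: deg_def)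

lemma deg_vspace: "v \<in> deg M i \<Longrightarrow> v \<in> vspace (basis M)"
  by (simp add: deg_def)

lemma act_deg:
  assumes "comod q M" "v \<in> deg M i" "j \<noteq> i"
  shows "act M (j, l) v = 0"
  using act_act[OF assms(1) deg_vspace[OF assms(2)], of j l i 0] assms by (simp add: deg_def)

lemma lin_eq_on_deg:
  fixes F G :: "('b \<Rightarrow>\<^sub>0 'k::field) \<Rightarrow> ('c \<Rightarrow>\<^sub>0 'k)"
  assumes M: "comod q M" and lin: "lin F" "lin G" and v: "v \<in> vspace (basis M)"
    and eq: "\<And>i w. w \<in> deg M i \<Longrightarrow> F w = G w"
  shows "F v = G v"
proof -
  let ?S = "{i. act M (i, 0) v \<noteq> 0}"
  have "v = (\<Sum>i\<in>?S. act M (i, 0) v)"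
    by (rule grade_expand[OF M v])
  moreover have "F (\<Sum>i\<in>?S. act M (i, 0) v) = G (\<Sum>i\<in>?S. act M (i, 0) v)"
    unfolding lin_sum[OF lin(1)] lin_sum[OF lin(2)]
    by (rule sum.cong) (use act_in_deg[OF M v, of _ 0] eq in auto)
  ultimately show ?thesis
    by simp
qed

lemma in_subspace_deg:
  fixes F :: "('b \<Rightarrow>\<^sub>0 'k::field) \<Rightarrow> ('c \<Rightarrow>\<^sub>0 'k)"
  assumes M: "comod q M" and v: "v \<in> vspace (basis M)" and W: "vs.subspace W"
    and lin: "lin F" and "\<And>i w. w \<in> deg M i \<Longrightarrow> F w \<in> W"
  shows "F v \<in> W"
proof -
  let ?S = "{i. act M (i, 0) v \<noteq> 0}"
  have "v = (\<Sum>i\<in>?S. act M (i, 0) v)"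
    by (rule grade_expand[OF M v])
  moreover have "F (\<Sum>i\<in>?S. act M (i, 0) v) \<in> W"
    unfolding lin_sum[OF lin]
    by (rule vs.subspace_sum[OF W]) (use act_in_deg[OF M v, of _ 0] assms(5) in auto)
  ultimately show ?thesis
    by simp
qed

lemma act_Suc:
  assumes "comod q M" "v \<in> vspace (basis M)"
  shows "act M (i, Suc l) v = act M (i + int l, 1) (act M (i, l) v)"
  using act_act[OF assms, of "i + int l" 1 i l] by simp

text \<open>On degree \<open>i\<close> every \<open>act M (i, l)\<close> is an iterate of the
  raising operator, and on other degrees it vanishes. So it is enough to respect degrees and paths
  of length one.\<close>

lemma morphI_deg:
  fixes F :: "('b \<Rightarrow>\<^sub>0 'k::field) \<Rightarrow> ('c \<Rightarrow>\<^sub>0 'k)"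
  assumes M: "comod q M" and N: "comod q N" and lin: "lin F"
    and deg: "\<And>i v. v \<in> deg M i \<Longrightarrow> F v \<in> deg N i"
    and raise: "\<And>i v. v \<in> deg M i \<Longrightarrow> act N (i, 1) (F v) = F (act M (i, 1) v)"
  shows "morph M N F"
  unfolding morph_def
proof (intro conjI ballI allI)
  have *: "act N (i, l) (F v) = F (act M (i, l) v)" if v: "v \<in> deg M i" for i l v
  proof (induction l)
    case 0
    then show ?case
      using deg[OF v] v by (simp add: deg_def)
  next
    case (Suc l)
    then show ?case
      using act_Suc[OF N deg_vspace[OF deg[OF v]], of i l] act_Suc[OF M deg_vspace[OF v], of i l]
        raise[OF act_in_degI[OF M v refl]] by simp
  qed
  fix v :: "'b \<Rightarrow>\<^sub>0 'k" assume v: "v \<in> vspace (basis M)"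
  show "F v \<in> vspace (basis N)"
    by (rule in_subspace_deg[OF M v subspace_vspace lin]) (use deg deg_vspace in blast)
  fix h :: "int \<times> nat"
  obtain j l where h: "h = (j, l)"
    by (cases h)
  show "act N h (F v) = F (act M h v)"
  proof (rule lin_eq_on_deg[OF M lin_compose[OF lin lin_act] lin_compose[OF lin_act lin] v])
    fix i w assume w: "w \<in> deg M i"
    show "act N h (F w) = F (act M h w)"
      using *[OF w, of l] act_deg[OF M w, of j l] act_deg[OF N deg[OF w], of j l]
      by (cases "j = i") (auto simp: h lin_0[OF lin])
  qed
qed (rule lin)

subsection \<open>Isomorphisms and subcomodules\<close>

lemma comodule_isoI:
  "morph M N F \<Longrightarrow> bij_betw F (vspace (basis M)) (vspace (basis N)) \<Longrightarrow> comodule_iso M N"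
  by (auto simp: comodule_iso_iff)

lemma comodule_iso_refl: "comod q M \<Longrightarrow> comodule_iso M M"
  by (rule comodule_isoI[of _ _ "\<lambda>v. v"]) (auto simp: morph_def lin_id bij_betw_def)

lemma comodule_iso_trans: "comodule_iso L M \<Longrightarrow> comodule_iso M N \<Longrightarrow> comodule_iso L N"
proof -
  assume "comodule_iso L M" "comodule_iso M N"
  then obtain F G where F: "morph L M F" "bij_betw F (vspace (basis L)) (vspace (basis M))"
    and G: "morph M N G" "bij_betw G (vspace (basis M)) (vspace (basis N))"
    by (auto simp: comodule_iso_iff)
  show "comodule_iso L N"
  proof (rule comodule_isoI)
    show "morph L N (\<lambda>v. G (F v))"
      using F(1) G(1) by (auto simp: morph_def intro: lin_compose)
    show "bij_betw (\<lambda>v. G (F v)) (vspace (basis L)) (vspace (basis N))"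
      using bij_betw_trans[OF F(2) G(2)] by (simp add: comp_def)
  qed
qed

lemma comodule_iso_sym:
  assumes "comod q M" "comodule_iso M N"
  shows "comodule_iso N M"
proof -
  obtain F where F: "morph M N F" "bij_betw F (vspace (basis M)) (vspace (basis N))"
    using assms by (auto simp: comodule_iso_iff)
  obtain G where G: "lin G" "\<And>v. v \<in> vspace (basis M) \<Longrightarrow> G (F v) = v"
    "\<And>w. w \<in> vspace (basis N) \<Longrightarrow> G w \<in> vspace (basis M)" "\<And>w. w \<in> vspace (basis N) \<Longrightarrow> F (G w) = w"
    using lin_inverse[OF morphD(1)[OF F(1)] F(2)] by blast
  have "act M h (G w) = G (act N h w)" if "w \<in> vspace (basis N)" for h w
    using G that morphD(3)[OF F(1), of "G w" h] act_in_vspace[OF assms(1) G(3)[OF that]] by metis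
  then have "morph N M G"
    using G by (simp add: morph_def)
  moreover have "bij_betw G (vspace (basis N)) (vspace (basis M))"
    by (rule bij_betw_lin_vspaceI[of _ _ _ F]) (use G morphD[OF F(1)] in auto)
  ultimately show ?thesis
    by (rule comodule_isoI)
qed

text \<open>The structure on \<open>W\<close> is transported along linear coordinates;
  \<open>ex_slices\<close> supplies the coaction whose coefficients are the transported
  operators.\<close>

lemma subcomodule:
  fixes M :: "('b, int \<times> nat, 'k::field) comodule"
  assumes M: "comod q M" and W: "vs.subspace W" "W \<subseteq> vspace (basis M)"
    and stable: "\<And>h w. w \<in> W \<Longrightarrow> act M h w \<in> W"
  obtains U :: "(nat, int \<times> nat, 'k) comodule" and F where
    "comod q U" "morph U M F" "bij_betw F (vspace (basis U)) W"
proof -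
  obtain F :: "(nat \<Rightarrow>\<^sub>0 'k) \<Rightarrow> ('b \<Rightarrow>\<^sub>0 'k)" and n where F: "lin F" "bij_betw F (vspace {..<n}) W"
    using subspace_param[OF W comodD(1)[OF M]] by metis
  obtain G where G: "lin G" "\<And>v. v \<in> vspace {..<n} \<Longrightarrow> G (F v) = v"
    "\<And>w. w \<in> W \<Longrightarrow> G w \<in> vspace {..<n}" "\<And>w. w \<in> W \<Longrightarrow> F (G w) = w"
    using lin_inverse[OF F] by blast
  have FW: "F v \<in> W" if "v \<in> vspace {..<n}" for v
    using F(2) that by (auto simp: bij_betw_def)
  have "\<exists>w. \<forall>h. slice h w = G (act M h (F (bvec j)))" for j
  proof (rule ex_slices)
    show "finite {h. G (act M h (F (bvec j))) \<noteq> 0}"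
      by (rule finite_subset[OF _ finite_act[of M "F (bvec j)"]]) (auto simp: lin_0[OF G(1)])
  qed
  then obtain c where c: "\<And>h j. slice h (c j) = G (act M h (F (bvec j)))"
    by metis
  define U where "U = \<lparr>basis = {..<n}, coact = c\<rparr>"
  have act: "act U h v = G (act M h (F v))" for h v
    by (rule lin_eqI[OF lin_act lin_compose[OF F(1) lin_compose[OF lin_act G(1)]]])
      (simp add: act_bvec U_def c)
  have act_F: "F (act U h v) = act M h (F v)" if "v \<in> vspace {..<n}" for h v
    unfolding act by (rule G(4)[OF stable[OF FW[OF that]]])
  have U_in: "act U h v \<in> vspace {..<n}" if "v \<in> vspace {..<n}" for h v
    unfolding act by (rule G(3)[OF stable[OF FW[OF that]]])
  have "comod q U"
  proof (rule comodI)
    show "finite (basis U)"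
      by (simp add: U_def)
    fix b assume "b \<in> basis U"
    then have b: "bvec b \<in> vspace {..<n}"
      by (simp add: U_def)
    note FbM = subsetD[OF W(2) FW[OF b]]
    show "act U h (bvec b) \<in> vspace (basis U)" for h
      using U_in[OF b] by (simp add: U_def)
    show "act U (j, m) (act U (i, l) (bvec b)) = (if j = i + int l then act U (i, l + m) (bvec b) else 0)"
      for i l j m
      unfolding act[of "(j, m)" "act U (i, l) (bvec b)"] act_F[OF b] act_act[OF M FbM]
      by (simp add: act lin_0[OF G(1)])
    let ?S = "{i. act M (i, 0) (F (bvec b)) \<noteq> 0}"
    have "G (F (bvec b)) = G (\<Sum>i\<in>?S. act M (i, 0) (F (bvec b)))"
      by (rule arg_cong[OF grade_expand[OF M FbM]])
    then have "bvec b = (\<Sum>i\<in>?S. act U (i, 0) (bvec b))"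
      by (simp add: lin_sum[OF G(1)] G(2)[OF b] act)
    then show "\<exists>S. finite S \<and> bvec b = (\<Sum>i\<in>S. act U (i, 0) (bvec b))"
      by (intro exI[of _ ?S] conjI finite_act_grade)
  qed
  moreover have "morph U M F"
    unfolding morph_def using F(1) FW W(2) act_F by (auto simp: U_def)
  moreover have "bij_betw F (vspace (basis U)) W"
    using F(2) by (simp add: U_def)
  ultimately show thesis
    by (rule that)
qed

lemma nat_comodule:
  fixes M :: "('b, int \<times> nat, 'k::field) comodule"
  assumes "comod q M"
  obtains U :: "(nat, int \<times> nat, 'k) comodule" where "comod q U" "comodule_iso U M"
  using subcomodule[OF assms subspace_vspace subset_refl act_in_vspace[OF assms]] comodule_isoI
  by metis

subsection \<open>Direct sums\<close>

definition inl :: "('b \<Rightarrow>\<^sub>0 'k::field) \<Rightarrow> ('b + 'c \<Rightarrow>\<^sub>0 'k)" where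
  "inl = lin_ext (\<lambda>a. bvec (Inl a))"

definition inr :: "('c \<Rightarrow>\<^sub>0 'k::field) \<Rightarrow> ('b + 'c \<Rightarrow>\<^sub>0 'k)" where
  "inr = lin_ext (\<lambda>a. bvec (Inr a))"

definition prl :: "('b + 'c \<Rightarrow>\<^sub>0 'k::field) \<Rightarrow> ('b \<Rightarrow>\<^sub>0 'k)" where
  "prl = lin_ext (case_sum bvec (\<lambda>_. 0))"

definition prr :: "('b + 'c \<Rightarrow>\<^sub>0 'k::field) \<Rightarrow> ('c \<Rightarrow>\<^sub>0 'k)" where
  "prr = lin_ext (case_sum (\<lambda>_. 0) bvec)"

lemma lin_inl: "lin inl" and lin_inr: "lin inr" and lin_prl: "lin prl" and lin_prr: "lin prr"
  by (simp_all add: inl_def inr_def prl_def prr_def lin_lin_ext)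

lemma inl_bvec [simp]: "inl (bvec a) = bvec (Inl a)" and inr_bvec [simp]: "inr (bvec b) = bvec (Inr b)"
  by (simp_all add: inl_def inr_def)

lemma prl_bvec [simp]: "prl (bvec (Inl a)) = bvec a" "prl (bvec (Inr b)) = 0"
  and prr_bvec [simp]: "prr (bvec (Inl a)) = 0" "prr (bvec (Inr b)) = bvec b"
  by (simp_all add: prl_def prr_def)

lemma prl_inl [simp]: "prl (inl u) = u" and prr_inr [simp]: "prr (inr v) = v"
  and prl_inr [simp]: "prl (inr v) = 0" and prr_inl [simp]: "prr (inl u) = 0"
  by (rule lin_eqI[OF lin_compose[OF lin_inl lin_prl] lin_id]
      lin_eqI[OF lin_compose[OF lin_inr lin_prr] lin_id]
      lin_eqI[OF lin_compose[OF lin_inr lin_prl] lin_const_zero]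
      lin_eqI[OF lin_compose[OF lin_inl lin_prr] lin_const_zero], simp)+

lemma sum_split: "inl (prl v) + inr (prr v) = v"
proof (rule lin_eqI[OF lin_plus[OF lin_compose[OF lin_prl lin_inl] lin_compose[OF lin_prr lin_inr]] lin_id])
  fix x :: "'a + 'b"
  show "inl (prl (bvec x)) + inr (prr (bvec x)) = bvec x"
    by (cases x) (simp_all add: lin_0[OF lin_inl] lin_0[OF lin_inr])
qed

lemma inl_in_vspace: "u \<in> vspace A \<Longrightarrow> inl u \<in> vspace (A <+> B)"
  by (erule lin_in_subspace[OF lin_inl _ subspace_vspace]) auto

lemma inr_in_vspace: "v \<in> vspace B \<Longrightarrow> inr v \<in> vspace (A <+> B)"
  by (erule lin_in_subspace[OF lin_inr _ subspace_vspace]) auto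

lemma prl_in_vspace: "w \<in> vspace (A <+> B) \<Longrightarrow> prl w \<in> vspace A"
  by (erule lin_in_subspace[OF lin_prl _ subspace_vspace]) auto

lemma prr_in_vspace: "w \<in> vspace (A <+> B) \<Longrightarrow> prr w \<in> vspace B"
  by (erule lin_in_subspace[OF lin_prr _ subspace_vspace]) auto

lemma lin_ext_relabel:
  "lin_ext (\<lambda>(a, h). bvec (f a, h)) = lin_ext (tensor_map (\<lambda>a. bvec (f a)) bvec)"
  by (rule arg_cong[of _ _ lin_ext]) (auto simp: fun_eq_iff tensor_map_def)

lemma act_inl: "act (direct_sum M N) h (inl u) = inl (act M h u)"
proof (rule lin_eqI[OF lin_compose[OF lin_inl lin_act] lin_compose[OF lin_act lin_inl]])
  fix b
  show "act (direct_sum M N) h (inl (bvec b)) = inl (act M h (bvec b))"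
    using slice_tensor_map[OF lin_inl, of h "coact M b"]
    by (simp add: act_bvec direct_sum_def lin_ext_relabel)
qed

lemma act_inr: "act (direct_sum M N) h (inr v) = inr (act N h v)"
proof (rule lin_eqI[OF lin_compose[OF lin_inr lin_act] lin_compose[OF lin_act lin_inr]])
  fix b
  show "act (direct_sum M N) h (inr (bvec b)) = inr (act N h (bvec b))"
    using slice_tensor_map[OF lin_inr, of h "coact N b"]
    by (simp add: act_bvec direct_sum_def lin_ext_relabel)
qed

lemma act_direct_sum: "act (direct_sum M N) h w = inl (act M h (prl w)) + inr (act N h (prr w))"
  by (subst sum_split[of w, symmetric]) (simp only: lin_add[OF lin_act] act_inl act_inr)

lemma basis_direct_sum [simp]: "basis (direct_sum M N) = basis M <+> basis N"
  by (simp add: direct_sum_def)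

lemma comod_direct_sum:
  assumes M: "comod q M" and N: "comod q N"
  shows "comod q (direct_sum M N)"
proof (rule comodI)
  show "finite (basis (direct_sum M N))"
    using comodD(1)[OF M] comodD(1)[OF N] by simp
  fix b assume "b \<in> basis (direct_sum M N)"
  then have b: "prl (bvec b) \<in> vspace (basis M)" "prr (bvec b) \<in> vspace (basis N)"
    by auto
  show "act (direct_sum M N) h (bvec b) \<in> vspace (basis (direct_sum M N))" for h
    unfolding act_direct_sum basis_direct_sum
    by (intro add_in_vspace inl_in_vspace inr_in_vspace act_in_vspace[OF M] act_in_vspace[OF N] b)
  show "act (direct_sum M N) (j, m) (act (direct_sum M N) (i, l) (bvec b)) =
    (if j = i + int l then act (direct_sum M N) (i, l + m) (bvec b) else 0)" for i l j m
    by (simp add: act_direct_sum[of M N _ "bvec b"] lin_add[OF lin_act] act_inl act_inr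
        act_act[OF M b(1)] act_act[OF N b(2)] lin_0[OF lin_inl] lin_0[OF lin_inr])
  let ?S = "{i. act M (i, 0) (prl (bvec b)) \<noteq> 0} \<union> {i. act N (i, 0) (prr (bvec b)) \<noteq> 0}"
  have fin: "finite ?S"
    by (intro finite_UnI finite_act_grade)
  have "(\<Sum>i\<in>?S. act (direct_sum M N) (i, 0) (bvec b))
      = inl (\<Sum>i\<in>?S. act M (i, 0) (prl (bvec b))) + inr (\<Sum>i\<in>?S. act N (i, 0) (prr (bvec b)))"
    by (simp add: act_direct_sum sum.distrib lin_sum[OF lin_inl] lin_sum[OF lin_inr])
  also have "\<dots> = bvec b"
    by (simp add: grade_sum[OF M b(1) fin] grade_sum[OF N b(2) fin] sum_split)
  finally have eq: "(\<Sum>i\<in>?S. act (direct_sum M N) (i, 0) (bvec b)) = bvec b" .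
  show "\<exists>S. finite S \<and> bvec b = (\<Sum>i\<in>S. act (direct_sum M N) (i, 0) (bvec b))"
    by (rule exI[of _ ?S], rule conjI[OF fin eq[symmetric]])
qed

lemma morph_case_sum:
  fixes M :: "('b, 'h, 'k::field) comodule" and N :: "('c, 'h, 'k) comodule" and P :: "('d, 'h, 'k) comodule"
  assumes F: "morph M P F" and G: "morph N P G"
  shows "morph (direct_sum M N) P (\<lambda>w. F (prl w) + G (prr w))"
  unfolding morph_def
proof (intro conjI ballI allI)
  show "lin (\<lambda>w. F (prl w) + G (prr w))"
    by (intro lin_plus lin_compose[OF lin_prl] lin_compose[OF lin_prr] morphD(1)[OF F] morphD(1)[OF G])
  fix w :: "'b + 'c \<Rightarrow>\<^sub>0 'k" assume "w \<in> vspace (basis (direct_sum M N))"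
  then have w: "prl w \<in> vspace (basis M)" "prr w \<in> vspace (basis N)"
    by (auto intro: prl_in_vspace prr_in_vspace)
  show "F (prl w) + G (prr w) \<in> vspace (basis P)"
    by (intro add_in_vspace morphD(2)[OF F] morphD(2)[OF G] w)
  show "act P h (F (prl w) + G (prr w))
      = F (prl (act (direct_sum M N) h w)) + G (prr (act (direct_sum M N) h w))" for h
    by (simp add: lin_add[OF lin_act] morphD(3)[OF F w(1)] morphD(3)[OF G w(2)] act_direct_sum
        lin_add[OF lin_prl] lin_add[OF lin_prr])
qed

subsection \<open>Ranks and multiplicities\<close>

lemma dim_vspace: "vs.dim (vspace S :: ('x \<Rightarrow>\<^sub>0 'k::field) set) = card S"
  by (rule dim_bij_vspace[OF lin_id]) (simp add: bij_betw_def)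

text \<open>An integer rather than a natural number, because multiplicities are alternating sums of
  ranks.\<close>

definition rk :: "('b, 'h, 'k::field) comodule \<Rightarrow> 'h \<Rightarrow> int" where
  "rk M h = int (vs.dim (act M h ` vspace (basis M)))"

lemma act_image_param:
  fixes M :: "('b, int \<times> nat, 'k::field) comodule"
  assumes M: "comod q M"
  obtains F :: "(nat \<Rightarrow>\<^sub>0 'k) \<Rightarrow> ('b \<Rightarrow>\<^sub>0 'k)" and n where
    "lin F" "bij_betw F (vspace {..<n}) (act M h ` vspace (basis M))" "rk M h = int n"
proof -
  have "vs.subspace (act M h ` vspace (basis M))"
    using vp.linear_subspace_image[OF lin_act subspace_vspace] .
  moreover have "act M h ` vspace (basis M) \<subseteq> vspace (basis M)"
    by (intro image_subsetI act_in_vspace[OF M])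
  ultimately obtain F :: "(nat \<Rightarrow>\<^sub>0 'k) \<Rightarrow> ('b \<Rightarrow>\<^sub>0 'k)" and n where
    F: "lin F" "bij_betw F (vspace {..<n}) (act M h ` vspace (basis M))"
    using subspace_param[OF _ _ comodD(1)[OF M]] by metis
  then show thesis
    using that[OF F] dim_bij_vspace[OF F] by (simp add: rk_def)
qed

lemma rk_iso:
  fixes M :: "('b, int \<times> nat, 'k::field) comodule" and N :: "('c, int \<times> nat, 'k) comodule"
  assumes M: "comod q M" and iso: "comodule_iso M N"
  shows "rk N h = rk M h"
proof -
  obtain F where F: "morph M N F" "bij_betw F (vspace (basis M)) (vspace (basis N))"
    using iso by (auto simp: comodule_iso_iff)
  obtain G :: "(nat \<Rightarrow>\<^sub>0 'k) \<Rightarrow> _" and n where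
    G: "lin G" "bij_betw G (vspace {..<n}) (act M h ` vspace (basis M))" "rk M h = int n"
    using act_image_param[OF M] by metis
  have "act N h ` vspace (basis N) = act N h ` F ` vspace (basis M)"
    using F(2) by (simp add: bij_betw_def)
  also have "\<dots> = F ` act M h ` vspace (basis M)"
    using morphD(3)[OF F(1)] by (auto simp: image_image)
  finally have "bij_betw F (act M h ` vspace (basis M)) (act N h ` vspace (basis N))"
    using bij_betw_subset[OF F(2)] act_in_vspace[OF M] by (metis image_subset_iff)
  then have "bij_betw (\<lambda>v. F (G v)) (vspace {..<n}) (act N h ` vspace (basis N))"
    using bij_betw_trans[OF G(2)] by (simp add: comp_def)
  then show ?thesis
    using dim_bij_vspace[OF lin_compose[OF G(1) morphD(1)[OF F(1)]]] G(3) by (simp add: rk_def)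
qed

lemma rk_direct_sum:
  fixes M :: "('b, int \<times> nat, 'k::field) comodule" and N :: "('c, int \<times> nat, 'k) comodule"
  assumes M: "comod q M" and N: "comod q N"
  shows "rk (direct_sum M N) h = rk M h + rk N h"
proof -
  let ?A = "act M h ` vspace (basis M)" and ?B = "act N h ` vspace (basis N)"
  obtain F :: "(nat \<Rightarrow>\<^sub>0 'k) \<Rightarrow> _" and m where F: "lin F" "bij_betw F (vspace {..<m}) ?A" "rk M h = int m"
    using act_image_param[OF M] by metis
  obtain G :: "(nat \<Rightarrow>\<^sub>0 'k) \<Rightarrow> _" and n where G: "lin G" "bij_betw G (vspace {..<n}) ?B" "rk N h = int n"
    using act_image_param[OF N] by metis
  obtain F' where F': "lin F'" "\<And>v. v \<in> vspace {..<m} \<Longrightarrow> F' (F v) = v"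
    "\<And>w. w \<in> ?A \<Longrightarrow> F' w \<in> vspace {..<m}" "\<And>w. w \<in> ?A \<Longrightarrow> F (F' w) = w"
    using lin_inverse[OF F(1,2)] by blast
  obtain G' where G': "lin G'" "\<And>v. v \<in> vspace {..<n} \<Longrightarrow> G' (G v) = v"
    "\<And>w. w \<in> ?B \<Longrightarrow> G' w \<in> vspace {..<n}" "\<And>w. w \<in> ?B \<Longrightarrow> G (G' w) = w"
    using lin_inverse[OF G(1,2)] by blast
  let ?W = "act (direct_sum M N) h ` vspace (basis (direct_sum M N))"
  let ?K = "\<lambda>v. inl (F (prl v)) + inr (G (prr v))"
  \<comment> \<open>The image in a direct sum is described by its two projections, so that the
    coordinate maps of both images can be applied componentwise.\<close>
  have W: "w \<in> ?W \<longleftrightarrow> prl w \<in> ?A \<and> prr w \<in> ?B" for w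
  proof
    assume "w \<in> ?W"
    then obtain v where v: "v \<in> vspace (basis M <+> basis N)" "w = act (direct_sum M N) h v"
      by auto
    then show "prl w \<in> ?A \<and> prr w \<in> ?B"
      using prl_in_vspace[OF v(1)] prr_in_vspace[OF v(1)]
      by (auto simp: act_direct_sum lin_add[OF lin_prl] lin_add[OF lin_prr])
  next
    assume "prl w \<in> ?A \<and> prr w \<in> ?B"
    then obtain u v where "u \<in> vspace (basis M)" "prl w = act M h u"
      "v \<in> vspace (basis N)" "prr w = act N h v"
      by auto
    then show "w \<in> ?W"
      using sum_split[of w]
      by (intro image_eqI[of _ _ "inl u + inr v"])
        (auto simp: act_direct_sum lin_add[OF lin_prl] lin_add[OF lin_prr] intro!: add_in_vspace inl_in_vspace inr_in_vspace)
  qed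
  have lin: "lin ?K"
    by (intro lin_plus lin_compose[OF lin_compose[OF lin_prl F(1)] lin_inl] lin_compose[OF lin_compose[OF lin_prr G(1)] lin_inr])
  have FA: "F v \<in> ?A" if "v \<in> vspace {..<m}" for v
    using F(2) that unfolding bij_betw_def by blast
  have GB: "G v \<in> ?B" if "v \<in> vspace {..<n}" for v
    using G(2) that unfolding bij_betw_def by blast
  have "bij_betw ?K (vspace ({..<m} <+> {..<n})) ?W"
  proof (rule bij_betw_lin_vspaceI[OF lin, where G = "\<lambda>w. inl (F' (prl w)) + inr (G' (prr w))"])
    show "?K ` vspace ({..<m} <+> {..<n}) \<subseteq> ?W"
    proof clarify
      fix v :: "nat + nat \<Rightarrow>\<^sub>0 'k" assume v: "v \<in> vspace ({..<m} <+> {..<n})"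
      show "?K v \<in> ?W"
        unfolding W using FA[OF prl_in_vspace[OF v]] GB[OF prr_in_vspace[OF v]]
        by (simp add: lin_add[OF lin_prl] lin_add[OF lin_prr])
    qed
    fix w assume "w \<in> ?W"
    then have w: "prl w \<in> ?A" "prr w \<in> ?B"
      unfolding W by auto
    show "inl (F' (prl w)) + inr (G' (prr w)) \<in> vspace ({..<m} <+> {..<n})"
      by (intro add_in_vspace inl_in_vspace inr_in_vspace F'(3)[OF w(1)] G'(3)[OF w(2)])
    show "?K (inl (F' (prl w)) + inr (G' (prr w))) = w"
      by (simp add: lin_add[OF lin_prl] lin_add[OF lin_prr] F'(4)[OF w(1)] G'(4)[OF w(2)] sum_split)
  next
    fix v :: "nat + nat \<Rightarrow>\<^sub>0 'k" assume v: "v \<in> vspace ({..<m} <+> {..<n})"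
    show "inl (F' (prl (?K v))) + inr (G' (prr (?K v))) = v"
      by (simp add: lin_add[OF lin_prl] lin_add[OF lin_prr] F'(2)[OF prl_in_vspace[OF v]]
          G'(2)[OF prr_in_vspace[OF v]] sum_split)
  qed
  then show ?thesis
    using dim_bij_vspace[OF lin] F(3) G(3) by (simp add: rk_def card_Plus)
qed

lemma finite_rk:
  assumes "comod q M"
  shows "finite {h. rk M h \<noteq> 0}"
proof (rule finite_subset)
  show "finite (\<Union>b\<in>basis M. {h. act M h (bvec b) \<noteq> 0})"
    using comodD(1)[OF assms] by (intro finite_UN_I finite_act)
  show "{h. rk M h \<noteq> 0} \<subseteq> (\<Union>b\<in>basis M. {h. act M h (bvec b) \<noteq> 0})"
  proof (rule subsetI, rule ccontr)
    fix h assume 1: "h \<in> {h. rk M h \<noteq> 0}" and 2: "h \<notin> (\<Union>b\<in>basis M. {h. act M h (bvec b) \<noteq> 0})"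
    have "act M h v = 0" if "v \<in> vspace (basis M)" for v
      by (rule lin_eq_on[OF lin_act lin_const_zero that]) (use 2 in auto)
    then have "act M h ` vspace (basis M) = vspace {}"
      by (auto simp: vspace_def intro: image_eqI[of _ _ 0])
    with 1 show False
      by (simp add: rk_def dim_vspace)
  qed
qed

text \<open>
  The rank of \<open>act M (i, l)\<close> counts the indecomposable summands whose support contains both \<open>i\<close> and
  \<open>i + l\<close>; the second difference counts those supported exactly on \<open>i, \<dots>, i + l\<close>.
\<close>

definition string_mult :: "('b, int \<times> nat, 'k::field) comodule \<Rightarrow> (int \<times> nat \<Rightarrow>\<^sub>0 int)" where
  "string_mult M = Abs_poly_mapping (\<lambda>(i, l).
     rk M (i, l) - rk M (i - 1, l + 1) - rk M (i, l + 1) + rk M (i - 1, l + 2))"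

lemma lookup_string_mult:
  assumes "comod q M"
  shows "Poly_Mapping.lookup (string_mult M) (i, l) =
    rk M (i, l) - rk M (i - 1, l + 1) - rk M (i, l + 1) + rk M (i - 1, l + 2)"
proof -
  let ?H = "{h. rk M h \<noteq> 0}"
  \<comment> \<open>The index shifts of the second difference. Each is injective, so each of the
    four terms is supported on a preimage of the finite support of \<open>rk M\<close>.\<close>
  let ?f = "\<lambda>d e (i :: int, l :: nat). (i - d, l + e)"
  have "inj (?f d e)" for d e
    by (auto simp: inj_def)
  then have fin: "finite (?f d e -` ?H)" for d e
    by (intro finite_vimageI finite_rk[OF assms])
  have "finite {x. (case x of (i, l) \<Rightarrow>
      rk M (i, l) - rk M (i - 1, l + 1) - rk M (i, l + 1) + rk M (i - 1, l + 2)) \<noteq> 0}"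
  proof (rule finite_subset)
    show "finite (?f 0 0 -` ?H \<union> ?f 1 1 -` ?H \<union> ?f 0 1 -` ?H \<union> ?f 1 2 -` ?H)"
      by (intro finite_UnI fin)
  qed auto
  then show ?thesis
    by (simp add: string_mult_def lookup_Abs_poly_mapping)
qed

lemma string_mult_iso: "comod q M \<Longrightarrow> comodule_iso M N \<Longrightarrow> string_mult M = string_mult N"
  by (simp add: string_mult_def rk_iso)

lemma string_mult_direct_sum: "comod q M \<Longrightarrow> comod q N \<Longrightarrow> string_mult (direct_sum M N) = string_mult M + string_mult N"
  by (rule poly_mapping_pair_eqI)
    (simp add: lookup_add lookup_string_mult[of q] comod_direct_sum rk_direct_sum[of q])

subsection \<open>Strings\<close>

text \<open>\<open>string i l\<close> is the indecomposable comodule living in the degrees \<open>i, \<dots>, i + l\<close>.\<close>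

definition string :: "int \<Rightarrow> nat \<Rightarrow> (nat, int \<times> nat, 'k::field) comodule" where
  "string i l = \<lparr> basis = {..l}, coact = (\<lambda>a. \<Sum>n\<le>l - a. bvec (a + n, (i + int a, n))) \<rparr>"

lemma basis_string [simp]: "basis (string i l) = {..l}"
  by (simp add: string_def)

lemma act_string_bvec:
  assumes "a \<le> l"
  shows "act (string i l) (j, n) (bvec a) = (if j = i + int a \<and> a + n \<le> l then bvec (a + n) else 0)"
proof -
  have "act (string i l) (j, n) (bvec a)
      = (\<Sum>n'\<le>l - a. slice (j, n) (bvec (a + n', (i + int a, n'))))"
    by (simp add: act_bvec string_def lin_sum[OF lin_slice])
  also have "\<dots> = (\<Sum>n'\<le>l - a. if n' = n then (if j = i + int a then bvec (a + n) else 0) else 0)"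
    by (rule sum.cong) (auto simp: slice_bvec)
  also have "\<dots> = (if j = i + int a \<and> a + n \<le> l then bvec (a + n) else 0)"
    using assms by auto
  finally show ?thesis .
qed

lemma lin_lookup: "lin (\<lambda>v. vscale (Poly_Mapping.lookup v x) w)"
  by (rule linI) (simp_all add: lookup_add vs.scale_left_distrib)

lemma act_string:
  assumes "v \<in> vspace {..l}"
  shows "act (string i l) (j, n) v =
    (if i \<le> j \<and> j + int n \<le> i + int l
     then vscale (Poly_Mapping.lookup v (nat (j - i))) (bvec (nat (j - i) + n)) else 0)" (is "_ = ?F v")
proof (rule lin_eq_on[OF lin_act _ assms, where G = ?F])
  show "lin ?F"
    by (cases "i \<le> j"; cases "j + int n \<le> i + int l") (simp_all add: lin_lookup lin_const_zero)
  fix a assume "a \<in> {..l}"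
  then show "act (string i l) (j, n) (bvec a) = ?F (bvec a)"
    by (auto simp: act_string_bvec lookup_single when_def)
qed

lemma comod_string: "comod q (string i l)"
proof (rule comodI)
  fix a assume "a \<in> basis (string i l)"
  then have a: "a \<le> l"
    by simp
  show "act (string i l) h (bvec a) \<in> vspace (basis (string i l))" for h
    by (cases h) (simp add: act_string_bvec a)
  show "act (string i l) (j, m) (act (string i l) (j', l') (bvec a)) =
      (if j = j' + int l' then act (string i l) (j', l' + m) (bvec a) else 0)" for j' l' j m
    by (auto simp: act_string_bvec a add.assoc)
  show "\<exists>S. finite S \<and> bvec a = (\<Sum>j\<in>S. act (string i l) (j, 0) (bvec a))"
    by (rule exI[of _ "{i + int a}"]) (simp add: act_string_bvec a)
qed simp

lemma rk_string:
  "rk (string i l :: (nat, int \<times> nat, 'k::field) comodule) (j, n) = (if i \<le> j \<and> j + int n \<le> i + int l then 1 else 0)"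
proof (cases "i \<le> j \<and> j + int n \<le> i + int l")
  case True
  let ?M = "string i l :: (nat, int \<times> nat, 'k) comodule"
  let ?b = "nat (j - i) + n"
  have le: "nat (j - i) \<le> l" "?b \<le> l"
    using True by auto
  have "act ?M (j, n) ` vspace {..l} = vspace {?b}"
  proof
    show "act ?M (j, n) ` vspace {..l} \<subseteq> vspace {?b}"
      using True by (auto simp: act_string intro!: vscale_in_vspace)
    show "vspace {?b} \<subseteq> act ?M (j, n) ` vspace {..l}"
    proof
      fix v :: "nat \<Rightarrow>\<^sub>0 'k" assume v: "v \<in> vspace {?b}"
      have "v = vscale (Poly_Mapping.lookup v ?b) (bvec ?b)"
        by (rule lin_eq_on[OF lin_id lin_lookup v]) simp
      also have "\<dots> = act ?M (j, n) (vscale (Poly_Mapping.lookup v ?b) (bvec (nat (j - i))))"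
        using True le by (simp add: lin_scale[OF lin_act] act_string_bvec)
      finally show "v \<in> act ?M (j, n) ` vspace {..l}"
        by (rule image_eqI) (use True in \<open>auto intro!: vscale_in_vspace\<close>)
    qed
  qed
  then show ?thesis
    using True by (simp add: rk_def dim_vspace)
next
  case False
  then have "act (string i l :: (nat, int \<times> nat, 'k) comodule) (j, n) ` vspace {..l} = vspace {}"
    by (auto simp: act_string vspace_def intro: image_eqI[of _ _ 0])
  then show ?thesis
    using False by (simp add: rk_def dim_vspace)
qed

text \<open>In terms of the end points \<open>j\<close> and \<open>j + n\<close>, the rank of a
  string is the product of the indicators of \<open>i \<le> j\<close> and
  \<open>j + n \<le> i + l\<close>. Differencing each factor leaves a delta at the corner.\<close>

lemma string_mult_string: "string_mult (string i l) = frag_of (i, l)"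
  by (rule poly_mapping_pair_eqI)
    (auto simp: lookup_string_mult[OF comod_string] rk_string)

text \<open>A string is cyclic: it is generated by its lowest vector, subject only to the relation
  that \<open>Suc l\<close> raises give zero. A homogeneous vector with this property therefore
  defines a morphism.\<close>

lemma morph_string:
  assumes M: "comod q M" and x: "x \<in> vspace (basis M)" "act M (i, 0) x = x" and top: "act M (i, Suc l) x = 0"
  shows "morph (string i l) M (lin_ext (\<lambda>a. act M (i, a) x))"
proof -
  have zero: "act M (i, n) x = 0" if "n > l" for n
  proof -
    have "act M (i, n) x = act M (i + int (Suc l), n - Suc l) (act M (i, Suc l) x)"
      using act_act[OF M x(1), of "i + int (Suc l)" "n - Suc l" i "Suc l"] that by simp
    then show ?thesis
      by (simp add: top)
  qed
  have "act M (j, n) (lin_ext (\<lambda>a. act M (i, a) x) v) = lin_ext (\<lambda>a. act M (i, a) x) (act (string i l) (j, n) v)"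
    if "v \<in> vspace {..l}" for v j n
  proof (rule lin_eq_on[OF lin_compose[OF lin_lin_ext lin_act] lin_compose[OF lin_act lin_lin_ext] that])
    fix a assume "a \<in> {..l}"
    then show "act M (j, n) (lin_ext (\<lambda>a. act M (i, a) x) (bvec a))
        = lin_ext (\<lambda>a. act M (i, a) x) (act (string i l) (j, n) (bvec a))"
      using zero[of "a + n"] by (auto simp: act_string_bvec act_act[OF M x(1)] lin_0[OF lin_lin_ext])
  qed
  then show ?thesis
    unfolding morph_def split_paired_All
    using act_in_vspace[OF M x(1)] by (auto simp: lin_lin_ext intro: lin_ext_in_vspace)
qed

lemma card_basis_iso:
  assumes "comodule_iso M N"
  shows "card (basis M) = card (basis N)"
proof -
  obtain F where "morph M N F" "bij_betw F (vspace (basis M)) (vspace (basis N))"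
    using assms by (auto simp: comodule_iso_iff)
  then show ?thesis
    using dim_bij_vspace[of F "basis M"] dim_vspace by (metis morphD(1))
qed

text \<open>
  For \<open>l\<close> maximal with some \<open>act M (i, l) \<noteq> 0\<close>, a string of length \<open>l\<close> in \<open>M\<close> has a retraction \<open>\<pi>\<close>, built from
  a linear functional that does not vanish on the end of the string.
\<close>

lemma split_string:
  fixes M :: "('b, int \<times> nat, 'k::field) comodule"
  assumes M: "comod q M" and ne: "basis M \<noteq> {}"
  obtains i l and U :: "(nat, int \<times> nat, 'k) comodule" where
    "comod q U" "comodule_iso (direct_sum (string i l) U) M" "card (basis U) < card (basis M)"
proof -
  let ?L = "\<Union>b\<in>basis M. {h. act M h (bvec b) \<noteq> 0}"
  have fin: "finite ?L"
    using comodD(1)[OF M] by (intro finite_UN_I finite_act)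
  obtain b0 where b0: "b0 \<in> basis M"
    using ne by blast
  have "?L \<noteq> {}"
  proof
    assume "?L = {}"
    then have "(\<Sum>i | act M (i, 0) (bvec b0) \<noteq> 0. act M (i, 0) (bvec b0)) = 0"
      using b0 by (intro sum.neutral ballI) blast
    moreover have "bvec b0 = (\<Sum>i | act M (i, 0) (bvec b0) \<noteq> 0. act M (i, 0) (bvec b0))"
      using b0 by (intro grade_expand[OF M]) simp
    ultimately have "bvec b0 = (0 :: 'b \<Rightarrow>\<^sub>0 'k)"
      by metis
    then show False
      by (metis lookup_single_eq lookup_zero zero_neq_one)
  qed
  then have "Max (snd ` ?L) \<in> snd ` ?L"
    using fin by (intro Max_in) auto
  then obtain i l b where b: "b \<in> basis M" "act M (i, l) (bvec b) \<noteq> 0" and l: "l = Max (snd ` ?L)"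
    by auto
  have large: "act M (j, n) w = 0" if n: "n > l" and w: "w \<in> vspace (basis M)" for j n w
  proof (rule lin_eq_on[OF lin_act lin_const_zero w])
    fix a assume a: "a \<in> basis M"
    show "act M (j, n) (bvec a) = 0"
    proof (rule ccontr)
      assume "act M (j, n) (bvec a) \<noteq> 0"
      then have "n \<in> snd ` ?L"
        using a by force
      then have "n \<le> l"
        unfolding l using fin by (intro Max_ge) auto
      with n show False
        by simp
    qed
  qed
  \<comment> \<open>The component of \<open>bvec b\<close> in degree \<open>i\<close> is the lowest
    vector of the string to be split off; passing to it does not change the value of
    \<open>act M (i, l)\<close>.\<close>
  define x where "x = act M (i, 0) (bvec b)"
  have bV: "bvec b \<in> vspace (basis M)"
    using b by simp
  have x: "x \<in> vspace (basis M)" "act M (i, 0) x = x" "act M (i, l) x \<noteq> 0"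
    using b act_in_vspace[OF M bV] act_act[OF M bV] by (simp_all add: x_def)
  obtain c where c: "Poly_Mapping.lookup (act M (i, l) x) c \<noteq> 0"
    using x(3) by (metis poly_mapping_eqI lookup_zero)
  \<comment> \<open>The functional is a coordinate \<open>c\<close> that is nonzero on the end of
    the string, normalised to take the value one there.\<close>
  define f where "f w = Poly_Mapping.lookup w c / Poly_Mapping.lookup (act M (i, l) x) c" for w
  have f: "f (u + v) = f u + f v" "f (vscale r u) = r * f u" "f 0 = 0" "f (act M (i, l) x) = 1" for u v r
    using c by (simp_all add: f_def lookup_add add_divide_distrib)
  define \<iota> where "\<iota> = lin_ext (\<lambda>a. act M (i, a) x)"
  \<comment> \<open>The component in degree \<open>i + a\<close> is first raised by the remaining
    \<open>l - a\<close> steps to the top degree, where \<open>f\<close> is read off. Compatibility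
    with raising is built into this formula.\<close>
  define \<pi> where "\<pi> w = (\<Sum>a\<le>l. vscale (f (act M (i + int a, l - a) w)) (bvec a))" for w
  let ?S = "string i l :: (nat, int \<times> nat, 'k) comodule"
  have \<iota>: "morph ?S M \<iota>"
    unfolding \<iota>_def by (rule morph_string[OF M x(1,2)]) (simp add: large x(1))
  have lookup_\<pi>: "Poly_Mapping.lookup (\<pi> w) e = (if e \<le> l then f (act M (i + int e, l - e) w) else 0)" for w e
  proof -
    have "Poly_Mapping.lookup (\<pi> w) e = (\<Sum>a\<le>l. if a = e then f (act M (i + int e, l - e) w) else 0)"
      unfolding \<pi>_def lookup_sum by (rule sum.cong) (auto simp: lookup_single when_def)
    then show ?thesis
      by simp
  qed
  have \<pi>V: "\<pi> w \<in> vspace {..l}" for w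
    by (auto simp: vspace_def in_keys_iff lookup_\<pi> split: if_splits)
  have lin_\<pi>: "lin \<pi>"
    by (intro linI poly_mapping_eqI)
      (simp_all add: lookup_\<pi> lookup_add lin_add[OF lin_act] lin_scale[OF lin_act] f)
  have act_\<pi>: "act ?S (j, n) (\<pi> w) = \<pi> (act M (j, n) w)" if w: "w \<in> vspace (basis M)" for j n w
  proof (rule poly_mapping_eqI)
    fix e
    have R: "Poly_Mapping.lookup (\<pi> (act M (j, n) w)) e
        = (if e \<le> l \<and> i + int e = j + int n then f (act M (j, n + (l - e)) w) else 0)"
      by (auto simp: lookup_\<pi> act_act[OF M w] f)
    show "Poly_Mapping.lookup (act ?S (j, n) (\<pi> w)) e = Poly_Mapping.lookup (\<pi> (act M (j, n) w)) e"
    proof (cases "e \<le> l \<and> i + int e = j + int n")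
      case True
      then have e: "e \<le> l" "i + int e = j + int n"
        by auto
      show ?thesis
      proof (cases "i \<le> j")
        case True
        with e have "nat (j - i) + n = e" "nat (j - i) \<le> l" "l - nat (j - i) = n + (l - e)"
          "j + int n \<le> i + int l"
          by auto
        then show ?thesis
          unfolding R using e True by (simp add: act_string[OF \<pi>V] lookup_\<pi> lookup_single)
      next
        case False
        \<comment> \<open>From a degree below \<open>i\<close>, the way up to the top degree
          \<open>i + l\<close> has length \<open>n + (l - e) > l\<close>, so maximality of
          \<open>l\<close> makes the right side vanish.\<close>
        with e have "n + (l - e) > l"
          by auto
        then show ?thesis
          unfolding R using e False by (simp add: act_string[OF \<pi>V] large[OF _ w] f)
      qed
    next
      case False
      then show ?thesis
        unfolding R by (auto simp: act_string[OF \<pi>V] lookup_single when_def)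
    qed
  qed
  have \<pi>\<iota>: "\<pi> (\<iota> s) = s" if s: "s \<in> vspace {..l}" for s
  proof (rule lin_eq_on[OF lin_compose[OF morphD(1)[OF \<iota>] lin_\<pi>] lin_id s])
    fix a assume a: "a \<in> {..l}"
    show "\<pi> (\<iota> (bvec a)) = bvec a"
      by (rule poly_mapping_eqI)
        (use a in \<open>auto simp: \<iota>_def lookup_\<pi> act_act[OF M x(1)] lookup_single when_def f\<close>)
  qed
  let ?W = "{w \<in> vspace (basis M). \<pi> w = 0}"
  have "vs.subspace ?W"
    by (rule vs.subspaceI)
      (auto simp: add_in_vspace vscale_in_vspace lin_0[OF lin_\<pi>] lin_add[OF lin_\<pi>] lin_scale[OF lin_\<pi>])
  moreover have "act M h w \<in> ?W" if "w \<in> ?W" for h w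
    using that act_in_vspace[OF M, of w h] act_\<pi>[of w "fst h" "snd h"] by auto
  ultimately obtain U :: "(nat, int \<times> nat, 'k) comodule" and g where
    U: "comod q U" "morph U M g" "bij_betw g (vspace (basis U)) ?W"
    using subcomodule[OF M, of ?W] by blast
  obtain g' where g': "lin g'" "\<And>v. v \<in> vspace (basis U) \<Longrightarrow> g' (g v) = v"
    "\<And>w. w \<in> ?W \<Longrightarrow> g' w \<in> vspace (basis U)" "\<And>w. w \<in> ?W \<Longrightarrow> g (g' w) = w"
    using lin_inverse[OF morphD(1)[OF U(2)] U(3)] by blast
  have gW: "g v \<in> ?W" if "v \<in> vspace (basis U)" for v
    using U(3) that unfolding bij_betw_def by blast
  let ?K = "\<lambda>v. \<iota> (prl v) + g (prr v)"
  have K: "morph (direct_sum ?S U) M ?K"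
    by (rule morph_case_sum[OF \<iota> U(2)])
  have "bij_betw ?K (vspace (basis (direct_sum ?S U))) (vspace (basis M))"
  proof (rule bij_betw_lin_vspaceI[OF morphD(1)[OF K], where G = "\<lambda>w. inl (\<pi> w) + inr (g' (w - \<iota> (\<pi> w)))"])
    show "?K ` vspace (basis (direct_sum ?S U)) \<subseteq> vspace (basis M)"
      using morphD(2)[OF K] by blast
  next
    fix w :: "'b \<Rightarrow>\<^sub>0 'k" assume w: "w \<in> vspace (basis M)"
    have "\<pi> (w - \<iota> (\<pi> w)) = 0"
      by (simp add: vp.linear_diff[OF lin_\<pi>] \<pi>\<iota>[OF \<pi>V])
    moreover have "\<iota> (\<pi> w) \<in> vspace (basis M)"
      using morphD(2)[OF \<iota>] \<pi>V by simp
    ultimately have W: "w - \<iota> (\<pi> w) \<in> ?W"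
      using vs.subspace_diff[OF subspace_vspace w] by simp
    show "inl (\<pi> w) + inr (g' (w - \<iota> (\<pi> w))) \<in> vspace (basis (direct_sum ?S U))"
      using g'(3)[OF W] \<pi>V by (auto intro!: add_in_vspace inl_in_vspace inr_in_vspace)
    show "?K (inl (\<pi> w) + inr (g' (w - \<iota> (\<pi> w)))) = w"
      by (simp add: lin_add[OF lin_prl] lin_add[OF lin_prr] g'(4)[OF W])
  next
    fix v :: "nat + nat \<Rightarrow>\<^sub>0 'k" assume "v \<in> vspace (basis (direct_sum ?S U))"
    then have v: "prl v \<in> vspace {..l}" "prr v \<in> vspace (basis U)"
      by (auto intro: prl_in_vspace prr_in_vspace)
    have \<pi>K: "\<pi> (?K v) = prl v"
      using gW[OF v(2)] by (simp add: lin_add[OF lin_\<pi>] \<pi>\<iota>[OF v(1)])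
    show "inl (\<pi> (?K v)) + inr (g' (?K v - \<iota> (\<pi> (?K v)))) = v"
      unfolding \<pi>K by (simp add: g'(2)[OF v(2)] sum_split)
  qed
  then have iso: "comodule_iso (direct_sum ?S U) M"
    by (rule comodule_isoI[OF K])
  have "card (basis M) = Suc l + card (basis U)"
    using card_basis_iso[OF iso] comodD(1)[OF U(1)] by (simp add: card_Plus)
  then show thesis
    using that[OF U(1) iso] by simp
qed

section \<open>Gaussian binomial coefficients\<close>

text \<open>A division-free form of the Gaussian binomial. Of the two \<open>q\<close>-Pascal rules
  this is the one in which raising the second tensor factor carries the power of
  \<open>q\<close>.\<close>

fun gauss :: "nat \<Rightarrow> nat \<Rightarrow> 'k::field poly" where
  "gauss 0 m = 1"
| "gauss (Suc l) 0 = 1"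
| "gauss (Suc l) (Suc m) = gauss l (Suc m) + monom 1 (Suc l) * gauss (Suc l) m"

lemma q_int_poly_add: "q_int_poly (a + b) = q_int_poly a + monom 1 a * q_int_poly b"
proof -
  have "(\<Sum>i<a + b. monom 1 i) = (\<Sum>i<a. monom 1 i) + (\<Sum>i<b. monom (1 :: 'a) (i + a))"
    by (induction b) (simp_all add: algebra_simps)
  then show ?thesis
    by (simp add: q_int_poly_def sum_distrib_left mult_monom add.commute)
qed

lemma q_fact_poly_Suc: "q_fact_poly (Suc l) = q_int_poly (Suc l) * q_fact_poly l"
  by (simp add: q_fact_poly_def mult.commute)

lemma q_fact_poly_0 [simp]: "q_fact_poly 0 = 1"
  by (simp add: q_fact_poly_def)

text \<open>Multiplying the Pascal rule by both factorials reduces it to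
  \<open>[a + b] = [a] + q^a [b]\<close> for quantum integers. It identifies \<open>gauss\<close>
  with the exact quotient in \<open>gauss_binomial\<close>.\<close>

lemma gauss_fact: "(gauss l m :: 'k::field poly) * (q_fact_poly l * q_fact_poly m) = q_fact_poly (l + m)"
proof (induction l m rule: gauss.induct)
  case (3 l m)
  have "(gauss (Suc l) (Suc m) :: 'k poly) * (q_fact_poly (Suc l) * q_fact_poly (Suc m))
      = q_int_poly (Suc l) * (gauss l (Suc m) * (q_fact_poly l * q_fact_poly (Suc m)))
        + monom 1 (Suc l) * q_int_poly (Suc m) * (gauss (Suc l) m * (q_fact_poly (Suc l) * q_fact_poly m))"
    by (simp add: q_fact_poly_Suc algebra_simps)
  also have "\<dots> = (q_int_poly (Suc l) + monom 1 (Suc l) * q_int_poly (Suc m)) * q_fact_poly (l + Suc m)"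
    unfolding 3 by (simp add: algebra_simps)
  also have "\<dots> = q_fact_poly (Suc l + Suc m)"
    using q_fact_poly_Suc[of "l + Suc m", where 'a = 'k] q_int_poly_add[of "Suc l" "Suc m", where 'a = 'k] by simp
  finally show ?case .
qed simp_all

text \<open>Positive quantum integers have constant coefficient one, so as polynomials they are
  nonzero whatever their value at \<open>q\<close>. This permits cancelling before
  evaluation.\<close>

lemma q_fact_poly_nonzero: "q_fact_poly l \<noteq> 0"
proof -
  have "q_int_poly (Suc i) \<noteq> (0 :: 'a poly)" for i
  proof -
    have "coeff (q_int_poly (Suc i) :: 'a poly) 0 = 1"
      using q_int_poly_add[of 1 i, where 'a = 'a] by (simp add: q_int_poly_def coeff_monom_mult)
    then show ?thesis
      by auto
  qed
  then show ?thesis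
    by (induction l) (simp_all add: q_fact_poly_Suc)
qed

lemma gauss_binomial_eq: "gauss_binomial l m q = poly (gauss l m) q"
  unfolding gauss_binomial_def gauss_fact[symmetric] by (simp add: q_fact_poly_nonzero)

lemma gauss_binomial_0 [simp]: "gauss_binomial 0 m q = 1" "gauss_binomial l 0 q = 1"
  by (simp_all add: gauss_binomial_eq gauss.simps(1)) (cases l; simp)

lemma gauss_binomial_Suc:
  "gauss_binomial (Suc l) (Suc m) q = gauss_binomial l (Suc m) q + q ^ Suc l * gauss_binomial (Suc l) m q"
  by (simp add: gauss_binomial_eq poly_monom)

lemma gauss_binomial_1: "gauss_binomial (Suc 0) m q = (\<Sum>k\<le>m. q ^ k)"
  by (induction m) (simp_all add: gauss_binomial_Suc sum.atMost_Suc_shift sum_distrib_left del: sum.atMost_Suc)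

section \<open>Tensor products of comodules\<close>

text \<open>The counterpart of \<open>tensor_map\<close> for maps that are given on vectors rather
  than on basis elements.\<close>

definition tmap :: "(('a \<Rightarrow>\<^sub>0 'k::field) \<Rightarrow> ('c \<Rightarrow>\<^sub>0 'k)) \<Rightarrow> (('b \<Rightarrow>\<^sub>0 'k) \<Rightarrow> ('d \<Rightarrow>\<^sub>0 'k))
    \<Rightarrow> ('a \<times> 'b \<Rightarrow>\<^sub>0 'k) \<Rightarrow> ('c \<times> 'd \<Rightarrow>\<^sub>0 'k)" where
  "tmap F G = lin_ext (\<lambda>(a, b). tensor_vec (F (bvec a)) (G (bvec b)))"

lemma lin_tmap: "lin (tmap F G)"
  by (simp add: tmap_def lin_lin_ext)

lemma tmap_bvec: "tmap F G (bvec (a, b)) = tensor_vec (F (bvec a)) (G (bvec b))"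
  by (simp add: tmap_def)

lemma tmap_tensor:
  assumes "lin F" "lin G"
  shows "tmap F G (tensor_vec u v) = tensor_vec (F u) (G v)"
proof -
  have "tmap F G (tensor_vec (bvec a) v) = tensor_vec (F (bvec a)) (G v)" for a
    by (rule lin_eqI[OF lin_compose[OF lin_tensor_right lin_tmap] lin_compose[OF assms(2) lin_tensor_right]])
      (simp add: tmap_bvec)
  then show ?thesis
    by (rule lin_eqI[OF lin_compose[OF lin_tensor_left lin_tmap] lin_compose[OF assms(1) lin_tensor_left]])
qed

lemma tmap_in_vspace:
  assumes "w \<in> vspace (A \<times> B)" "\<And>a. a \<in> A \<Longrightarrow> F (bvec a) \<in> vspace C" "\<And>b. b \<in> B \<Longrightarrow> G (bvec b) \<in> vspace D"
  shows "tmap F G w \<in> vspace (C \<times> D)"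
  by (rule lin_in_subspace[OF lin_tmap assms(1) subspace_vspace])
    (auto simp: tmap_bvec intro!: tensor_in_vspace assms)

lemma basis_tensor [simp]: "basis (tensor_prod H U V) = basis U \<times> basis V"
  by (simp add: tensor_prod_def)

text \<open>\<open>S\<close> and \<open>T\<close> may exceed the supports, so that a specialisation
  can choose an index set of convenient shape.\<close>

lemma act_tensor_general:
  fixes U :: "('b, 'h, 'k::field) comodule" and V :: "('c, 'h, 'k) comodule"
  assumes S: "finite S" "{h. act U h u \<noteq> 0} \<subseteq> S" and T: "finite T" "{h. act V h v \<noteq> 0} \<subseteq> T"
  shows "act (tensor_prod H U V) h (tensor_vec u v) =
    (\<Sum>(h1, h2)\<in>S \<times> T. vscale (Poly_Mapping.lookup (h_mult H h1 h2) h) (tensor_vec (act U h1 u) (act V h2 v)))"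
proof -
  define \<Theta> :: "('b \<times> 'h) \<times> ('c \<times> 'h) \<Rightarrow> (('b \<times> 'c) \<times> 'h \<Rightarrow>\<^sub>0 'k)"
    where "\<Theta> = (\<lambda>((u\<^sub>0, u\<^sub>1), (v\<^sub>0, v\<^sub>1)). tensor_vec (bvec (u\<^sub>0, v\<^sub>0)) (h_mult H u\<^sub>1 v\<^sub>1))"
  have coact: "coact (tensor_prod H U V) (b, c) = lin_ext \<Theta> (tensor_vec (coact U b) (coact V c))" for b c
    by (simp add: tensor_prod_def \<Theta>_def)
  have bilin: "lin (\<lambda>w. lin_ext \<Theta> (tensor_vec w w'))" "lin (\<lambda>w. lin_ext \<Theta> (tensor_vec w'' w))" for w' w''
    by (rule lin_compose[OF lin_tensor_left lin_lin_ext], rule lin_compose[OF lin_tensor_right lin_lin_ext])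
  have 0: "lin_ext (coact (tensor_prod H U V)) (tensor_vec (bvec b) v)
      = lin_ext \<Theta> (tensor_vec (coact U b) (lin_ext (coact V) v))" for b
    by (rule lin_eqI[OF lin_compose[OF lin_tensor_right lin_lin_ext] lin_compose[OF lin_lin_ext bilin(2)]])
      (simp add: coact)
  have 1: "lin_ext (coact (tensor_prod H U V)) (tensor_vec u v)
      = lin_ext \<Theta> (tensor_vec (lin_ext (coact U) u) (lin_ext (coact V) v))"
    by (rule lin_eqI[OF lin_compose[OF lin_tensor_left lin_lin_ext] lin_compose[OF lin_lin_ext bilin(1)]])
      (simp add: 0)
  have "lin_ext \<Theta> (tensor_vec (tensor_vec (bvec b) (bvec h1)) (tensor_vec y (bvec h2)))
      = tensor_vec (tensor_vec (bvec b) y) (h_mult H h1 h2)" for b y h1 h2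
    by (rule lin_eqI[OF lin_compose[OF lin_tensor_left bilin(2)] lin_compose[OF lin_tensor_right lin_tensor_left]])
      (simp add: \<Theta>_def)
  then have 2: "lin_ext \<Theta> (tensor_vec (tensor_vec x (bvec h1)) (tensor_vec y (bvec h2)))
      = tensor_vec (tensor_vec x y) (h_mult H h1 h2)" for x y h1 h2
    by (rule lin_eqI[OF lin_compose[OF lin_tensor_left bilin(1)] lin_compose[OF lin_tensor_left lin_tensor_left]])
  have u: "lin_ext (coact U) u = (\<Sum>h1\<in>S. tensor_vec (act U h1 u) (bvec h1))"
    unfolding act_def by (rule slice_expand[OF S(1)]) (use S(2) in \<open>auto simp: act_def\<close>)
  have v: "lin_ext (coact V) v = (\<Sum>h2\<in>T. tensor_vec (act V h2 v) (bvec h2))"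
    unfolding act_def by (rule slice_expand[OF T(1)]) (use T(2) in \<open>auto simp: act_def\<close>)
  have "lin_ext (coact (tensor_prod H U V)) (tensor_vec u v)
     = (\<Sum>h1\<in>S. \<Sum>h2\<in>T. tensor_vec (tensor_vec (act U h1 u) (act V h2 v)) (h_mult H h1 h2))"
    unfolding 1 u v by (simp add: tensor_sum lin_sum[OF lin_lin_ext] 2 sum.swap[of _ T S])
  then show ?thesis
    unfolding act_def[of "tensor_prod H U V"]
    by (simp only: lin_sum[OF lin_slice] slice_tensor flip: sum.cartesian_product)
qed

abbreviation tp where "tp q \<equiv> tensor_prod (path_hopf q)"

lemma act_tensor:
  fixes U :: "('b, int \<times> nat, 'k::field) comodule" and V :: "('c, int \<times> nat, 'k) comodule"
  assumes U: "comod q U" and V: "comod q V" and u: "u \<in> deg U i" and v: "v \<in> deg V j"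
  shows "act (tp q U V) (k, n) (tensor_vec u v) =
    (if k = i + j then \<Sum>s\<le>n. vscale (q powi (i * int (n - s)) * gauss_binomial s (n - s) q)
        (tensor_vec (act U (i, s) u) (act V (j, n - s) v)) else 0)"
proof -
  \<comment> \<open>The supports are padded with all lengths up to \<open>n\<close>, so that the
    diagonal \<open>?g\<close> lies in the index set. Off the diagonal the terms vanish: only paths
    from \<open>i\<close> and \<open>j\<close> act on \<open>u\<close> and \<open>v\<close>, and
    multiplication adds lengths.\<close>
  let ?S = "{h. act U h u \<noteq> 0} \<union> Pair i ` {..n}" and ?T = "{h. act V h v \<noteq> 0} \<union> Pair j ` {..n}"
  let ?f = "\<lambda>(h1, h2). vscale (Poly_Mapping.lookup (h_mult (path_hopf q) h1 h2) (k, n))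
    (tensor_vec (act U h1 u) (act V h2 v))"
  let ?g = "\<lambda>s. ((i, s), (j, n - s))"
  have fst: "fst h1 = i" if "act U h1 u \<noteq> 0" for h1
    using act_deg[OF U u, of "fst h1" "snd h1"] that by auto
  have snd: "fst h2 = j" if "act V h2 v \<noteq> 0" for h2
    using act_deg[OF V v, of "fst h2" "snd h2"] that by auto
  have mult: "Poly_Mapping.lookup (h_mult (path_hopf q) (i, s) (j, t)) (k, n)
      = (if k = i + j \<and> n = s + t then q powi (i * int t) * gauss_binomial s t q else 0)" for s t
    by (auto simp: path_hopf_def lookup_single when_def)
  have "act (tp q U V) (k, n) (tensor_vec u v) = sum ?f (?S \<times> ?T)"
    by (rule act_tensor_general) (auto intro: finite_act)
  also have "\<dots> = sum ?f (?g ` {..n})"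
  proof (rule sum.mono_neutral_right)
    show "finite (?S \<times> ?T)"
      by (intro finite_cartesian_product finite_UnI finite_act finite_imageI finite_atMost)
    show "?g ` {..n} \<subseteq> ?S \<times> ?T"
      by auto
    show "\<forall>p\<in>?S \<times> ?T - ?g ` {..n}. ?f p = 0"
    proof
      fix p assume p: "p \<in> ?S \<times> ?T - ?g ` {..n}"
      obtain h1 h2 where h: "p = (h1, h2)"
        by (cases p)
      obtain s t where st: "h1 = (i, s)" "h2 = (j, t)"
        using p fst[of h1] snd[of h2] unfolding h by (cases h1, cases h2) auto
      have "n \<noteq> s + t"
      proof
        assume "n = s + t"
        then have "p = ?g s" "s \<le> n"
          by (simp_all add: h st)
        with p show False
          by blast
      qed
      then show "?f p = 0"
        by (simp add: h st mult)
    qed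
  qed
  also have "\<dots> = (\<Sum>s\<le>n. ?f (?g s))"
    by (subst sum.reindex) (auto simp: inj_on_def)
  finally show ?thesis
    by (simp add: mult)
qed

lemma act_tensor_0:
  assumes "comod q U" "comod q V" "u \<in> deg U i" "v \<in> deg V j"
  shows "act (tp q U V) (k, 0) (tensor_vec u v) = (if k = i + j then tensor_vec u v else 0)"
  using assms by (simp add: act_tensor[OF assms] deg_def)

text \<open>The skew Leibniz rule of the raising operator. Its weight is the factor of the product
  of the trivial path at \<open>i\<close> with an arrow.\<close>

lemma act_tensor_1:
  assumes "comod q U" "comod q V" "u \<in> deg U i" "v \<in> deg V j"
  shows "act (tp q U V) (k, Suc 0) (tensor_vec u v) = (if k = i + j then
    tensor_vec (act U (i, Suc 0) u) v + vscale (q powi i) (tensor_vec u (act V (j, Suc 0) v)) else 0)"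
  using assms(3,4) by (simp add: act_tensor[OF assms] deg_def add.commute)

lemma tensor_in_deg:
  assumes "comod q U" "comod q V" "u \<in> deg U i" "v \<in> deg V j" "k = i + j"
  shows "tensor_vec u v \<in> deg (tp q U V) k"
  using assms(3,4,5) tensor_in_vspace[OF deg_vspace deg_vspace, OF assms(3,4)]
  by (simp add: deg_def[of "tp q U V"] act_tensor_0[OF assms(1-4)])

lemma lin_eq_on_deg2:
  fixes U :: "('b, int \<times> nat, 'k::field) comodule" and V :: "('c, int \<times> nat, 'k) comodule"
  assumes U: "comod q U" and V: "comod q V" and lin: "lin F" "lin G"
    and eq: "\<And>i j u v. u \<in> deg U i \<Longrightarrow> v \<in> deg V j \<Longrightarrow> F (tensor_vec u v) = G (tensor_vec u v)"
    and w: "w \<in> vspace (basis U \<times> basis V)"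
  shows "F w = G w"
proof (rule lin_eq_on[OF lin w])
  fix x assume "x \<in> basis U \<times> basis V"
  then obtain b c where x: "x = (b, c)" "b \<in> basis U" "c \<in> basis V"
    by auto
  have *: "F (tensor_vec (bvec b) v) = G (tensor_vec (bvec b) v)" if "v \<in> deg V j" for v j
    by (rule lin_eq_on_deg[OF U lin_compose[OF lin_tensor_left lin(1)] lin_compose[OF lin_tensor_left lin(2)]])
      (use x eq that in auto)
  have "F (tensor_vec (bvec b) (bvec c)) = G (tensor_vec (bvec b) (bvec c))"
    by (rule lin_eq_on_deg[OF V lin_compose[OF lin_tensor_right lin(1)] lin_compose[OF lin_tensor_right lin(2)]])
      (use x * in auto)
  then show "F (bvec x) = G (bvec x)"
    by (simp add: x)
qed

lemma lin_eq_on_deg3: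
  fixes U :: "('b, int \<times> nat, 'k::field) comodule" and V :: "('c, int \<times> nat, 'k) comodule"
    and W :: "('d, int \<times> nat, 'k) comodule"
  assumes U: "comod q U" and V: "comod q V" and W: "comod q W" and lin: "lin F" "lin G"
    and eq: "\<And>i j k u v w. u \<in> deg U i \<Longrightarrow> v \<in> deg V j \<Longrightarrow> w \<in> deg W k \<Longrightarrow>
      F (tensor_vec (tensor_vec u v) w) = G (tensor_vec (tensor_vec u v) w)"
    and x: "x \<in> vspace ((basis U \<times> basis V) \<times> basis W)"
  shows "F x = G x"
proof (rule lin_eq_on[OF lin x])
  fix y assume "y \<in> (basis U \<times> basis V) \<times> basis W"
  then obtain b c where y: "y = (b, c)" "b \<in> basis U \<times> basis V" "c \<in> basis W"
    by auto
  have *: "F (tensor_vec (bvec b) v) = G (tensor_vec (bvec b) v)" if "v \<in> deg W j" for v j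
    by (rule lin_eq_on_deg2[OF U V lin_compose[OF lin_tensor_left lin(1)] lin_compose[OF lin_tensor_left lin(2)]])
      (use y eq that in auto)
  have "F (tensor_vec (bvec b) (bvec c)) = G (tensor_vec (bvec b) (bvec c))"
    by (rule lin_eq_on_deg[OF W lin_compose[OF lin_tensor_right lin(1)] lin_compose[OF lin_tensor_right lin(2)]])
      (use y * in auto)
  then show "F (bvec y) = G (bvec y)"
    by (simp add: y)
qed

text \<open>The \<open>q\<close>-Pascal rule makes the coefficients of \<open>act\<close> on a tensor product iterates of degree one.\<close>

lemma act_tensor_Suc:
  fixes U :: "('b, int \<times> nat, 'k::field) comodule" and V :: "('c, int \<times> nat, 'k) comodule"
  assumes q: "q \<noteq> 0" and U: "comod q U" and V: "comod q V" and w: "w \<in> vspace (basis U \<times> basis V)"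
  shows "act (tp q U V) (k, Suc n) w = act (tp q U V) (k + int n, Suc 0) (act (tp q U V) (k, n) w)"
proof (rule lin_eq_on_deg2[OF U V lin_act lin_compose[OF lin_act lin_act] _ w])
  fix i j u v assume u: "u \<in> deg U i" and v: "v \<in> deg V j"
  let ?T = "tp q U V"
  show "act ?T (k, Suc n) (tensor_vec u v) = act ?T (k + int n, Suc 0) (act ?T (k, n) (tensor_vec u v))"
  proof (cases "k = i + j")
    case True
    define t where "t a b = tensor_vec (act U (i, a) u) (act V (j, b) v)" for a b
    define c where "c a b = q powi (i * int b) * gauss_binomial a b q" for a b
    have act_n: "act ?T (k, n) (tensor_vec u v) = (\<Sum>s\<le>n. vscale (c s (n - s)) (t s (n - s)))" for n
      using True by (simp add: act_tensor[OF U V u v] c_def t_def)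
    have step: "act ?T (k + int n, Suc 0) (t s (n - s)) = t (Suc s) (n - s) + vscale (q powi (i + int s)) (t s (Suc (n - s)))"
      if "s \<le> n" for s
      unfolding t_def
      using act_tensor_1[OF U V act_in_degI[OF U u refl, of s] act_in_degI[OF V v refl, of "n - s"], of "k + int n"]
        act_Suc[OF U deg_vspace[OF u], of i s] act_Suc[OF V deg_vspace[OF v], of j "n - s"] that True
      by simp
    \<comment> \<open>The last factor is the weight of raising \<open>v\<close> past a vector of
      degree \<open>i + Suc a\<close>, so the \<open>q\<close>-Pascal rule counts the two ways to
      reach the exponents \<open>Suc a\<close>, \<open>Suc b\<close> by one more raise.\<close>
    have pascal: "c (Suc a) (Suc b) = c a (Suc b) + c (Suc a) b * q powi (i + int (Suc a))" for a b
    proof -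
      have "q powi (i * int (Suc b)) = q powi (i * int b) * q powi i"
        using q by (simp add: power_int_add algebra_simps)
      moreover have "q powi (i + int (Suc a)) = q powi i * q ^ Suc a"
        using q by (simp add: power_int_add flip: power_int_of_nat)
      ultimately show ?thesis
        unfolding c_def gauss_binomial_Suc by (simp add: algebra_simps)
    qed
    have c0: "c a 0 = 1" "c 0 b * q powi i = c 0 (Suc b)" for a b
      using q by (simp_all add: c_def power_int_add algebra_simps)
    have "act ?T (k + int n, Suc 0) (act ?T (k, n) (tensor_vec u v))
        = (\<Sum>s\<le>n. vscale (c s (n - s)) (t (Suc s) (n - s) + vscale (q powi (i + int s)) (t s (Suc (n - s)))))"
      unfolding act_n by (simp add: lin_sum[OF lin_act] lin_scale[OF lin_act] step cong: sum.cong_simp)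
    also have "\<dots> = (\<Sum>s\<le>n. vscale (c s (n - s)) (t (Suc s) (n - s)))
        + (\<Sum>s\<le>n. vscale (c s (n - s) * q powi (i + int s)) (t s (Suc (n - s))))"
      by (simp add: vs.scale_right_distrib sum.distrib)
    \<comment> \<open>Terms are regrouped by their final exponents. An inner term receives one
      contribution from raising \<open>u\<close> and one from raising \<open>v\<close>, joined by
      \<open>pascal\<close>; each end receives a single one, handled by \<open>c0\<close>.\<close>
    also have "\<dots> = (\<Sum>s\<le>Suc n. vscale (c s (Suc n - s)) (t s (Suc n - s)))"
    proof (cases n)
      case 0
      then show ?thesis
        using c0(2)[of 0] by (simp add: c0 add.commute)
    next
      case (Suc m)
      let ?R = "\<Sum>s\<le>m. vscale (c (Suc s) (m - s) * q powi (i + int (Suc s))) (t (Suc s) (Suc (m - s)))"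
      let ?L = "\<Sum>s\<le>m. vscale (c s (Suc (m - s))) (t (Suc s) (Suc (m - s)))"
      have "(\<Sum>s\<le>n. vscale (c s (n - s)) (t (Suc s) (n - s))) = ?L + t (Suc n) 0"
        by (simp add: Suc c0 Suc_diff_le cong: sum.cong_simp)
      moreover have "(\<Sum>s\<le>n. vscale (c s (n - s) * q powi (i + int s)) (t s (Suc (n - s)))) = vscale (c 0 (Suc n)) (t 0 (Suc n)) + ?R"
        unfolding Suc sum.atMost_Suc_shift by (simp add: c0)
      moreover have "?L + ?R = (\<Sum>s\<le>m. vscale (c (Suc s) (Suc (m - s))) (t (Suc s) (Suc (m - s))))"
        unfolding pascal by (simp add: vs.scale_left_distrib sum.distrib)
      moreover have "(\<Sum>s\<le>Suc n. vscale (c s (Suc n - s)) (t s (Suc n - s)))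
          = vscale (c 0 (Suc n)) (t 0 (Suc n))
            + (\<Sum>s\<le>m. vscale (c (Suc s) (Suc (m - s))) (t (Suc s) (Suc (m - s)))) + t (Suc n) 0"
        unfolding sum.atMost_Suc_shift[of _ n] unfolding Suc by (simp add: c0 Suc_diff_le cong: sum.cong_simp)
      ultimately show ?thesis
        by (simp add: algebra_simps)
    qed
    also have "\<dots> = act ?T (k, Suc n) (tensor_vec u v)"
      by (rule act_n[symmetric])
    finally show ?thesis ..
  next
    case False
    then show ?thesis
      by (simp add: act_tensor[OF U V u v])
  qed
qed

text \<open>Composition of paths is proved by induction on the length of the second path: length
  zero is a statement about degrees, and \<open>act_tensor_Suc\<close> is the induction
  step.\<close>

lemma comod_tensor:
  fixes U :: "('b, int \<times> nat, 'k::field) comodule" and V :: "('c, int \<times> nat, 'k) comodule"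
  assumes q: "q \<noteq> 0" and U: "comod q U" and V: "comod q V"
  shows "comod q (tp q U V)"
proof -
  let ?T = "tp q U V"
  have act_0: "act ?T (k, 0) (act ?T (i, l) w) = (if k = i + int l then act ?T (i, l) w else 0)"
    if "w \<in> vspace (basis U \<times> basis V)" for k i l w
  proof (rule lin_eq_on_deg2[OF U V lin_compose[OF lin_act lin_act] _ _ that])
    show "lin (\<lambda>w. if k = i + int l then act ?T (i, l) w else 0)"
      by (cases "k = i + int l") (simp_all add: lin_act lin_const_zero)
    fix a b u v assume u: "u \<in> deg U a" and v: "v \<in> deg V b"
    have "act ?T (k, 0) (tensor_vec (act U (a, s) u) (act V (b, l - s) v))
        = (if k = a + b + int l then tensor_vec (act U (a, s) u) (act V (b, l - s) v) else 0)" if "s \<le> l" for s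
      using act_tensor_0[OF U V act_in_degI[OF U u refl, of s] act_in_degI[OF V v refl, of "l - s"], of k] that
      by (simp add: of_nat_diff)
    then show "act ?T (k, 0) (act ?T (i, l) (tensor_vec u v))
        = (if k = i + int l then act ?T (i, l) (tensor_vec u v) else 0)"
      by (cases "i = a + b"; cases "k = a + b + int l")
        (simp_all add: act_tensor[OF U V u v] lin_sum[OF lin_act] lin_scale[OF lin_act] cong: sum.cong_simp)
  qed
  have in_space: "act ?T h w \<in> vspace (basis U \<times> basis V)" if "w \<in> vspace (basis U \<times> basis V)" for h w
  proof -
    have 1: "act ?T h (tensor_vec u v) \<in> vspace (basis U \<times> basis V)"
      if "u \<in> deg U i" "v \<in> deg V j" for u v i j
      by (cases h) (auto simp: act_tensor[OF U V that] intro!: sum_in_vspace vscale_in_vspace tensor_in_vspace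
          act_in_vspace[OF U] act_in_vspace[OF V] deg_vspace[OF that(1)] deg_vspace[OF that(2)])
    have 2: "act ?T h (tensor_vec (bvec b) v) \<in> vspace (basis U \<times> basis V)"
      if "b \<in> basis U" "v \<in> deg V j" for b v j
      by (rule in_subspace_deg[OF U _ subspace_vspace lin_compose[OF lin_tensor_left lin_act]])
        (use that 1 in auto)
    have 3: "act ?T h (tensor_vec (bvec b) (bvec c)) \<in> vspace (basis U \<times> basis V)"
      if "b \<in> basis U" "c \<in> basis V" for b c
      by (rule in_subspace_deg[OF V _ subspace_vspace lin_compose[OF lin_tensor_right lin_act]])
        (use that 2 in auto)
    show ?thesis
      by (rule lin_in_subspace[OF lin_act that subspace_vspace]) (use 3 in auto)
  qed
  show ?thesis
  proof (rule comodI)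
    show "finite (basis ?T)"
      using comodD(1)[OF U] comodD(1)[OF V] by simp
    fix x assume "x \<in> basis ?T"
    then have x: "bvec x \<in> vspace (basis U \<times> basis V)"
      by simp
    show "act ?T h (bvec x) \<in> vspace (basis ?T)" for h
      using in_space[OF x] by simp
    show "act ?T (j, m) (act ?T (i, l) (bvec x)) = (if j = i + int l then act ?T (i, l + m) (bvec x) else 0)"
      for i l j m
    proof (induction m)
      case 0
      then show ?case
        by (simp add: act_0[OF x])
    next
      case (Suc m)
      then show ?case
        by (simp add: act_tensor_Suc[OF q U V in_space[OF x]] act_tensor_Suc[OF q U V x, of _ "l + m"] add.assoc)
    qed
    obtain b c where bc: "x = (b, c)" "b \<in> basis U" "c \<in> basis V"
      using \<open>x \<in> basis ?T\<close> by auto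
    let ?A = "{i. act U (i, 0) (bvec b) \<noteq> 0}" and ?B = "{j. act V (j, 0) (bvec c) \<noteq> 0}"
    \<comment> \<open>The possible degrees of the tensor are the sums of the degrees occurring in
      the two factors. As different pairs may have the same sum, the triple sum is reordered before
      the sum over \<open>?K\<close> is evaluated.\<close>
    let ?K = "(\<lambda>(i, j). i + j) ` (?A \<times> ?B)"
    let ?t = "\<lambda>i j. tensor_vec (act U (i, 0) (bvec b)) (act V (j, 0) (bvec c))"
    have fin: "finite ?A" "finite ?B" "finite ?K"
      by (intro finite_imageI finite_cartesian_product finite_act_grade)+
    have bV: "bvec b \<in> vspace (basis U)" "bvec c \<in> vspace (basis V)"
      using bc by auto
    have bx: "bvec x = (\<Sum>i\<in>?A. \<Sum>j\<in>?B. ?t i j)"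
      by (subst sum.swap)
        (simp add: bc(1) grade_sum[OF U bV(1) fin(1)] grade_sum[OF V bV(2) fin(2)] flip: tensor_sum)
    have act: "act ?T (k, 0) (?t i j) = (if k = i + j then ?t i j else 0)" for k i j
      using act_tensor_0[OF U V act_in_deg[OF U bV(1), of i 0] act_in_deg[OF V bV(2), of j 0], of k] by simp
    have "(\<Sum>k\<in>?K. act ?T (k, 0) (bvec x)) = (\<Sum>k\<in>?K. \<Sum>i\<in>?A. \<Sum>j\<in>?B. if k = i + j then ?t i j else 0)"
      unfolding bx by (simp add: lin_sum[OF lin_act] act)
    also have "\<dots> = (\<Sum>i\<in>?A. \<Sum>k\<in>?K. \<Sum>j\<in>?B. if k = i + j then ?t i j else 0)"
      by (rule sum.swap)
    also have "\<dots> = (\<Sum>i\<in>?A. \<Sum>j\<in>?B. \<Sum>k\<in>?K. if k = i + j then ?t i j else 0)"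
      by (rule sum.cong[OF refl]) (rule sum.swap)
    also have "\<dots> = (\<Sum>i\<in>?A. \<Sum>j\<in>?B. ?t i j)"
    proof (intro sum.cong refl)
      fix i j assume "i \<in> ?A" "j \<in> ?B"
      then have "i + j \<in> ?K"
        by force
      then show "(\<Sum>k\<in>?K. if k = i + j then ?t i j else 0) = ?t i j"
        using fin(3) by simp
    qed
    finally have "bvec x = (\<Sum>k\<in>?K. act ?T (k, 0) (bvec x))"
      unfolding bx by (rule sym)
    then show "\<exists>S. finite S \<and> bvec x = (\<Sum>i\<in>S. act ?T (i, 0) (bvec x))"
      using fin(3) by blast
  qed
qed

subsection \<open>Functoriality, distributivity and associativity\<close>

text \<open>The tests range over all vectors instead of homogeneous ones. For tensor products they
  can then be verified by linearity on pure tensors of homogeneous vectors.\<close>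

lemma morphI:
  fixes F :: "('b \<Rightarrow>\<^sub>0 'k::field) \<Rightarrow> ('c \<Rightarrow>\<^sub>0 'k)"
  assumes M: "comod q M" and N: "comod q N" and lin: "lin F"
    and space: "\<And>w. w \<in> vspace (basis M) \<Longrightarrow> F w \<in> vspace (basis N)"
    and act: "\<And>k w. w \<in> vspace (basis M) \<Longrightarrow> act N (k, 0) (F w) = F (act M (k, 0) w)"
      "\<And>k w. w \<in> vspace (basis M) \<Longrightarrow> act N (k, Suc 0) (F w) = F (act M (k, Suc 0) w)"
  shows "morph M N F"
proof (rule morphI_deg[OF M N lin])
  fix i v assume v: "v \<in> deg M i"
  note vV = deg_vspace[OF v]
  show "F v \<in> deg N i"
    using act(1)[OF vV, of i] space[OF vV] v by (simp add: deg_def)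
  show "act N (i, 1) (F v) = F (act M (i, 1) v)"
    using act(2)[OF vV, of i] by simp
qed

lemma morph_deg:
  assumes "morph M N F" "v \<in> deg M i"
  shows "F v \<in> deg N i"
  using morphD(2,3)[OF assms(1) deg_vspace[OF assms(2)]] assms(2) by (simp add: deg_def)

lemma morph_tmap:
  fixes U :: "('a, int \<times> nat, 'k::field) comodule" and V :: "('b, int \<times> nat, 'k) comodule"
    and U' :: "('c, int \<times> nat, 'k) comodule" and V' :: "('d, int \<times> nat, 'k) comodule"
  assumes q: "q \<noteq> 0" and U: "comod q U" "comod q U'" "morph U U' F" and V: "comod q V" "comod q V'" "morph V V' G"
  shows "morph (tp q U V) (tp q U' V') (tmap F G)"
proof (rule morphI[OF comod_tensor[OF q U(1) V(1)] comod_tensor[OF q U(2) V(2)] lin_tmap])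
  note lin = morphD(1)[OF U(3)] morphD(1)[OF V(3)]
  fix w :: "'a \<times> 'b \<Rightarrow>\<^sub>0 'k" assume "w \<in> vspace (basis (tp q U V))"
  then have w: "w \<in> vspace (basis U \<times> basis V)"
    by simp
  show "tmap F G w \<in> vspace (basis (tp q U' V'))"
    unfolding basis_tensor by (rule tmap_in_vspace[OF w]) (simp_all add: morphD(2)[OF U(3)] morphD(2)[OF V(3)])
  show "act (tp q U' V') (k, 0) (tmap F G w) = tmap F G (act (tp q U V) (k, 0) w)" for k
  proof (rule lin_eq_on_deg2[OF U(1) V(1) lin_compose[OF lin_tmap lin_act] lin_compose[OF lin_act lin_tmap] _ w])
    fix i j u v assume uv: "u \<in> deg U i" "v \<in> deg V j"
    show "act (tp q U' V') (k, 0) (tmap F G (tensor_vec u v)) = tmap F G (act (tp q U V) (k, 0) (tensor_vec u v))"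
      by (simp add: tmap_tensor[OF lin] act_tensor_0[OF U(1) V(1) uv] lin_0[OF lin_tmap]
          act_tensor_0[OF U(2) V(2) morph_deg[OF U(3) uv(1)] morph_deg[OF V(3) uv(2)]])
  qed
  show "act (tp q U' V') (k, Suc 0) (tmap F G w) = tmap F G (act (tp q U V) (k, Suc 0) w)" for k
  proof (rule lin_eq_on_deg2[OF U(1) V(1) lin_compose[OF lin_tmap lin_act] lin_compose[OF lin_act lin_tmap] _ w])
    fix i j u v assume uv: "u \<in> deg U i" "v \<in> deg V j"
    show "act (tp q U' V') (k, Suc 0) (tmap F G (tensor_vec u v)) = tmap F G (act (tp q U V) (k, Suc 0) (tensor_vec u v))"
      by (simp add: tmap_tensor[OF lin] act_tensor_1[OF U(1) V(1) uv] lin_0[OF lin_tmap]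
          act_tensor_1[OF U(2) V(2) morph_deg[OF U(3) uv(1)] morph_deg[OF V(3) uv(2)]]
          morphD(3)[OF U(3) deg_vspace[OF uv(1)]] morphD(3)[OF V(3) deg_vspace[OF uv(2)]]
          lin_add[OF lin_tmap] lin_scale[OF lin_tmap])
  qed
qed

text \<open>Counting dimensions replaces the construction of an inverse; the explicit isomorphisms
  between tensor products are obtained in this way.\<close>

lemma iso_by_surj:
  fixes F :: "('b \<Rightarrow>\<^sub>0 'k::field) \<Rightarrow> ('c \<Rightarrow>\<^sub>0 'k)"
  assumes "comod q M" and F: "morph M N F" and "card (basis M) = card (basis N)"
    and "\<And>c. c \<in> basis N \<Longrightarrow> bvec c \<in> F ` vspace (basis M)"
  shows "comodule_iso M N"
  by (rule comodule_isoI[OF F], rule lin_surj_imp_bij[OF morphD(1)[OF F]])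
    (use assms comodD(1)[OF assms(1)] morphD(2)[OF F] in auto)

lemma tensor_iso:
  fixes U :: "('a, int \<times> nat, 'k::field) comodule" and V :: "('b, int \<times> nat, 'k) comodule"
    and U' :: "('c, int \<times> nat, 'k) comodule" and V' :: "('d, int \<times> nat, 'k) comodule"
  assumes q: "q \<noteq> 0" and U: "comod q U" "comod q U'" "comodule_iso U U'"
    and V: "comod q V" "comod q V'" "comodule_iso V V'"
  shows "comodule_iso (tp q U V) (tp q U' V')"
proof -
  obtain F where F: "morph U U' F" "bij_betw F (vspace (basis U)) (vspace (basis U'))"
    using U(3) by (auto simp: comodule_iso_iff)
  obtain G where G: "morph V V' G" "bij_betw G (vspace (basis V)) (vspace (basis V'))"
    using V(3) by (auto simp: comodule_iso_iff)
  show ?thesis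
  proof (rule iso_by_surj[OF comod_tensor[OF q U(1) V(1)] morph_tmap[OF q U(1,2) F(1) V(1,2) G(1)]])
    show "card (basis (tp q U V)) = card (basis (tp q U' V'))"
      by (simp add: card_cartesian_product card_basis_iso[OF U(3)] card_basis_iso[OF V(3)])
    fix x assume "x \<in> basis (tp q U' V')"
    then obtain a b where x: "x = (a, b)" "a \<in> basis U'" "b \<in> basis V'"
      by auto
    have "bvec a \<in> F ` vspace (basis U)" "bvec b \<in> G ` vspace (basis V)"
      using x F(2) G(2) by (simp_all add: bij_betw_def)
    then obtain u v where uv: "u \<in> vspace (basis U)" "F u = bvec a" "v \<in> vspace (basis V)" "G v = bvec b"
      by (metis imageE)
    show "bvec x \<in> tmap F G ` vspace (basis (tp q U V))"
      by (rule image_eqI[of _ _ "tensor_vec u v"])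
        (simp_all add: tmap_tensor[OF morphD(1)[OF F(1)] morphD(1)[OF G(1)]] uv x tensor_in_vspace)
  qed
qed

lemma morph_inl: "morph M (direct_sum M N) inl" and morph_inr: "morph N (direct_sum M N) inr"
  by (simp_all add: morph_def lin_inl lin_inr inl_in_vspace inr_in_vspace act_inl act_inr)

lemma morph_id: "morph M M (\<lambda>v. v)"
  by (simp add: morph_def lin_id)

lemma tensor_direct_sum_left:
  fixes A :: "('a, int \<times> nat, 'k::field) comodule" and B :: "('b, int \<times> nat, 'k) comodule"
    and N :: "('c, int \<times> nat, 'k) comodule"
  assumes q: "q \<noteq> 0" and A: "comod q A" and B: "comod q B" and N: "comod q N"
  shows "comodule_iso (direct_sum (tp q A N) (tp q B N)) (tp q (direct_sum A B) N)"
proof -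
  note AB = comod_direct_sum[OF A B]
  let ?F = "tmap inl (\<lambda>v. v) :: ('a \<times> 'c \<Rightarrow>\<^sub>0 'k) \<Rightarrow> (('a + 'b) \<times> 'c \<Rightarrow>\<^sub>0 'k)"
  let ?G = "tmap inr (\<lambda>v. v) :: ('b \<times> 'c \<Rightarrow>\<^sub>0 'k) \<Rightarrow> (('a + 'b) \<times> 'c \<Rightarrow>\<^sub>0 'k)"
  show ?thesis
  proof (rule iso_by_surj[OF comod_direct_sum[OF comod_tensor[OF q A N] comod_tensor[OF q B N]]
        morph_case_sum[OF morph_tmap[OF q A AB morph_inl N N morph_id] morph_tmap[OF q B AB morph_inr N N morph_id]]])
    show "card (basis (direct_sum (tp q A N) (tp q B N))) = card (basis (tp q (direct_sum A B) N))"
      using comodD(1)[OF A] comodD(1)[OF B] comodD(1)[OF N]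
      by (simp add: card_Plus card_cartesian_product algebra_simps)
    fix x assume "x \<in> basis (tp q (direct_sum A B) N)"
    then consider a c where "x = (Inl a, c)" "a \<in> basis A" "c \<in> basis N"
      | b c where "x = (Inr b, c)" "b \<in> basis B" "c \<in> basis N"
      by auto
    then show "bvec x \<in> (\<lambda>w. ?F (prl w) + ?G (prr w)) ` vspace (basis (direct_sum (tp q A N) (tp q B N)))"
    proof cases
      case 1
      then show ?thesis
        by (intro image_eqI[of _ _ "bvec (Inl (a, c))"]) (auto simp: tmap_bvec lin_0[OF lin_tmap])
    next
      case 2
      then show ?thesis
        by (intro image_eqI[of _ _ "bvec (Inr (b, c))"]) (auto simp: tmap_bvec lin_0[OF lin_tmap])
    qed
  qed
qed

lemma tensor_direct_sum_right:
  fixes A :: "('a, int \<times> nat, 'k::field) comodule" and B :: "('b, int \<times> nat, 'k) comodule"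
    and N :: "('c, int \<times> nat, 'k) comodule"
  assumes q: "q \<noteq> 0" and A: "comod q A" and B: "comod q B" and N: "comod q N"
  shows "comodule_iso (direct_sum (tp q N A) (tp q N B)) (tp q N (direct_sum A B))"
proof -
  note AB = comod_direct_sum[OF A B]
  let ?F = "tmap (\<lambda>v. v) inl :: ('c \<times> 'a \<Rightarrow>\<^sub>0 'k) \<Rightarrow> ('c \<times> ('a + 'b) \<Rightarrow>\<^sub>0 'k)"
  let ?G = "tmap (\<lambda>v. v) inr :: ('c \<times> 'b \<Rightarrow>\<^sub>0 'k) \<Rightarrow> ('c \<times> ('a + 'b) \<Rightarrow>\<^sub>0 'k)"
  show ?thesis
  proof (rule iso_by_surj[OF comod_direct_sum[OF comod_tensor[OF q N A] comod_tensor[OF q N B]]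
        morph_case_sum[OF morph_tmap[OF q N N morph_id A AB morph_inl] morph_tmap[OF q N N morph_id B AB morph_inr]]])
    show "card (basis (direct_sum (tp q N A) (tp q N B))) = card (basis (tp q N (direct_sum A B)))"
      using comodD(1)[OF A] comodD(1)[OF B] comodD(1)[OF N]
      by (simp add: card_Plus card_cartesian_product algebra_simps)
    fix x assume "x \<in> basis (tp q N (direct_sum A B))"
    then consider a c where "x = (c, Inl a)" "a \<in> basis A" "c \<in> basis N"
      | b c where "x = (c, Inr b)" "b \<in> basis B" "c \<in> basis N"
      by auto
    then show "bvec x \<in> (\<lambda>w. ?F (prl w) + ?G (prr w)) ` vspace (basis (direct_sum (tp q N A) (tp q N B)))"
    proof cases
      case 1
      then show ?thesis
        by (intro image_eqI[of _ _ "bvec (Inl (c, a))"]) (auto simp: tmap_bvec lin_0[OF lin_tmap])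
    next
      case 2
      then show ?thesis
        by (intro image_eqI[of _ _ "bvec (Inr (c, b))"]) (auto simp: tmap_bvec lin_0[OF lin_tmap])
    qed
  qed
qed

definition assoc :: "(('a \<times> 'b) \<times> 'c \<Rightarrow>\<^sub>0 'k::field) \<Rightarrow> ('a \<times> 'b \<times> 'c \<Rightarrow>\<^sub>0 'k)" where
  "assoc = lin_ext (\<lambda>((a, b), c). bvec (a, b, c))"

lemma lin_assoc: "lin assoc"
  by (simp add: assoc_def lin_lin_ext)

lemma assoc_tensor: "assoc (tensor_vec (tensor_vec u v) w) = tensor_vec u (tensor_vec v w)"
proof -
  have 1: "assoc (tensor_vec (tensor_vec (bvec a) (bvec b)) w) = tensor_vec (bvec a) (tensor_vec (bvec b) w)" for a b
    by (rule lin_eqI[OF lin_compose[OF lin_tensor_right lin_assoc] lin_compose[OF lin_tensor_right lin_tensor_right]])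
      (simp add: assoc_def)
  have 2: "assoc (tensor_vec (tensor_vec (bvec a) v) w) = tensor_vec (bvec a) (tensor_vec v w)" for a
    by (rule lin_eqI[OF lin_compose[OF lin_compose[OF lin_tensor_right lin_tensor_left] lin_assoc]
          lin_compose[OF lin_tensor_left lin_tensor_right]]) (rule 1)
  show ?thesis
    by (rule lin_eqI[OF lin_compose[OF lin_compose[OF lin_tensor_left lin_tensor_left] lin_assoc] lin_tensor_left])
      (rule 2)
qed

lemma tensor_assoc:
  fixes A :: "('a, int \<times> nat, 'k::field) comodule" and B :: "('b, int \<times> nat, 'k) comodule"
    and C :: "('c, int \<times> nat, 'k) comodule"
  assumes q: "q \<noteq> 0" and A: "comod q A" and B: "comod q B" and C: "comod q C"
  shows "comodule_iso (tp q (tp q A B) C) (tp q A (tp q B C))"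
proof -
  note AB = comod_tensor[OF q A B] and BC = comod_tensor[OF q B C]
  let ?L = "tp q (tp q A B) C" and ?R = "tp q A (tp q B C)"
  note L = comod_tensor[OF q AB C] and R = comod_tensor[OF q A BC]
  have "morph ?L ?R assoc"
  proof (rule morphI[OF L R lin_assoc])
    fix w :: "('a \<times> 'b) \<times> 'c \<Rightarrow>\<^sub>0 'k" assume "w \<in> vspace (basis ?L)"
    then have w: "w \<in> vspace ((basis A \<times> basis B) \<times> basis C)"
      by simp
    show "assoc w \<in> vspace (basis ?R)"
      by (rule lin_in_subspace[OF lin_assoc w subspace_vspace]) (auto simp: assoc_def)
    show "act ?R (k, 0) (assoc w) = assoc (act ?L (k, 0) w)" for k
    proof (rule lin_eq_on_deg3[OF A B C lin_compose[OF lin_assoc lin_act] lin_compose[OF lin_act lin_assoc] _ w])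
      fix i j l u v x assume u: "u \<in> deg A i" and v: "v \<in> deg B j" and x: "x \<in> deg C l"
      show "act ?R (k, 0) (assoc (tensor_vec (tensor_vec u v) x)) = assoc (act ?L (k, 0) (tensor_vec (tensor_vec u v) x))"
        by (simp add: assoc_tensor act_tensor_0[OF A BC u tensor_in_deg[OF B C v x refl]]
            act_tensor_0[OF AB C tensor_in_deg[OF A B u v refl] x] lin_0[OF lin_assoc])
    qed
    show "act ?R (k, Suc 0) (assoc w) = assoc (act ?L (k, Suc 0) w)" for k
    proof (rule lin_eq_on_deg3[OF A B C lin_compose[OF lin_assoc lin_act] lin_compose[OF lin_act lin_assoc] _ w])
      fix i j l u v x assume u: "u \<in> deg A i" and v: "v \<in> deg B j" and x: "x \<in> deg C l"
      show "act ?R (k, Suc 0) (assoc (tensor_vec (tensor_vec u v) x)) = assoc (act ?L (k, Suc 0) (tensor_vec (tensor_vec u v) x))"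
        \<comment> \<open>Both bracketings give the same three Leibniz terms; in the last one the
          weight is \<open>q powi (i + j)\<close> on one side and the product of the two separate
          weights on the other.\<close>
        using q by (simp add: assoc_tensor act_tensor_1[OF A BC u tensor_in_deg[OF B C v x refl]]
            act_tensor_1[OF AB C tensor_in_deg[OF A B u v refl] x] act_tensor_1[OF A B u v] act_tensor_1[OF B C v x]
            lin_0[OF lin_assoc] lin_add[OF lin_assoc] lin_scale[OF lin_assoc] tensor_add
            vs.scale_right_distrib power_int_add add.assoc)
    qed
  qed
  then show ?thesis
  proof (rule iso_by_surj[OF L])
    show "card (basis ?L) = card (basis ?R)"
      by (simp add: card_cartesian_product)
    fix x assume "x \<in> basis ?R"
    then obtain a b c where "x = (a, b, c)" "a \<in> basis A" "b \<in> basis B" "c \<in> basis C"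
      by auto
    then show "bvec x \<in> assoc ` vspace (basis ?L)"
      by (intro image_eqI[of _ _ "bvec ((a, b), c)"]) (simp_all add: assoc_def)
  qed
qed

subsection \<open>Tensor products with the generators\<close>

declare single_one [simp del] \<comment> \<open>it turns \<open>bvec 0\<close> into the unit of the convolution product\<close>

lemma bvec_in_deg_string: "a \<le> l \<Longrightarrow> j = i + int a \<Longrightarrow> bvec a \<in> deg (string i l) j"
  by (simp add: deg_def act_string_bvec)

text \<open>A one-dimensional factor shifts degrees and rescales the raising operator by a nonzero
  constant, so the lowest vector still generates everything.\<close>

lemma string_tensor_string_0:
  assumes q: "q \<noteq> 0"
  shows "comodule_iso (string (i + j) l :: (nat, int \<times> nat, 'k::field) comodule) (tp q (string i 0) (string j l))"
proof -
  let ?P = "tp q (string i 0) (string j l)"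
  note P = comod_tensor[OF q comod_string[of q i 0] comod_string[of q j l]]
  let ?x = "bvec (0, 0) :: nat \<times> nat \<Rightarrow>\<^sub>0 'k"
  have act: "act ?P (i + j, n) ?x = (if n \<le> l then vscale (q powi (i * int n)) (bvec (0, n)) else 0)" for n
  proof -
    let ?f = "\<lambda>s. vscale (q powi (i * int (n - s)) * gauss_binomial s (n - s) q)
        (tensor_vec (act (string i 0) (i, s) (bvec 0)) (act (string j l) (j, n - s) (bvec 0)))"
    have "act ?P (i + j, n) (tensor_vec (bvec 0) (bvec 0)) = (\<Sum>s\<le>n. ?f s)"
      by (simp del: tensor_bvec add: act_tensor[OF comod_string comod_string bvec_in_deg_string[of 0 _ i] bvec_in_deg_string[of 0 _ j]])
    \<comment> \<open>The first factor cannot be raised, so all raises fall on the second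
      one.\<close>
    also have "\<dots> = (\<Sum>s\<in>{0}. ?f s)"
      by (rule sum.mono_neutral_right) (auto simp: act_string_bvec)
    finally show ?thesis
      by (simp add: act_string_bvec)
  qed
  have x: "?x \<in> vspace (basis ?P)" "act ?P (i + j, 0) ?x = ?x" "act ?P (i + j, Suc l) ?x = 0"
    by (simp_all add: act)
  show ?thesis
  proof (rule iso_by_surj[OF comod_string morph_string[OF P x]])
    show "card (basis (string (i + j) l)) = card (basis ?P)"
      by (simp add: card_cartesian_product)
    fix c assume "c \<in> basis ?P"
    then obtain n where n: "c = (0, n)" "n \<le> l"
      by auto
    show "bvec c \<in> lin_ext (\<lambda>a. act ?P (i + j, a) ?x) ` vspace (basis (string (i + j) l))"
      by (rule image_eqI[of _ _ "vscale (inverse (q powi (i * int n))) (bvec n)"])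
        (use n q in \<open>auto simp: lin_scale[OF lin_lin_ext] act intro!: vscale_in_vspace\<close>)
  qed
qed

context
  fixes q :: "'k::field_char_0" and j :: int and l :: nat and P
  assumes q: "q \<noteq> 0" "q = 1 \<or> (\<forall>n::nat. n > 0 \<longrightarrow> q ^ n \<noteq> 1)"
  defines "P \<equiv> tp q (string 0 1) (string j l)"
begin

text \<open>Vectors beyond the end of the second string are read as zero, so the formulas for the
  raising operator hold without case distinctions at the top.\<close>

definition "pv a b = (if b \<le> l then bvec (a, b) else (0 :: nat \<times> nat \<Rightarrow>\<^sub>0 'k))"

lemma comod_P: "comod q P"
  unfolding P_def by (rule comod_tensor[OF q(1) comod_string comod_string])

text \<open>The two-dimensional factor is raised at most once; the positions at which this can
  happen contribute the powers of \<open>q\<close> in the quantum integer. For \<open>n = 0\<close>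
  the truncated index \<open>b + n - 1\<close> is harmless, since the sum in front of it is
  empty.\<close>

lemma act_P_0:
  assumes "b \<le> l"
  shows "act P (j + int b, n) (bvec (0, b)) = pv 0 (b + n) + vscale (\<Sum>k<n. q ^ k) (pv 1 (b + n - 1))"
proof -
  let ?f = "\<lambda>s. vscale (q powi (0 * int (n - s)) * gauss_binomial s (n - s) q)
      (tensor_vec (act (string 0 1) (0, s) (bvec 0)) (act (string j l) (j + int b, n - s) (bvec b)))"
  have "act P (j + int b, n) (tensor_vec (bvec 0) (bvec b)) = (\<Sum>s\<le>n. ?f s)"
    unfolding P_def using assms
    by (simp del: tensor_bvec add: act_tensor[OF comod_string comod_string bvec_in_deg_string[of 0 _ 0] bvec_in_deg_string[of b _ "j + int b"]])
  also have "\<dots> = (\<Sum>s\<in>{0, 1} \<inter> {..n}. ?f s)"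
    by (rule sum.mono_neutral_right) (auto simp: act_string_bvec)
  also have "\<dots> = pv 0 (b + n) + vscale (\<Sum>k<n. q ^ k) (pv 1 (b + n - 1))"
  proof (cases n)
    case 0
    then show ?thesis
      using assms by (simp add: act_string_bvec pv_def)
  next
    case (Suc m)
    then have "{0, 1} \<inter> {..n} = {0, 1}"
      by auto
    then show ?thesis
      using assms Suc by (simp add: act_string_bvec pv_def gauss_binomial_1 lessThan_Suc_atMost)
  qed
  finally show ?thesis
    by simp
qed

lemma act_P_1:
  assumes "b \<le> l"
  shows "act P (j + int b + 1, n) (bvec (1, b)) = vscale (q ^ n) (pv 1 (b + n))"
proof -
  let ?f = "\<lambda>s. vscale (q powi (1 * int (n - s)) * gauss_binomial s (n - s) q)
      (tensor_vec (act (string 0 1) (1, s) (bvec 1)) (act (string j l) (j + int b, n - s) (bvec b)))"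
  have "act P (j + int b + 1, n) (tensor_vec (bvec 1) (bvec b)) = (\<Sum>s\<le>n. ?f s)"
    unfolding P_def using assms
    by (simp del: tensor_bvec add: act_tensor[OF comod_string comod_string bvec_in_deg_string[of "Suc 0" _ 1] bvec_in_deg_string[of b _ "j + int b"]])
  also have "\<dots> = (\<Sum>s\<in>{0}. ?f s)"
    by (rule sum.mono_neutral_right) (auto simp: act_string_bvec)
  finally show ?thesis
    using assms by (simp add: act_string_bvec pv_def)
qed

text \<open>For \<open>q = 1\<close> the sum is \<open>Suc n\<close>, nonzero in characteristic
  zero. Otherwise it is a geometric sum, and its vanishing would make \<open>q\<close> a root of
  unity.\<close>

lemma q_int_nonzero: "(\<Sum>k<Suc n. q ^ k) \<noteq> 0"
proof (cases "q = 1")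
  case False
  have "(q - 1) * (\<Sum>k<Suc n. q ^ k) = q ^ Suc n - 1"
    by (rule power_diff_1_eq[symmetric])
  moreover have "q ^ Suc n \<noteq> 1"
    using q(2) False by blast
  ultimately show ?thesis
    by auto
qed (simp del: of_nat_Suc)

text \<open>The long summand, generated by the lowest vector of \<open>P\<close>.\<close>

definition "chain0 = lin_ext (\<lambda>n. act P (j, n) (bvec (0, 0)))"

lemma chain0_bvec: "chain0 (bvec n) = pv 0 n + vscale (\<Sum>k<n. q ^ k) (pv 1 (n - 1))"
  using act_P_0[of 0 n] by (simp add: chain0_def)

lemma morph_chain0: "morph (string j (Suc l)) P chain0"
  unfolding chain0_def
proof (rule morph_string[OF comod_P])
  show "bvec (0, 0) \<in> vspace (basis P)"
    by (simp add: P_def)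
qed (use act_P_0[of 0 0] act_P_0[of 0 "Suc (Suc l)"] in \<open>simp_all add: pv_def\<close>)

text \<open>The short summand. Its lowest vector in degree \<open>j + 1\<close> has to be killed by
  \<open>l\<close> raises. These send \<open>(0, 1)\<close> to \<open>[l]\<close> times, and
  \<open>(1, 0)\<close> to \<open>q^l\<close> times, the top vector \<open>(1, l)\<close>, which
  forces the coefficient \<open>[l] / q^l\<close>.\<close>

definition "chain1 = lin_ext (\<lambda>n. act P (j + 1, n)
  (bvec (0, 1) - vscale ((\<Sum>k<l. q ^ k) / q ^ l) (bvec (1, 0))))"

lemma chain1_bvec:
  assumes "l > 0"
  shows "chain1 (bvec n) = pv 0 (Suc n) + vscale ((\<Sum>k<n. q ^ k) - (\<Sum>k<l. q ^ k) / q ^ l * q ^ n) (pv 1 n)"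
  using assms act_P_0[of 1 n] act_P_1[of 0 n]
  by (simp add: chain1_def vp.linear_diff[OF lin_act] lin_scale[OF lin_act] vs.scale_left_diff_distrib)

lemma morph_chain1:
  assumes "l > 0"
  shows "morph (string (j + 1) (l - 1)) P chain1"
  unfolding chain1_def
proof (rule morph_string[OF comod_P])
  let ?r = "bvec (0, 1) - vscale ((\<Sum>k<l. q ^ k) / q ^ l) (bvec (1, 0))"
  show "?r \<in> vspace (basis P)"
    using assms by (intro vs.subspace_diff[OF subspace_vspace] vscale_in_vspace) (simp_all add: P_def)
  show "act P (j + 1, 0) ?r = ?r"
    using chain1_bvec[OF assms, of 0] assms by (simp add: chain1_def pv_def)
  show "act P (j + 1, Suc (l - 1)) ?r = 0"
    using chain1_bvec[OF assms, of l] assms q(1) by (simp add: chain1_def pv_def)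
qed

lemma card_basis_P: "card (basis P) = 2 * Suc l"
  by (simp add: P_def card_cartesian_product)

lemma tensor_gen_string_0:
  assumes "l = 0"
  shows "comodule_iso (string j 1) P"
proof -
  have m: "morph (string j 1) P chain0"
    using morph_chain0 assms by simp
  have "bvec c \<in> chain0 ` vspace (basis (string j 1))" if "c \<in> basis P" for c
  proof -
    have "c = (0, 0) \<or> c = (Suc 0, 0)"
      using that assms by (auto simp: P_def)
    moreover have "chain0 (bvec 0) = bvec (0, 0)" "chain0 (bvec (Suc 0)) = bvec (Suc 0, 0)"
      unfolding chain0_bvec pv_def using assms by simp_all
    moreover have "bvec n \<in> vspace (basis (string j 1))" if "n \<le> 1" for n
      using that by simp
    ultimately show ?thesis
      by (metis imageI le_refl le_Suc_eq One_nat_def zero_le)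
  qed
  then show ?thesis
    by (intro iso_by_surj[OF comod_string m]) (simp_all add: card_basis_P assms)
qed

text \<open>In each degree the two chains are combined so as to isolate the vector from the row
  \<open>(1, n)\<close>; the row \<open>(0, n)\<close> then follows by subtraction from
  \<open>chain0\<close>.\<close>

lemma tensor_gen_string_Suc:
  assumes l: "l > 0"
  shows "comodule_iso (direct_sum (string j (Suc l)) (string (j + 1) (l - 1))) P"
proof -
  let ?S = "direct_sum (string j (Suc l)) (string (j + 1) (l - 1)) :: (nat + nat, int \<times> nat, 'k) comodule"
  let ?K = "\<lambda>w. chain0 (prl w) + chain1 (prr w)"
  have K: "morph ?S P ?K"
    by (rule morph_case_sum[OF morph_chain0 morph_chain1[OF l]])
  let ?W = "?K ` vspace (basis ?S)"
  have sub: "vs.subspace ?W"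
    using vp.linear_subspace_image[OF morphD(1)[OF K] subspace_vspace] .
  have K0: "?K (bvec (Inl n)) = chain0 (bvec n)" for n
    by (simp add: chain1_def lin_0[OF lin_lin_ext])
  have K1: "?K (bvec (Inr n)) = chain1 (bvec n)" for n
    by (simp add: chain0_def lin_0[OF lin_lin_ext])
  have W0: "chain0 (bvec n) \<in> ?W" if "n \<le> Suc l" for n
    unfolding K0[symmetric] by (rule imageI) (use that in auto)
  have W1: "chain1 (bvec n) \<in> ?W" if "n < l" for n
    unfolding K1[symmetric] by (rule imageI) (use that in auto)
  let ?c = "(\<Sum>k<l. q ^ k) / q ^ l"
  have scale: "x \<in> ?W" if "vscale r x \<in> ?W" "r \<noteq> 0" for r x
    using vs.subspace_scale[OF sub that(1), of "inverse r"] that(2) by simp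
  have top: "pv 1 n \<in> ?W" if n: "n \<le> l" for n
  proof (cases "n = l")
    case True
    \<comment> \<open>At the top, \<open>pv 0 (Suc l)\<close> is zero by convention, so the last
      vector of \<open>chain0\<close> is a multiple of \<open>pv 1 l\<close> alone.\<close>
    have "vscale (\<Sum>k<Suc l. q ^ k) (pv 1 n) \<in> ?W"
      using W0[of "Suc l"] True unfolding chain0_bvec by (simp add: pv_def)
    then show ?thesis
      by (rule scale[OF _ q_int_nonzero])
  next
    case False
    then have in_W: "chain0 (bvec (Suc n)) - chain1 (bvec n) \<in> ?W"
      using n by (intro vs.subspace_diff[OF sub] W0 W1) auto
    have eq: "chain0 (bvec (Suc n)) - chain1 (bvec n)
        = vscale ((\<Sum>k<Suc n. q ^ k) - ((\<Sum>k<n. q ^ k) - ?c * q ^ n)) (pv 1 n)"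
      by (simp only: chain0_bvec chain1_bvec[OF l] diff_Suc_1 vs.scale_left_diff_distrib) simp
    \<comment> \<open>The determinant in this degree:
      \<open>q^n + q^n [l] / q^l = q^n / q^l [l + 1]\<close>. The same quantum integer
      \<open>[l + 1]\<close> decides invertibility in every degree.\<close>
    have coeff: "(\<Sum>k<Suc n. q ^ k) - ((\<Sum>k<n. q ^ k) - ?c * q ^ n) = q ^ n / q ^ l * (\<Sum>k<Suc l. q ^ k)"
      using q(1) by (simp add: field_simps)
    have nz: "q ^ n / q ^ l * (\<Sum>k<Suc l. q ^ k) \<noteq> 0"
      using q(1) q_int_nonzero[of l] by simp
    show ?thesis
      by (rule scale[OF in_W[unfolded eq coeff] nz])
  qed
  have bot: "pv 0 n \<in> ?W" if n: "n \<le> l" for n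
  proof -
    have "chain0 (bvec n) - vscale (\<Sum>k<n. q ^ k) (pv 1 (n - 1)) \<in> ?W"
      using n by (intro vs.subspace_diff[OF sub] vs.subspace_scale[OF sub] W0 top) auto
    then show ?thesis
      by (simp add: chain0_bvec)
  qed
  show ?thesis
  proof (rule iso_by_surj[OF comod_direct_sum[OF comod_string comod_string] K])
    show "card (basis ?S) = card (basis P)"
      using l by (simp add: card_basis_P card_Plus)
    fix c assume "c \<in> basis P"
    then obtain b where "b \<le> l" "c = (0, b) \<or> c = (1, b)"
      by (auto simp: P_def le_Suc_eq)
    then show "bvec c \<in> ?W"
      using top[of b] bot[of b] by (auto simp: pv_def)
  qed
qed

end

section \<open>The class of a comodule in the Laurent polynomial ring\<close>

abbreviation (input) laurent_mon :: "int \<Rightarrow> nat \<Rightarrow> (int \<times> nat \<Rightarrow>\<^sub>0 int)" where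
  "laurent_mon i m \<equiv> frag_of (i, m)"

lemma laurent_mon_mult: "laurent_mon i m * laurent_mon j n = laurent_mon (i + j) (m + n)"
  by (simp add: mult_single)

lemma laurent_mon_0: "laurent_mon 0 0 = 1"
  using single_one[where 'a = "int \<times> nat" and 'b = int] by (simp add: zero_prod_def)

text \<open>The Chebyshev type recursion is the Clebsch-Gordan rule for \<open>string 0 1 \<otimes> string i l\<close>.\<close>

fun string_poly :: "int \<Rightarrow> nat \<Rightarrow> (int \<times> nat \<Rightarrow>\<^sub>0 int)" where
  "string_poly i 0 = laurent_mon i 0"
| "string_poly i (Suc 0) = laurent_mon 0 1 * laurent_mon i 0"
| "string_poly i (Suc (Suc l)) = laurent_mon 0 1 * string_poly i (Suc l) - string_poly (i + 1) l"

lemma laurent_mon_string_poly: "laurent_mon j 0 * string_poly i l = string_poly (j + i) l"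
proof (induction i l rule: string_poly.induct)
  case (2 i)
  then show ?case
    by (simp add: laurent_mon_mult)
next
  case (3 i l)
  have "laurent_mon j 0 * string_poly i (Suc (Suc l))
      = laurent_mon 0 1 * (laurent_mon j 0 * string_poly i (Suc l)) - laurent_mon j 0 * string_poly (i + 1) l"
    by (simp add: right_diff_distrib mult.left_commute)
  also have "\<dots> = laurent_mon 0 1 * string_poly (j + i) (Suc l) - string_poly (j + (i + 1)) l"
    by (simp only: 3)
  finally show ?case
    by (simp add: add.assoc)
qed (simp add: laurent_mon_mult)

section \<open>Strings and monomials as two bases of the same free abelian group\<close>

lemma frag_hom_eqI:
  assumes "\<And>x y. F (x - y) = F x - F y" "\<And>x y. G (x - y) = G x - G y" "\<And>a. F (frag_of a) = G (frag_of a)"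
  shows "F x = (G x :: 'c::ab_group_add)"
proof -
  \<comment> \<open>Compatibility with differences already fixes the value at zero, and differences
    are what the induction rule for free abelian groups asks for.\<close>
  have "F 0 = 0" "G 0 = 0"
    using assms(1)[of 0 0] assms(2)[of 0 0] by simp_all
  then show ?thesis
    using free_Abelian_group_induct[of x UNIV "\<lambda>x. F x = G x"] assms by simp
qed

text \<open>The two occurrences of the type are read differently: a key \<open>(i, l)\<close> of the
  argument is a string, a key of the result is a monomial in \<open>x\<close> and
  \<open>y\<close>.\<close>

definition string_eval :: "(int \<times> nat \<Rightarrow>\<^sub>0 int) \<Rightarrow> (int \<times> nat \<Rightarrow>\<^sub>0 int)" where
  "string_eval = frag_extend (\<lambda>(i, l). string_poly i l)"

text \<open>Multiplication by \<open>y\<close> written in the string basis, that is, the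
  Clebsch-Gordan rule for \<open>string 0 1\<close>.\<close>

definition raise :: "(int \<times> nat \<Rightarrow>\<^sub>0 int) \<Rightarrow> (int \<times> nat \<Rightarrow>\<^sub>0 int)" where
  "raise = frag_extend (\<lambda>(i, l). frag_of (i, Suc l) + (if l = 0 then 0 else frag_of (i + 1, l - 1)))"

text \<open>The candidate inverse of \<open>string_eval\<close>: \<open>x^i\<close> is the string
  \<open>(i, 0)\<close>, and each factor \<open>y\<close> is one application of
  \<open>raise\<close>.\<close>

definition string_expand :: "(int \<times> nat \<Rightarrow>\<^sub>0 int) \<Rightarrow> (int \<times> nat \<Rightarrow>\<^sub>0 int)" where
  "string_expand = frag_extend (\<lambda>(i, m). (raise ^^ m) (frag_of (i, 0)))"

lemma string_eval_diff: "string_eval (x - y) = string_eval x - string_eval y"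
  and string_eval_add: "string_eval (x + y) = string_eval x + string_eval y"
  and raise_diff: "raise (x - y) = raise x - raise y"
  and string_expand_diff: "string_expand (x - y) = string_expand x - string_expand y"
  by (simp_all add: string_eval_def raise_def string_expand_def frag_extend_diff frag_extend_add)

lemma gen_string_poly:
  "laurent_mon 0 1 * string_poly i l = string_poly i (Suc l) + (if l = 0 then 0 else string_poly (i + 1) (l - 1))"
  by (cases l) simp_all

lemma string_eval_raise: "string_eval (raise x) = laurent_mon 0 1 * string_eval x"
proof (rule frag_hom_eqI[of "\<lambda>x. string_eval (raise x)"])
  fix a :: "int \<times> nat"
  obtain i l where "a = (i, l)"
    by (cases a)
  then show "string_eval (raise (frag_of a)) = laurent_mon 0 1 * string_eval (frag_of a)"
    using gen_string_poly[of i l] by (simp add: raise_def string_eval_def frag_extend_add)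
qed (simp_all add: raise_diff string_eval_diff algebra_simps)

lemma string_eval_expand: "string_eval (string_expand x) = x"
proof (rule frag_hom_eqI[of "\<lambda>x. string_eval (string_expand x)" "\<lambda>x. x"])
  fix a :: "int \<times> nat"
  obtain i m where a: "a = (i, m)"
    by (cases a)
  have "string_eval ((raise ^^ m) (frag_of (i, 0))) = laurent_mon i m"
  proof (induction m)
    case 0
    then show ?case
      by (simp add: string_eval_def)
  next
    case (Suc m)
    then show ?case
      by (simp add: string_eval_raise laurent_mon_mult)
  qed
  then show "string_eval (string_expand (frag_of a)) = frag_of a"
    by (simp add: a string_expand_def)
qed (simp_all add: string_eval_diff string_expand_diff)

lemma string_expand_gen: "string_expand (laurent_mon 0 1 * x) = raise (string_expand x)"
proof (rule frag_hom_eqI[of "\<lambda>x. string_expand (laurent_mon 0 1 * x)"])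
  fix a :: "int \<times> nat"
  obtain i m where "a = (i, m)"
    by (cases a)
  then show "string_expand (laurent_mon 0 1 * frag_of a) = raise (string_expand (frag_of a))"
    by (simp add: laurent_mon_mult string_expand_def)
qed (simp_all add: raise_diff string_expand_diff algebra_simps)

text \<open>The recursion of \<open>string_poly\<close> solves the rule of \<open>raise\<close> for
  its longer string, so the subtracted term cancels exactly the shorter one.\<close>

lemma string_expand_poly: "string_expand (string_poly i l) = frag_of (i, l)"
proof (induction i l rule: string_poly.induct)
  case (1 i)
  then show ?case
    by (simp add: string_expand_def)
next
  case (2 i)
  then show ?case
    unfolding string_poly.simps string_expand_gen by (simp add: string_expand_def raise_def)
next
  case (3 i l)
  then show ?case
    unfolding string_poly.simps string_expand_diff string_expand_gen by (simp add: raise_def)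
qed

lemma string_expand_eval: "string_expand (string_eval x) = x"
proof (rule frag_hom_eqI[of "\<lambda>x. string_expand (string_eval x)" "\<lambda>x. x"])
  fix a :: "int \<times> nat"
  show "string_expand (string_eval (frag_of a)) = frag_of a"
    by (cases a) (simp add: string_eval_def string_expand_poly)
qed (simp_all add: string_eval_diff string_expand_diff)

text \<open>Built from ranks and hence independent of any chosen decomposition; on strings it is the
  polynomial that the Green ring isomorphism must assign to them.\<close>

definition chr :: "('b, int \<times> nat, 'k::field) comodule \<Rightarrow> (int \<times> nat \<Rightarrow>\<^sub>0 int)" where
  "chr M = string_eval (string_mult M)"

lemma chr_iso: "comod q M \<Longrightarrow> comodule_iso M N \<Longrightarrow> chr M = chr N"
  by (simp add: chr_def string_mult_iso)

lemma chr_direct_sum: "comod q M \<Longrightarrow> comod q N \<Longrightarrow> chr (direct_sum M N) = chr M + chr N"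
  by (simp add: chr_def string_mult_direct_sum string_eval_add)

lemma chr_string: "chr (string i l) = string_poly i l"
  by (simp add: chr_def string_mult_string string_eval_def)

lemma chr_empty:
  assumes "basis M = {}"
  shows "chr M = 0"
proof -
  have "act M h ` vspace (basis M) = vspace {}" for h
    using assms by (simp add: vspace_def)
  then have "rk M h = 0" for h
    by (simp add: rk_def dim_vspace)
  then have "string_mult M = 0"
    by (simp add: string_mult_def case_prod_beta')
  then show ?thesis
    by (simp add: chr_def string_eval_def)
qed

text \<open>Splitting off a string lowers the dimension. The complement again has a basis in
  \<open>nat\<close>, so the property need only make sense for that type.\<close>

lemma comodule_string_induct [consumes 1, case_names empty step]:
  fixes M :: "(nat, int \<times> nat, 'k::field) comodule"
  assumes "comod q M"
    and empty: "\<And>M :: (nat, int \<times> nat, 'k) comodule. comod q M \<Longrightarrow> basis M = {} \<Longrightarrow> P M"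
    and step: "\<And>i l (M :: (nat, int \<times> nat, 'k) comodule) (U :: (nat, int \<times> nat, 'k) comodule).
      comod q M \<Longrightarrow> comod q U \<Longrightarrow> comodule_iso (direct_sum (string i l) U) M \<Longrightarrow> P U \<Longrightarrow> P M"
  shows "P M"
  using assms(1)
proof (induction "card (basis M)" arbitrary: M rule: less_induct)
  case less
  show ?case
  proof (cases "basis M = {}")
    case False
    then obtain i l and U :: "(nat, int \<times> nat, 'k) comodule" where
      "comod q U" "comodule_iso (direct_sum (string i l) U) M" "card (basis U) < card (basis M)"
      using split_string[OF less.prems] by metis
    then show ?thesis
      using step[OF less.prems] less.hyps by blast
  qed (use empty less.prems in blast)
qed

section \<open>Multiplicativity\<close>

context
  fixes q :: "'k::field_char_0"
  assumes q: "q \<noteq> 0" "q = 1 \<or> (\<forall>n::nat. n > 0 \<longrightarrow> q ^ n \<noteq> 1)"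
begin

lemma chr_tensor_iso:
  fixes U :: "('a, int \<times> nat, 'k) comodule" and V :: "('b, int \<times> nat, 'k) comodule"
    and U' :: "('c, int \<times> nat, 'k) comodule" and V' :: "('d, int \<times> nat, 'k) comodule"
  assumes "comod q U" "comod q U'" "comodule_iso U U'" "comod q V" "comod q V'" "comodule_iso V V'"
  shows "chr (tp q U V) = chr (tp q U' V')"
  by (rule chr_iso[OF comod_tensor[OF q(1) assms(1,4)] tensor_iso[OF q(1) assms]])

lemma chr_tensor_sum_left:
  assumes "comod q A" "comod q B" "comod q N"
  shows "chr (tp q (direct_sum A B) N) = chr (tp q A N) + chr (tp q B N)"
  using chr_iso[OF comod_direct_sum[OF comod_tensor[OF q(1) assms(1,3)] comod_tensor[OF q(1) assms(2,3)]]
      tensor_direct_sum_left[OF q(1) assms]]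
    chr_direct_sum[OF comod_tensor[OF q(1) assms(1,3)] comod_tensor[OF q(1) assms(2,3)]]
  by simp

lemma chr_tensor_sum_right:
  assumes "comod q A" "comod q B" "comod q N"
  shows "chr (tp q N (direct_sum A B)) = chr (tp q N A) + chr (tp q N B)"
  using chr_iso[OF comod_direct_sum[OF comod_tensor[OF q(1) assms(3,1)] comod_tensor[OF q(1) assms(3,2)]]
      tensor_direct_sum_right[OF q(1) assms]]
    chr_direct_sum[OF comod_tensor[OF q(1) assms(3,1)] comod_tensor[OF q(1) assms(3,2)]]
  by simp

text \<open>A definition cannot quantify over the basis type of \<open>N\<close>, so
  \<open>nat\<close> is fixed here; \<open>multiplicativeD\<close> extends the property to all basis
  types by isomorphism.\<close>

definition multiplicative :: "('b, int \<times> nat, 'k) comodule \<Rightarrow> bool" where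
  "multiplicative M \<longleftrightarrow>
     (\<forall>N :: (nat, int \<times> nat, 'k) comodule. comod q N \<longrightarrow> chr (tp q M N) = chr M * chr N)"

lemma multiplicativeD:
  fixes M :: "('a, int \<times> nat, 'k) comodule" and N :: "('b, int \<times> nat, 'k) comodule"
  assumes "multiplicative M" and M: "comod q M" and N: "comod q N"
  shows "chr (tp q M N) = chr M * chr N"
proof -
  obtain U :: "(nat, int \<times> nat, 'k) comodule" where U: "comod q U" "comodule_iso U N"
    using nat_comodule[OF N] by metis
  have "chr (tp q M U) = chr (tp q M N)"
    by (rule chr_tensor_iso[OF M M comodule_iso_refl[OF M] U(1) N U(2)])
  then show ?thesis
    using assms(1) U chr_iso[OF U] by (simp add: multiplicative_def)
qed

lemma multiplicative_iso:
  fixes M :: "('a, int \<times> nat, 'k) comodule" and M' :: "('b, int \<times> nat, 'k) comodule"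
  assumes M: "comod q M" "comod q M'" "comodule_iso M M'" and "multiplicative M"
  shows "multiplicative M'"
  unfolding multiplicative_def
proof (intro allI impI)
  fix N :: "(nat, int \<times> nat, 'k) comodule" assume N: "comod q N"
  show "chr (tp q M' N) = chr M' * chr N"
    using chr_tensor_iso[OF M N N comodule_iso_refl[OF N]] chr_iso[OF M(1,3)] assms(4) N
    by (simp add: multiplicative_def)
qed

text \<open>Rebracketing lets \<open>B\<close> act on \<open>N\<close> first, which reduces products
  of the generators to the generators themselves.\<close>

lemma multiplicative_tensor:
  fixes A :: "('a, int \<times> nat, 'k) comodule" and B :: "('b, int \<times> nat, 'k) comodule"
  assumes A: "comod q A" "multiplicative A" and B: "comod q B" "multiplicative B"
  shows "multiplicative (tp q A B)"
  unfolding multiplicative_def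
proof (intro allI impI)
  fix N :: "(nat, int \<times> nat, 'k) comodule" assume N: "comod q N"
  have "chr (tp q (tp q A B) N) = chr (tp q A (tp q B N))"
    by (rule chr_iso[OF comod_tensor[OF q(1) comod_tensor[OF q(1) A(1) B(1)] N] tensor_assoc[OF q(1) A(1) B(1) N]])
  also have "\<dots> = chr A * (chr B * chr N)"
    by (simp add: multiplicativeD[OF A(2,1)] multiplicativeD[OF B(2,1)] comod_tensor[OF q(1) B(1) N] N)
  finally show "chr (tp q (tp q A B) N) = chr (tp q A B) * chr N"
    by (simp add: multiplicativeD[OF A(2,1) B(1)] mult.assoc)
qed

text \<open>Both sides of multiplicativity are additive in the left factor, so the contribution of
  \<open>B\<close> cancels. The forward direction extracts a new string from a product whose other
  summand is already understood.\<close>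

lemma multiplicative_sum_iff:
  fixes A :: "('a, int \<times> nat, 'k) comodule" and B :: "('b, int \<times> nat, 'k) comodule"
  assumes A: "comod q A" and B: "comod q B" "multiplicative B"
  shows "multiplicative (direct_sum A B) \<longleftrightarrow> multiplicative A"
  using B(2) unfolding multiplicative_def
  by (simp add: chr_tensor_sum_left[OF A B(1)] chr_direct_sum[OF A B(1)] distrib_right)

text \<open>Both sides are additive in the right factor, so testing on strings is enough.\<close>

lemma multiplicative_by_strings:
  assumes A: "comod q A"
    and strings: "\<And>j l. chr (tp q A (string j l)) = chr A * string_poly j l"
  shows "multiplicative A"
  unfolding multiplicative_def
proof (intro allI impI)
  fix N :: "(nat, int \<times> nat, 'k) comodule" assume "comod q N"
  then show "chr (tp q A N) = chr A * chr N"
  proof (induction rule: comodule_string_induct)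
    case (empty M)
    then show ?case
      by (simp add: chr_empty)
  next
    case (step i l M U)
    have "chr (tp q A M) = chr (tp q A (direct_sum (string i l) U))"
      by (rule chr_tensor_iso[OF A A comodule_iso_refl[OF A] comod_direct_sum[OF comod_string step(2)] step(1,3), symmetric])
    also have "\<dots> = chr A * string_poly i l + chr A * chr U"
      by (simp add: chr_tensor_sum_right[OF comod_string step(2) A] strings step.IH)
    also have "\<dots> = chr A * chr (direct_sum (string i l :: (nat, int \<times> nat, 'k) comodule) U)"
      by (simp add: chr_direct_sum[OF comod_string step(2)] chr_string distrib_left)
    finally show ?case
      by (simp add: chr_iso[OF comod_direct_sum[OF comod_string step(2)] step(3)])
  qed
qed

lemma multiplicative_string_0: "multiplicative (string i 0)"
proof (rule multiplicative_by_strings[OF comod_string])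
  fix j l
  show "chr (tp q (string i 0) (string j l)) = chr (string i 0 :: (nat, int \<times> nat, 'k) comodule) * string_poly j l"
    using chr_iso[OF comod_string string_tensor_string_0[OF q(1), of i j l]]
    by (simp add: chr_string laurent_mon_string_poly)
qed

lemma multiplicative_gen: "multiplicative (string 0 1)"
proof (rule multiplicative_by_strings[OF comod_string])
  fix j l
  show "chr (tp q (string 0 1) (string j l)) = chr (string 0 1 :: (nat, int \<times> nat, 'k) comodule) * string_poly j l"
  proof (cases "l = 0")
    case True
    then show ?thesis
      using chr_iso[OF comod_string tensor_gen_string_0[OF q True, of j]]
      by (simp add: chr_string laurent_mon_mult)
  next
    case False
    then show ?thesis
      using chr_iso[OF comod_direct_sum[OF comod_string comod_string] tensor_gen_string_Suc[OF q, of l j]]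
        gen_string_poly[of j l]
      by (simp add: chr_direct_sum[OF comod_string[of q] comod_string[of q]] chr_string laurent_mon_mult)
  qed
qed

lemma multiplicative_string: "multiplicative (string i l)"
proof (induction l arbitrary: i rule: less_induct)
  case (less l)
  show ?case
  proof (cases l)
    case 0
    then show ?thesis
      by (simp add: multiplicative_string_0)
  next
    case (Suc m)
    \<comment> \<open>\<open>?P\<close> is multiplicative as a product, and it consists of the
      wanted string and, for \<open>m > 0\<close>, the shorter
      \<open>string (i + 1) (m - 1)\<close>. The latter is covered by the hypothesis because the
      induction is a strong one.\<close>
    let ?P = "tp q (string 0 1) (string i m)"
    have P: "comod q ?P" "multiplicative ?P"
      using less.IH[of m i] Suc
      by (intro comod_tensor[OF q(1) comod_string comod_string]
          multiplicative_tensor[OF comod_string multiplicative_gen comod_string]; simp)+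
    show ?thesis
    proof (cases "m = 0")
      case True
      then show ?thesis
        using multiplicative_iso[OF P(1) comod_string _ P(2)] Suc
          comodule_iso_sym[OF comod_string tensor_gen_string_0[OF q True, of i]] by simp
    next
      case False
      let ?S = "direct_sum (string i (Suc m)) (string (i + 1) (m - 1)) :: (nat + nat, int \<times> nat, 'k) comodule"
      have S: "comod q ?S"
        by (rule comod_direct_sum[OF comod_string comod_string])
      have "multiplicative ?S"
        using False by (intro multiplicative_iso[OF P(1) S _ P(2)] comodule_iso_sym[OF S] tensor_gen_string_Suc[OF q]) simp
      then show ?thesis
        using multiplicative_sum_iff[OF comod_string comod_string less.IH[of "m - 1" "i + 1"]] Suc by simp
    qed
  qed
qed

lemma multiplicative_comod:
  assumes "comod q M"
  shows "multiplicative (M :: (nat, int \<times> nat, 'k) comodule)"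
  using assms
proof (induction rule: comodule_string_induct)
  case (empty M)
  then show ?case
    by (simp add: multiplicative_def chr_empty)
next
  case (step i l M U)
  have "multiplicative (direct_sum (string i l) U)"
    by (simp add: multiplicative_sum_iff[OF comod_string step(2) step.IH] multiplicative_string)
  then show ?case
    by (rule multiplicative_iso[OF comod_direct_sum[OF comod_string step(2)] step(1,3)])
qed

lemma chr_tensor:
  fixes M N :: "(nat, int \<times> nat, 'k) comodule"
  assumes "comod q M" "comod q N"
  shows "chr (tp q M N) = chr M * chr N"
  by (rule multiplicativeD[OF multiplicative_comod[OF assms(1)] assms])

section \<open>The Green ring\<close>

abbreviation cls :: "('b, int \<times> nat, 'k) comodule \<Rightarrow> (int \<times> nat, 'k) object_class" where
  "cls M \<equiv> iso_class (path_hopf q) M"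

lemma iso_class_eq:
  fixes M :: "('a, int \<times> nat, 'k) comodule" and N :: "('b, int \<times> nat, 'k) comodule"
  assumes "comod q M" "comodule_iso M N"
  shows "cls M = cls N"
proof -
  have "comodule_iso U M \<longleftrightarrow> comodule_iso U N" for U :: "(nat, int \<times> nat, 'k) comodule"
    using comodule_iso_trans[of U M N] comodule_iso_trans[of U N M] assms(2) comodule_iso_sym[OF assms] by blast
  then show ?thesis
    by (simp add: iso_class_def)
qed

lemma cls_in_iso_classes:
  fixes M :: "('a, int \<times> nat, 'k) comodule"
  assumes "comod q M"
  shows "cls M \<in> iso_classes (path_hopf q)"
proof -
  obtain U :: "(nat, int \<times> nat, 'k) comodule" where "comod q U" "comodule_iso U M"
    using nat_comodule[OF assms] by metis
  then show ?thesis
    using iso_class_eq unfolding iso_classes_def by blast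
qed

definition class_chr :: "(int \<times> nat, 'k) object_class \<Rightarrow> (int \<times> nat \<Rightarrow>\<^sub>0 int)" where
  "class_chr A = chr (SOME M. M \<in> A)"

lemma class_chr_cls:
  fixes M :: "('a, int \<times> nat, 'k) comodule"
  assumes "comod q M"
  shows "class_chr (cls M) = chr M"
proof -
  have "\<exists>U. U \<in> cls M"
    using nat_comodule[OF assms] unfolding iso_class_def by blast
  then have "(SOME U. U \<in> cls M) \<in> cls M"
    by (rule someI_ex)
  then show ?thesis
    unfolding class_chr_def by (auto simp: iso_class_def intro: chr_iso)
qed

text \<open>\<open>tensor_class\<close> is a union over all pairs of representatives; by
  \<open>tensor_iso\<close> all members of the union are the same class.\<close>

lemma tensor_class_cls:
  fixes U V :: "(nat, int \<times> nat, 'k) comodule"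
  assumes U: "comod q U" and V: "comod q V"
  shows "tensor_class (path_hopf q) (cls U) (cls V) = cls (tp q U V)"
proof -
  have "cls (tp q U' V') = cls (tp q U V)" if "U' \<in> cls U" "V' \<in> cls V" for U' V'
    using that U V
    by (intro iso_class_eq comod_tensor tensor_iso q(1)) (auto simp: iso_class_def)
  moreover have "U \<in> cls U" "V \<in> cls V"
    using U V comodule_iso_refl by (auto simp: iso_class_def)
  ultimately show ?thesis
    unfolding tensor_class_def by blast
qed

section \<open>The comparison map on formal sums of classes\<close>

abbreviation "green_classes \<equiv> iso_classes (path_hopf q)"
abbreviation "green_free \<equiv> free_green_ring (path_hopf q)"
abbreviation "green_rels \<equiv> generate (free_Abelian_group green_classes) (split_relations (path_hopf q))"

lemma iso_classesE:
  assumes "A \<in> green_classes"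
  obtains U :: "(nat, int \<times> nat, 'k) comodule" where "comod q U" "A = cls U"
  using assms unfolding iso_classes_def by blast

definition ring_chr :: "((int \<times> nat, 'k) object_class \<Rightarrow>\<^sub>0 int) \<Rightarrow> (int \<times> nat \<Rightarrow>\<^sub>0 int)" where
  "ring_chr = frag_extend class_chr"

lemma ring_chr_cls:
  fixes M :: "('a, int \<times> nat, 'k) comodule"
  assumes "comod q M"
  shows "ring_chr (frag_of (cls M)) = chr M"
  by (simp add: ring_chr_def class_chr_cls[OF assms])

lemma ring_chr_diff: "ring_chr (x - y) = ring_chr x - ring_chr y"
  and ring_chr_add: "ring_chr (x + y) = ring_chr x + ring_chr y"
  and ring_chr_minus: "ring_chr (- x) = - ring_chr x"
  and ring_chr_0: "ring_chr 0 = 0"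
  by (simp_all add: ring_chr_def frag_extend_diff frag_extend_add frag_extend_minus)

text \<open>Supplies additivity of the free product in its second argument, which sits inside the
  function being extended.\<close>

lemma frag_extend_fun_diff:
  "frag_extend (\<lambda>A. f A - g A) a = frag_extend f a - frag_extend g a"
  by (rule frag_hom_eqI[of "frag_extend (\<lambda>A. f A - g A)"]) (simp_all add: frag_extend_diff)

text \<open>Closure and multiplicativity are both stable under differences in either argument, so
  one double induction reduces them to a pair of classes, where \<open>chr_tensor\<close>
  applies.\<close>

lemma mult_closed_chr:
  assumes "Poly_Mapping.keys a \<subseteq> green_classes" "Poly_Mapping.keys b \<subseteq> green_classes"
  shows "Poly_Mapping.keys (a \<otimes>\<^bsub>green_free\<^esub> b) \<subseteq> green_classes \<and> ring_chr (a \<otimes>\<^bsub>green_free\<^esub> b) = ring_chr a * ring_chr b"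
proof -
  let ?t = "\<lambda>a b. frag_extend (\<lambda>A. frag_extend (\<lambda>B. frag_of (tensor_class (path_hopf q) A B)) b) a"
  have diff: "?t (a - a') b = ?t a b - ?t a' b" "?t a (b - b') = ?t a b - ?t a b'" for a a' b b'
    by (simp_all add: frag_extend_diff frag_extend_fun_diff)
  have keys: "Poly_Mapping.keys (x - y) \<subseteq> green_classes" if "Poly_Mapping.keys x \<subseteq> green_classes" "Poly_Mapping.keys y \<subseteq> green_classes"
    for x y :: "(int \<times> nat, 'k) object_class \<Rightarrow>\<^sub>0 int"
    using keys_diff[of x y] that by blast
  define Q where "Q a b \<longleftrightarrow> Poly_Mapping.keys (?t a b) \<subseteq> green_classes \<and> ring_chr (?t a b) = ring_chr a * ring_chr b" for a b
  have Q_0: "Q 0 b" "Q a 0" for a b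
    by (simp_all add: Q_def ring_chr_0 frag_extend_eq_0)
  have Q_diff: "Q a b \<Longrightarrow> Q a' b \<Longrightarrow> Q (a - a') b" "Q a b \<Longrightarrow> Q a b' \<Longrightarrow> Q a (b - b')" for a a' b b'
    unfolding Q_def by (simp_all only: diff keys ring_chr_diff left_diff_distrib right_diff_distrib)
  have Q_cls: "Q (frag_of A) (frag_of B)" if AB: "A \<in> green_classes" "B \<in> green_classes" for A B
  proof -
    obtain U :: "(nat, int \<times> nat, 'k) comodule" where U: "comod q U" "A = cls U"
      using AB(1) by (rule iso_classesE)
    obtain V :: "(nat, int \<times> nat, 'k) comodule" where V: "comod q V" "B = cls V"
      using AB(2) by (rule iso_classesE)
    note T = comod_tensor[OF q(1) U(1) V(1)]
    show ?thesis
      by (simp add: Q_def U V tensor_class_cls[OF U(1) V(1)] cls_in_iso_classes[OF T] ring_chr_cls[OF T]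
          ring_chr_cls[OF U(1)] ring_chr_cls[OF V(1)] chr_tensor[OF U(1) V(1)])
  qed
  have "Q (frag_of A) b" if "A \<in> green_classes" for A
    by (rule free_Abelian_group_induct[OF assms(2)]) (simp_all add: Q_0 Q_diff Q_cls that)
  then have "Q a b"
    by (intro free_Abelian_group_induct[OF assms(1), of "\<lambda>a. Q a b"]) (simp_all add: Q_0 Q_diff)
  then show ?thesis
    by (simp add: free_green_ring_def Q_def)
qed

section \<open>The subgroup of split relations as the kernel of the comparison map\<close>

lemma split_relations_subset: "split_relations (path_hopf q) \<subseteq> carrier (free_Abelian_group green_classes)"
proof
  fix x assume "x \<in> split_relations (path_hopf q)"
  then obtain U V :: "(nat, int \<times> nat, 'k) comodule" where UV: "comod q U" "comod q V"
    and x: "x = frag_of (cls (direct_sum U V)) - (frag_of (cls U) + frag_of (cls V))"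
    unfolding split_relations_def by blast
  have "Poly_Mapping.keys x \<subseteq> {cls (direct_sum U V), cls U, cls V}"
    unfolding x using keys_diff keys_add by fastforce
  then show "x \<in> carrier (free_Abelian_group green_classes)"
    using cls_in_iso_classes[OF UV(1)] cls_in_iso_classes[OF UV(2)] cls_in_iso_classes[OF comod_direct_sum[OF UV]]
    by auto
qed

lemma subgroup_green_rels: "subgroup green_rels (free_Abelian_group green_classes)"
  by (rule group.generate_is_subgroup[OF group_free_Abelian_group split_relations_subset])

lemma green_rels_keys: "x \<in> green_rels \<Longrightarrow> Poly_Mapping.keys x \<subseteq> green_classes"
  using subgroup.mem_carrier[OF subgroup_green_rels] by simp

lemma green_rels_0: "0 \<in> green_rels"
  using subgroup.one_closed[OF subgroup_green_rels] by simp

lemma green_rels_add: "x \<in> green_rels \<Longrightarrow> y \<in> green_rels \<Longrightarrow> x + y \<in> green_rels"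
  using subgroup.m_closed[OF subgroup_green_rels] by simp

lemma green_rels_minus: "x \<in> green_rels \<Longrightarrow> - x \<in> green_rels"
  using subgroup.m_inv_closed[OF subgroup_green_rels, of x] green_rels_keys[of x] by simp

lemma green_rels_diff: "x \<in> green_rels \<Longrightarrow> y \<in> green_rels \<Longrightarrow> x - y \<in> green_rels"
  using green_rels_add[OF _ green_rels_minus, of x y] by simp

lemma green_rels_relation:
  fixes U V :: "(nat, int \<times> nat, 'k) comodule"
  assumes "comod q U" "comod q V"
  shows "frag_of (cls (direct_sum U V)) - (frag_of (cls U) + frag_of (cls V)) \<in> green_rels"
  by (rule generate.incl) (use assms in \<open>auto simp: split_relations_def\<close>)

lemma ring_chr_green_rels: "x \<in> green_rels \<Longrightarrow> ring_chr x = 0"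
proof (induction rule: generate.induct)
  case (incl h)
  then show ?case
    by (auto simp: split_relations_def ring_chr_diff ring_chr_add ring_chr_cls chr_direct_sum comod_direct_sum)
next
  case (inv h)
  then have "ring_chr h = 0"
    by (auto simp: split_relations_def ring_chr_diff ring_chr_add ring_chr_cls chr_direct_sum comod_direct_sum)
  then show ?case
    using inv split_relations_subset by (auto simp: ring_chr_minus)
qed (simp_all add: ring_chr_0 ring_chr_add)

definition of_strings :: "(int \<times> nat \<Rightarrow>\<^sub>0 int) \<Rightarrow> ((int \<times> nat, 'k) object_class \<Rightarrow>\<^sub>0 int)" where
  "of_strings = frag_extend (\<lambda>(i, l). frag_of (cls (string i l)))"

lemma of_strings_diff: "of_strings (x - y) = of_strings x - of_strings y"
  and of_strings_add: "of_strings (x + y) = of_strings x + of_strings y"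
  by (simp_all add: of_strings_def frag_extend_diff frag_extend_add)

lemma keys_of_strings: "Poly_Mapping.keys (of_strings x) \<subseteq> green_classes"
  unfolding of_strings_def
  by (rule order_trans[OF keys_frag_extend]) (auto simp: cls_in_iso_classes[OF comod_string])

lemma ring_chr_of_strings: "ring_chr (of_strings x) = string_eval x"
proof (rule frag_hom_eqI[of "\<lambda>x. ring_chr (of_strings x)"])
  fix a :: "int \<times> nat"
  show "ring_chr (of_strings (frag_of a)) = string_eval (frag_of a)"
    by (cases a) (simp add: of_strings_def ring_chr_cls[OF comod_string] chr_string string_eval_def)
qed (simp_all add: of_strings_diff ring_chr_diff string_eval_diff)

text \<open>Strings generate the Green group, with the coefficients given by the rank formula; each
  splitting step costs one defining relation.\<close>

lemma cls_of_strings: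
  assumes "comod q M"
  shows "frag_of (cls (M :: (nat, int \<times> nat, 'k) comodule)) - of_strings (string_mult M) \<in> green_rels"
  using assms
proof (induction rule: comodule_string_induct)
  case (empty M)
  \<comment> \<open>Recovered from the vanishing of \<open>chr M\<close>, since
    \<open>string_expand\<close> inverts \<open>string_eval\<close>.\<close>
  have "string_mult M = 0"
    using chr_empty[OF empty(2)] string_expand_eval[of "string_mult M"] by (simp add: chr_def string_expand_def)
  moreover have "comodule_iso (direct_sum M M) M"
    by (rule comodule_isoI[of _ _ "\<lambda>_. 0"])
      (use empty(2) in \<open>auto simp: morph_def lin_const_zero vspace_def bij_betw_def Plus_def\<close>)
  then have "cls (direct_sum M M) = cls M"
    by (rule iso_class_eq[OF comod_direct_sum[OF empty(1,1)]])
  \<comment> \<open>A zero comodule is isomorphic to the sum of two copies of itself, and the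
    corresponding relation reads minus its class.\<close>
  then have "frag_of (cls M) - (frag_of (cls M) + frag_of (cls M)) \<in> green_rels"
    using green_rels_relation[OF empty(1,1)] by metis
  then have "frag_of (cls M) \<in> green_rels"
    using green_rels_minus by fastforce
  ultimately show ?case
    by (simp add: of_strings_def)
next
  case (step i l M U)
  let ?S = "string i l :: (nat, int \<times> nat, 'k) comodule"
  have S: "comod q ?S" "comod q (direct_sum ?S U)"
    by (rule comod_string, rule comod_direct_sum[OF comod_string step(2)])
  have "string_mult M = frag_of (i, l) + string_mult U"
    using string_mult_iso[OF S(2) step(3)] string_mult_direct_sum[OF S(1) step(2)] by (simp add: string_mult_string)
  moreover have "cls M = cls (direct_sum ?S U)"
    by (rule iso_class_eq[OF S(2) step(3), symmetric])
  moreover have "of_strings (frag_of (i, l)) = frag_of (cls ?S)"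
    by (simp add: of_strings_def)
  ultimately have "frag_of (cls M) - of_strings (string_mult M)
     = (frag_of (cls (direct_sum ?S U)) - (frag_of (cls ?S) + frag_of (cls U)))
       + (frag_of (cls U) - of_strings (string_mult U))"
    by (simp add: of_strings_add)
  then show ?case
    using green_rels_add[OF green_rels_relation[OF S(1) step(2)] step.IH] by simp
qed

text \<open>On a class, \<open>string_expand\<close> turns \<open>chr\<close> back into the string
  multiplicities, so this is \<open>cls_of_strings\<close> extended additively. An element with zero
  image is thereby forced into the relations.\<close>

lemma diff_of_strings_in_green_rels:
  assumes "Poly_Mapping.keys x \<subseteq> green_classes"
  shows "x - of_strings (string_expand (ring_chr x)) \<in> green_rels"
proof (rule free_Abelian_group_induct[OF assms])
  show "0 - of_strings (string_expand (ring_chr 0)) \<in> green_rels"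
    using green_rels_0 by (simp add: ring_chr_0 string_expand_def of_strings_def)
next
  fix x y
  assume "x - of_strings (string_expand (ring_chr x)) \<in> green_rels" "y - of_strings (string_expand (ring_chr y)) \<in> green_rels"
  then show "x - y - of_strings (string_expand (ring_chr (x - y))) \<in> green_rels"
    using green_rels_diff by (fastforce simp: ring_chr_diff string_expand_diff of_strings_diff algebra_simps)
next
  fix A assume "A \<in> green_classes"
  then obtain U :: "(nat, int \<times> nat, 'k) comodule" where "comod q U" "A = cls U"
    by (rule iso_classesE)
  then show "frag_of A - of_strings (string_expand (ring_chr (frag_of A))) \<in> green_rels"
    using cls_of_strings[of U] by (simp add: ring_chr_cls chr_def string_expand_eval)
qed

lemma ring_chr_kernel:
  assumes "Poly_Mapping.keys x \<subseteq> green_classes" "ring_chr x = 0"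
  shows "x \<in> green_rels"
  using diff_of_strings_in_green_rels[OF assms(1)] assms(2) by (simp add: string_expand_def of_strings_def)

lemma unit_iso: "comodule_iso (string 0 0) (unit_comodule (path_hopf q))"
proof (rule comodule_isoI)
  let ?F = "lin_ext (\<lambda>_. bvec ()) :: (nat \<Rightarrow>\<^sub>0 'k) \<Rightarrow> (unit \<Rightarrow>\<^sub>0 'k)"
  let ?U = "unit_comodule (path_hopf q)"
  have act: "act ?U h (bvec ()) = (if h = (0, 0) then bvec () else 0)" for h
    by (auto simp: act_bvec unit_comodule_def slice_bvec path_hopf_def)
  have "act ?U h (?F v) = ?F (act (string 0 0) h v)" if "v \<in> vspace {..0}" for h v
    by (rule lin_eq_on[OF lin_compose[OF lin_lin_ext lin_act] lin_compose[OF lin_act lin_lin_ext] that])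
      (cases h, simp add: act act_string_bvec lin_0[OF lin_lin_ext])
  then show "morph (string 0 0) ?U ?F"
    by (auto simp: morph_def lin_lin_ext unit_comodule_def vspace_def)
  show "bij_betw ?F (vspace (basis (string 0 0 :: (nat, int \<times> nat, 'k) comodule))) (vspace (basis ?U))"
  proof (rule lin_surj_imp_bij[OF lin_lin_ext])
    show "bvec t \<in> ?F ` vspace (basis (string 0 0 :: (nat, int \<times> nat, 'k) comodule))" for t
      by (rule image_eqI[of _ _ "bvec 0"]) simp_all
  qed (auto simp: unit_comodule_def vspace_def)
qed

lemma green_ring_iso: "green_ring (path_hopf q) \<simeq> laurent_xy"
proof -
  let ?H = "path_hopf q"
  let ?cos = "\<lambda>x. green_rels +>\<^bsub>green_free\<^esub> x"
  \<comment> \<open>The value at a coset is read from an arbitrary representative; this is sound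
    because \<open>ring_chr\<close> vanishes on the relations.\<close>
  define h where "h S = ring_chr (SOME x. x \<in> S)" for S
  have carrier_free: "x \<in> carrier green_free \<longleftrightarrow> Poly_Mapping.keys x \<subseteq> green_classes" for x
    by (simp add: free_green_ring_def)
  have cos: "y \<in> ?cos x \<longleftrightarrow> (\<exists>z\<in>green_rels. y = z + x)" for x y
    by (auto simp: a_r_coset_def' free_green_ring_def)
  have cos_self: "x \<in> ?cos x" for x
    using green_rels_0 by (auto simp: cos)
  have cosD: "Poly_Mapping.keys y \<subseteq> green_classes \<and> ring_chr y = ring_chr x"
    if "y \<in> ?cos x" "Poly_Mapping.keys x \<subseteq> green_classes" for x y
    using that keys_add by (fastforce simp: cos ring_chr_add ring_chr_green_rels dest: green_rels_keys)
  have h: "h S = p" if "x \<in> S" "\<And>x. x \<in> S \<Longrightarrow> ring_chr x = p" for S x p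
    unfolding h_def using that someI[of "\<lambda>x. x \<in> S" x] by blast
  have h_cos: "h (?cos x) = ring_chr x" if "Poly_Mapping.keys x \<subseteq> green_classes" for x
    by (rule h[OF cos_self]) (use cosD that in blast)
  have carrier_green: "carrier (green_ring ?H) = {?cos x |x. Poly_Mapping.keys x \<subseteq> green_classes}"
    by (auto simp: green_ring_def FactRing_def A_RCOSETS_def' carrier_free)
  have "h \<in> ring_hom (green_ring ?H) laurent_xy"
  proof (rule ring_hom_memI)
    show "h S \<in> carrier laurent_xy" for S
      by (simp add: ring_of_type_algebra_def)
    have one: "\<one>\<^bsub>green_free\<^esub> = frag_of (cls (unit_comodule ?H))"
      by (simp add: free_green_ring_def)
    have unit: "cls (unit_comodule ?H) = cls (string 0 0)"
      by (rule iso_class_eq[OF comod_string unit_iso, symmetric])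
    have "h (?cos \<one>\<^bsub>green_free\<^esub>) = 1"
      unfolding one unit
      by (subst h_cos) (simp_all add: cls_in_iso_classes[OF comod_string] ring_chr_cls[OF comod_string] chr_string laurent_mon_0)
    then show "h \<one>\<^bsub>green_ring ?H\<^esub> = \<one>\<^bsub>laurent_xy\<^esub>"
      by (simp add: green_ring_def FactRing_def ring_of_type_algebra_def)
  next
    fix S T assume "S \<in> carrier (green_ring ?H)" "T \<in> carrier (green_ring ?H)"
    then obtain x y where S: "S = ?cos x" "Poly_Mapping.keys x \<subseteq> green_classes" and T: "T = ?cos y" "Poly_Mapping.keys y \<subseteq> green_classes"
      unfolding carrier_green by blast
    have add: "S \<oplus>\<^bsub>green_ring ?H\<^esub> T = {a + b |a b. a \<in> S \<and> b \<in> T}"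
      by (auto simp: green_ring_def FactRing_def set_add_def set_mult_def free_green_ring_def)
    have "h (S \<oplus>\<^bsub>green_ring ?H\<^esub> T) = ring_chr x + ring_chr y"
    proof (rule h)
      show "x + y \<in> S \<oplus>\<^bsub>green_ring ?H\<^esub> T"
        unfolding add using cos_self S T by blast
      show "ring_chr z = ring_chr x + ring_chr y" if "z \<in> S \<oplus>\<^bsub>green_ring ?H\<^esub> T" for z
        using that cosD S T unfolding add by (auto simp: ring_chr_add)
    qed
    then show "h (S \<oplus>\<^bsub>green_ring ?H\<^esub> T) = h S \<oplus>\<^bsub>laurent_xy\<^esub> h T"
      by (simp add: S T h_cos ring_of_type_algebra_def)
    \<comment> \<open>The quotient product is a union of cosets over all pairs of representatives,
      so \<open>ring_chr\<close> has to be shown constant on that whole union.\<close>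
    have mult: "S \<otimes>\<^bsub>green_ring ?H\<^esub> T = (\<Union>a\<in>S. \<Union>b\<in>T. ?cos (a \<otimes>\<^bsub>green_free\<^esub> b))"
      by (simp add: green_ring_def FactRing_def rcoset_mult_def)
    have "h (S \<otimes>\<^bsub>green_ring ?H\<^esub> T) = ring_chr x * ring_chr y"
    proof (rule h)
      show "x \<otimes>\<^bsub>green_free\<^esub> y \<in> S \<otimes>\<^bsub>green_ring ?H\<^esub> T"
        unfolding mult using cos_self S T by blast
      fix z assume "z \<in> S \<otimes>\<^bsub>green_ring ?H\<^esub> T"
      then obtain a b where ab: "a \<in> S" "b \<in> T" "z \<in> ?cos (a \<otimes>\<^bsub>green_free\<^esub> b)"
        unfolding mult by blast
      have a: "Poly_Mapping.keys a \<subseteq> green_classes" "ring_chr a = ring_chr x" and b: "Poly_Mapping.keys b \<subseteq> green_classes" "ring_chr b = ring_chr y"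
        using ab S T cosD by blast+
      show "ring_chr z = ring_chr x * ring_chr y"
        using cosD[OF ab(3)] mult_closed_chr[OF a(1) b(1)] a b by simp
    qed
    then show "h (S \<otimes>\<^bsub>green_ring ?H\<^esub> T) = h S \<otimes>\<^bsub>laurent_xy\<^esub> h T"
      by (simp add: S T h_cos ring_of_type_algebra_def)
  qed
  moreover have "bij_betw h (carrier (green_ring ?H)) (carrier laurent_xy)"
  proof (rule bij_betwI')
    show "h S \<in> carrier laurent_xy" for S
      by (simp add: ring_of_type_algebra_def)
  next
    fix S T assume "S \<in> carrier (green_ring ?H)" "T \<in> carrier (green_ring ?H)"
    then obtain x y where S: "S = ?cos x" "Poly_Mapping.keys x \<subseteq> green_classes" and T: "T = ?cos y" "Poly_Mapping.keys y \<subseteq> green_classes"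
      unfolding carrier_green by blast
    show "h S = h T \<longleftrightarrow> S = T"
    proof
      assume "h S = h T"
      then have "ring_chr (x - y) = 0"
        using S T h_cos by (simp add: ring_chr_diff)
      moreover have "Poly_Mapping.keys (x - y) \<subseteq> green_classes"
        using keys_diff[of x y] S T by blast
      ultimately have xy: "x - y \<in> green_rels"
        by (intro ring_chr_kernel)
      \<comment> \<open>A translate by \<open>x\<close> is a translate by \<open>y\<close> with the
        relation \<open>x - y\<close> absorbed; the converse inclusion subtracts it.\<close>
      have "z + x \<in> ?cos y" if "z \<in> green_rels" for z
        unfolding cos by (rule bexI[OF _ green_rels_add[OF that xy]]) simp
      moreover have "z + y \<in> ?cos x" if "z \<in> green_rels" for z
        unfolding cos by (rule bexI[OF _ green_rels_diff[OF that xy]]) simp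
      ultimately show "S = T"
        unfolding S T by (auto simp: cos)
    qed simp
  next
    fix p :: "int \<times> nat \<Rightarrow>\<^sub>0 int"
    \<comment> \<open>The polynomial is expanded in the string basis, and every string is replaced
      by its class.\<close>
    let ?x = "of_strings (string_expand p)"
    show "\<exists>S\<in>carrier (green_ring ?H). p = h S"
    proof (rule bexI[of _ "?cos ?x"])
      show "p = h (?cos ?x)"
        by (simp add: h_cos[OF keys_of_strings] ring_chr_of_strings string_eval_expand)
      show "?cos ?x \<in> carrier (green_ring ?H)"
        unfolding carrier_green using keys_of_strings by blast
    qed
  qed
  ultimately show ?thesis
    unfolding is_ring_iso_def ring_iso_def by blast
qed

end

theorem theorem4p8:
  fixes q :: "'k::{alg_closed_field, field_char_0}"
  assumes "q \<noteq> 0"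
    and "q = 1 \<or> (\<forall>n::nat. n > 0 \<longrightarrow> q ^ n \<noteq> 1)"
  shows "green_ring (path_hopf q) \<simeq> laurent_xy"
  by (rule green_ring_iso[OF assms])

end
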